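(* Assume that one of the following holds: (i) $X$ is a Euclidean building and $c$ is a semistable weighted configuration on $\partial_\infty X$; or (ii) $X$ is a locally compact Hadamard space and $c$ is a stable weighted configuration on $\partial_\infty X$. Then the associated weak contraction $\Phi_c : X \to X$ has a fixed point. In particular, there exists a polygon $p$ in $X$ such that $c$ is a Gauss map for $p$.
   Context: A Hadamard space is a complete CAT(0) space (not assumed locally compact or geodesically complete). Geodesics, rays and segments have unit speed. $\partial_\infty X$ is the set of equivalence classes of rays, two rays being equivalent if they have bounded distance. For $x\in X$, $\xi\in\partial_\infty X$, $\overline{x\xi}$ is the unique ray from $x$ in the class $\xi$, and $\overline{x\xi}(t)$ is its point at distance $t$ from $x$. For $\xi,\eta\in\partial_\infty X$, $\angle(\xi,\eta)\in[0,\pi]$ is the Tits angle, $\angle(\xi,\eta)=\lim_{t,t'\to\infty}\tilde\angle_o(\overline{o\xi}(t),\overline{o\eta}(t'))$, where $\tilde\angle_o$ is the Euclidean comparison angle at $o$ (independent of $o\in X$). Weighted configurations: a weighted configuration $c$ on $\partial_\infty X$ is an $n$-tuple $(\xi_1,\dots,\xi_n)$ of points of $\partial_\infty X$ together with weights $m_1,\dots,m_n\in\mathbb{R}_{>0}$. Its slope function is $\mathrm{slope}_c:\partial_\infty X\to\mathbb{R}$, $\mathrm{slope}_c(\xi)=-\sum_{i=1}^n m_i\cos\angle(\xi_i,\xi)$. The configuration $c$ is semistable if $\mathrm{slope}_c\ge 0$ on $\partial_\infty X$, and stable if $\mathrm{slope}_c>0$ on $\partial_\infty X$. Associated weak contraction: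 for $\xi\in\partial_\infty X$, $t\ge0$ put $\phi_{\xi,t}:X\to X$, $\phi_{\xi,t}(x)=\overline{x\xi}(t)$, and $\Phi_c=\phi_{\xi_n,m_n}\circ\dots\circ\phi_{\xi_1,m_1}$ (a 1-Lipschitz map). Polygons and Gauss maps: a polygon $p$ in $X$ is an $n$-tuple $(x_1,\dots,x_n)$ of points of $X$ with $x_i\ne x_{i+1}$ for all $i\in\mathbb{Z}/n\mathbb{Z}$. A weighted configuration $c$ with points $\xi_i$ and weights $m_i$ ($1\le i\le n$) is a Gauss map for $p$ if for all $i$ (indices mod $n$) $x_{i+1}\in\overline{x_i\xi_i}$ and $m_i=d(x_i,x_{i+1})$. Euclidean buildings are understood in the sense of Kleiner–Leeb (not necessarily discrete or locally compact): let $E=\mathbb{R}^n$ and let $W_{\mathrm{aff}}\subset \mathrm{Isom}(E)$ be a group generated by reflections whose rotational part $W$ is finite; put $\Delta=S^{n-1}/W$ (spherical Weyl chamber). A Euclidean building modelled on $(E,W_{\mathrm{aff}})$ is a Hadamard space $X$ such that: (EB1) every nontrivial oriented segment $\overline{xy}$ has a $\Delta$-direction $\theta(\overline{xy})\in\Delta$, with $d_\Delta(\theta(\overline{xy}),\theta(\overline{xz}))\le\tilde\angle_x(y,z)$; (EB2) the angle between $\overline{xy}$ and $\overline{xz}$ lies in the finite set of distances in $S^{n-1}$ between points of the $W$-orbits $\theta(\overline{xy})$ and $\theta(\overline{xz})$; (EB3) there is a collection of isometric embeddings $E\to X$ preserving $\Delta$-directions, closed under precomposition with $W_{\mathrm{aff}}$,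 whose images are called apartments, such that every segment, ray and line is contained in an apartment; (EB4) coordinate changes between apartments are restrictions of isometries in $W_{\mathrm{aff}}$. *)

theory Defs
  imports "HOL-Analysis.Analysis" "HOL-Algebra.Generated_Groups" "HOL-Algebra.Bij"
begin

section \<open>Hadamard spaces\<close>

context metric_space
begin

text \<open>
  A segment from \<open>x\<close> to \<open>y\<close> is a unit-speed parametrization on \<open>[0, dist x y]\<close>; the values of
  the total function \<open>g\<close> outside this interval are irrelevant.
\<close>

definition geodesic_segment :: "'a \<Rightarrow> 'a \<Rightarrow> (real \<Rightarrow> 'a) \<Rightarrow> bool" where
  "geodesic_segment x y g \<longleftrightarrow>
     g 0 = x \<and> g (dist x y) = y \<and>
     (\<forall>s\<in>{0..dist x y}. \<forall>t\<in>{0..dist x y}. dist (g s) (g t) = \<bar>s - t\<bar>)"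

text \<open>
  Comparison of geodesic triangles \<open>x y z\<close> with Euclidean triangles \<open>x' y' z'\<close>.
  Two points on different sides of a triangle lie on two sides with a common vertex, which is
  called \<open>x\<close> here; for two points on one side there is nothing to compare.
\<close>

definition triangle_comparison :: "'a \<Rightarrow> 'a \<Rightarrow> 'a \<Rightarrow> bool" where
  "triangle_comparison x y z \<longleftrightarrow>
     (\<forall>g h. \<forall>x' y' z' p' q' :: real^2. \<forall>s\<in>{0..dist x y}. \<forall>t\<in>{0..dist x z}.
        geodesic_segment x y g \<and> geodesic_segment x z h \<and>
        dist x' y' = dist x y \<and> dist x' z' = dist x z \<and> dist y' z' = dist y z \<and>
        p' \<in> closed_segment x' y' \<and> dist x' p' = s \<and>
        q' \<in> closed_segment x' z' \<and> dist x' q' = t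
        \<longrightarrow> dist (g s) (h t) \<le> dist p' q')"

end

class hadamard_space = complete_space +
  assumes geodesic_space: "\<exists>g. geodesic_segment x y g"
    and triangle_comparison: "triangle_comparison x y z"


section \<open>Angles, rays and the ideal boundary\<close>

definition comparison_angle :: "'a::metric_space \<Rightarrow> 'a \<Rightarrow> 'a \<Rightarrow> real" where
  "comparison_angle x y z =
     arccos (((dist x y)\<^sup>2 + (dist x z)\<^sup>2 - (dist y z)\<^sup>2) / (2 * dist x y * dist x z))"

definition segment_angle :: "'a::hadamard_space \<Rightarrow> 'a \<Rightarrow> 'a \<Rightarrow> real" where
  "segment_angle x y z =
     (THE a. \<forall>g h. geodesic_segment x y g \<and> geodesic_segment x z h \<longrightarrow>
        ((\<lambda>(s, t). comparison_angle x (g s) (h t)) \<longlongrightarrow> a) (at_right 0 \<times>\<^sub>F at_right 0))"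

text \<open>Rays are functions on \<open>[0, \<infinity>)\<close>, made extensional so that equal rays are equal functions.\<close>

definition geodesic_ray :: "(real \<Rightarrow> 'a::metric_space) \<Rightarrow> bool" where
  "geodesic_ray r \<longleftrightarrow>
     r \<in> extensional {0..} \<and> (\<forall>s\<ge>0. \<forall>t\<ge>0. dist (r s) (r t) = \<bar>s - t\<bar>)"

definition geodesic_line :: "(real \<Rightarrow> 'a::metric_space) \<Rightarrow> bool" where
  "geodesic_line l \<longleftrightarrow> (\<forall>s t. dist (l s) (l t) = \<bar>s - t\<bar>)"

definition asymptotic :: "(real \<Rightarrow> 'a::metric_space) rel" where
  "asymptotic = {(r, r'). geodesic_ray r \<and> geodesic_ray r' \<and>
     (\<exists>C. \<forall>t\<ge>0. dist (r t) (r' t) \<le> C)}"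

definition ideal_boundary :: "(real \<Rightarrow> 'a::metric_space) set set" where
  "ideal_boundary = Collect geodesic_ray // asymptotic"

definition ray_from :: "'a::hadamard_space \<Rightarrow> (real \<Rightarrow> 'a) set \<Rightarrow> real \<Rightarrow> 'a" where
  "ray_from x \<xi> = (THE r. r \<in> \<xi> \<and> r 0 = x)"

text \<open>The limit exists and is the same for every base point \<open>b\<close>.\<close>

definition tits_angle :: "(real \<Rightarrow> 'a::hadamard_space) set \<Rightarrow> (real \<Rightarrow> 'a) set \<Rightarrow> real" where
  "tits_angle \<xi> \<eta> =
     (THE a. \<forall>b. ((\<lambda>(t, t'). comparison_angle b (ray_from b \<xi> t) (ray_from b \<eta> t')) \<longlongrightarrow> a)
        (at_top \<times>\<^sub>F at_top))"


section \<open>Weighted configurations, weak contractions, polygons\<close>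

text \<open>An \<open>n\<close>-tuple of points at infinity with weights is a list of pairs (point, weight).\<close>

type_synonym 'a config = "((real \<Rightarrow> 'a) set \<times> real) list"

definition weighted_configuration :: "'a::hadamard_space config \<Rightarrow> bool" where
  "weighted_configuration c \<longleftrightarrow> (\<forall>(\<xi>, m)\<in>set c. \<xi> \<in> ideal_boundary \<and> m > 0)"

definition slope :: "'a::hadamard_space config \<Rightarrow> (real \<Rightarrow> 'a) set \<Rightarrow> real" where
  "slope c \<eta> = - (\<Sum>(\<xi>, m)\<leftarrow>c. m * cos (tits_angle \<xi> \<eta>))"

definition semistable_configuration :: "'a::hadamard_space config \<Rightarrow> bool" where
  "semistable_configuration c \<longleftrightarrow> (\<forall>\<eta>\<in>ideal_boundary. slope c \<eta> \<ge> 0)"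

definition stable_configuration :: "'a::hadamard_space config \<Rightarrow> bool" where
  "stable_configuration c \<longleftrightarrow> (\<forall>\<eta>\<in>ideal_boundary. slope c \<eta> > 0)"

definition push :: "(real \<Rightarrow> 'a::hadamard_space) set \<Rightarrow> real \<Rightarrow> 'a \<Rightarrow> 'a" where
  "push \<xi> t x = ray_from x \<xi> t"

text \<open>\<open>fold\<close> applies the map of the first entry of the list first.\<close>

definition weak_contraction :: "'a::hadamard_space config \<Rightarrow> 'a \<Rightarrow> 'a" where
  "weak_contraction c = fold (\<lambda>(\<xi>, m). push \<xi> m) c"

definition polygon :: "'a list \<Rightarrow> bool" where
  "polygon p \<longleftrightarrow> (\<forall>i<length p. p ! i \<noteq> p ! (Suc i mod length p))"

definition gauss_map :: "'a::hadamard_space config \<Rightarrow> 'a list \<Rightarrow> bool" where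
  "gauss_map c p \<longleftrightarrow> length c = length p \<and>
     (\<forall>i<length p. p ! (Suc i mod length p) \<in> ray_from (p ! i) (fst (c ! i)) ` {0..} \<and>
        snd (c ! i) = dist (p ! i) (p ! (Suc i mod length p)))"


section \<open>Euclidean buildings in the sense of Kleiner and Leeb\<close>

definition rotational_part :: "(real^'d \<Rightarrow> real^'d) \<Rightarrow> real^'d \<Rightarrow> real^'d" where
  "rotational_part w v = w v - w 0"

definition hyperplane_reflections :: "(real^'d \<Rightarrow> real^'d) set" where
  "hyperplane_reflections = {\<lambda>x. x - (2 * (v \<bullet> x - b)) *\<^sub>R v | v b. norm v = 1}"

definition affine_weyl_group :: "(real^'d \<Rightarrow> real^'d) set \<Rightarrow> bool" where
  "affine_weyl_group G \<longleftrightarrow>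
     (\<exists>R\<subseteq>hyperplane_reflections. G = generate (BijGroup UNIV) R) \<and>
     finite (rotational_part ` G)"

text \<open>
  Points of the spherical Weyl chamber \<open>S\<^sup>n\<^sup>-\<^sup>1 / W\<close> are \<open>W\<close>-orbits of unit vectors, where \<open>W\<close> is
  the rotational part of the affine Weyl group \<open>G\<close>.
\<close>

definition weyl_orbit :: "(real^'d \<Rightarrow> real^'d) set \<Rightarrow> real^'d \<Rightarrow> (real^'d) set" where
  "weyl_orbit G v = (\<lambda>\<rho>. \<rho> v) ` rotational_part ` G"

definition weyl_chamber :: "(real^'d \<Rightarrow> real^'d) set \<Rightarrow> (real^'d) set set" where
  "weyl_chamber G = weyl_orbit G ` sphere 0 1"

definition orbit_distances :: "(real^'d) set \<Rightarrow> (real^'d) set \<Rightarrow> real set" where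
  "orbit_distances \<delta> \<delta>' = {arccos (v \<bullet> w) | v w. v \<in> \<delta> \<and> w \<in> \<delta>'}"

definition chamber_dist :: "(real^'d) set \<Rightarrow> (real^'d) set \<Rightarrow> real" where
  "chamber_dist \<delta> \<delta>' = Inf (orbit_distances \<delta> \<delta>')"

text \<open>
  \<open>G\<close> is the affine Weyl group, \<open>\<theta> x y\<close> the direction in the Weyl chamber of the oriented segment
  from \<open>x\<close> to \<open>y\<close> (relevant for \<open>x \<noteq> y\<close> only), and \<open>\<A>\<close> the collection of charts, whose
  images are the apartments.
\<close>

locale euclidean_building =
  fixes G :: "(real^'d \<Rightarrow> real^'d) set"
    and \<theta> :: "'a::hadamard_space \<Rightarrow> 'a \<Rightarrow> (real^'d) set"
    and \<A> :: "(real^'d \<Rightarrow> 'a) set"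
  assumes affine_weyl_group: "affine_weyl_group G"
    and EB1_direction: "x \<noteq> y \<Longrightarrow> \<theta> x y \<in> weyl_chamber G"
    and EB1_comparison:
      "x \<noteq> y \<Longrightarrow> x \<noteq> z \<Longrightarrow> chamber_dist (\<theta> x y) (\<theta> x z) \<le> comparison_angle x y z"
    and EB2: "x \<noteq> y \<Longrightarrow> x \<noteq> z \<Longrightarrow> segment_angle x y z \<in> orbit_distances (\<theta> x y) (\<theta> x z)"
    and EB3_isometric: "\<iota> \<in> \<A> \<Longrightarrow> dist (\<iota> u) (\<iota> v) = dist u v"
    and EB3_direction: "\<iota> \<in> \<A> \<Longrightarrow> u \<noteq> v \<Longrightarrow> \<theta> (\<iota> u) (\<iota> v) = weyl_orbit G (sgn (v - u))"
    and EB3_precomposition: "\<iota> \<in> \<A> \<Longrightarrow> w \<in> G \<Longrightarrow> \<iota> \<circ> w \<in> \<A>"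
    and EB3_segment: "geodesic_segment x y g \<Longrightarrow> \<exists>\<iota>\<in>\<A>. g ` {0..dist x y} \<subseteq> range \<iota>"
    and EB3_ray: "geodesic_ray r \<Longrightarrow> \<exists>\<iota>\<in>\<A>. r ` {0..} \<subseteq> range \<iota>"
    and EB3_line: "geodesic_line l \<Longrightarrow> \<exists>\<iota>\<in>\<A>. range l \<subseteq> range \<iota>"
    and EB4: "\<iota> \<in> \<A> \<Longrightarrow> \<kappa> \<in> \<A> \<Longrightarrow> \<exists>w\<in>G. \<forall>u. \<iota> u \<in> range \<kappa> \<longrightarrow> \<iota> u = \<kappa> (w u)"

end

theory Submission
  imports Defs "HOL-Library.Diagonal_Subsequence"
begin

text \<open>
  The contractions \<open>x \<mapsto> (1 - l) p + l \<Phi>\<^sub>c x\<close>, \<open>l < 1\<close>, have unique fixed points, which converge to a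
  fixed point of \<open>\<Phi>\<^sub>c\<close> as \<open>l \<rightarrow> 1\<close> unless they escape to infinity. Let \<open>f\<close> be the sum of the Busemann
  functions of the \<open>\<xi>\<^sub>i\<close> with weights \<open>m\<^sub>i\<close>; its asymptotic slope along a ray to \<open>\<eta>\<close> is
  \<open>slope c \<eta>\<close>, and \<open>d(p, \<Phi>\<^sub>c x)\<^sup>2 \<le> d(p, x)\<^sup>2 - 2 f(x) + const\<close>. Hence \<open>f\<close> is bounded above on the escaping
  points, and under local compactness they subconverge to a ray along which \<open>f\<close> does not grow,
  against stability.

  In a building compactness is replaced by two facts: semistability implies
  \<open>f(x) \<ge> - o(d(p, x))\<close>, since otherwise \<open>f\<close> has a ray of steepest descent; and the
  slopes of Busemann functions along rays of a given type take finitely many values.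
\<close>

section \<open>Geodesics and the CAT(0) inequality\<close>

text \<open>Semistability allows slope 0 at infinity, so a ray along which \<open>f\<close> does not
  grow would contradict nothing. In the building case the contradiction comes from a ray that points
  back from an escaping point \<open>x\<close> towards \<open>p\<close>: \<open>x\<close> lies
  between \<open>p\<close> and its image, so a convex function that is negative at \<open>p\<close>
  and 0 at \<open>x\<close> must be positive at the image.

  To bound a Busemann function of \<open>\<omega>\<close> at the image from above, two facts are
  combined. By convexity, a Busemann function stays above its initial slope along a ray, and its
  increment over a segment is at most the length times the slope at the far end. Moreover, slopes
  are minus cosines of angles, so at each point the slope of the function of \<open>\<omega>\<close>
  towards \<open>\<xi>\<close> equals that of the function of \<open>\<xi>\<close> towards
  \<open>\<omega>\<close>. The first reading describes a push towards \<open>\<xi>\<close>; the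
  second describes \<open>f\<close> along rays to \<open>\<omega>\<close>, where semistability can
  be used. Finiteness of the slope values turns approximate inequalities into the exact one that is
  needed.\<close>

lemma geodesic_segmentD:
  assumes "geodesic_segment x y g"
  shows "g 0 = x" "g (dist x y) = y"
    and "s \<in> {0..dist x y} \<Longrightarrow> t \<in> {0..dist x y} \<Longrightarrow> dist (g s) (g t) = \<bar>s - t\<bar>"
  using assms unfolding geodesic_segment_def by blast+

text \<open>A choice, which \<open>geodesic_segment_unique\<close> shows to be the only one on its
  domain. Rescaled to [0, 1] it becomes \<open>conv\<close>, the substitute for the affine
  combination (1 - l) x + l y.\<close>

definition geo :: "'a::hadamard_space \<Rightarrow> 'a \<Rightarrow> real \<Rightarrow> 'a" where
  "geo x y = (SOME g. geodesic_segment x y g)"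

definition conv :: "'a::hadamard_space \<Rightarrow> 'a \<Rightarrow> real \<Rightarrow> 'a" where
  "conv x y l = geo x y (l * dist x y)"

lemma conv_geodesic: "geodesic_segment x y (geo x y)"
  unfolding geo_def using geodesic_space by (rule someI_ex)

lemma conv_0 [simp]: "conv x y 0 = x" and conv_1 [simp]: "conv x y 1 = y"
  using geodesic_segmentD(1,2)[OF conv_geodesic[of x y]] by (simp_all add: conv_def)

lemma dist_conv:
  assumes "s \<in> {0..1}" "t \<in> {0..1}"
  shows "dist (conv x y s) (conv x y t) = \<bar>s - t\<bar> * dist x y"
proof -
  have "s * dist x y \<in> {0..dist x y}" "t * dist x y \<in> {0..dist x y}"
    using assms by (auto simp: mult_left_le_one_le)
  then have "dist (conv x y s) (conv x y t) = \<bar>s * dist x y - t * dist x y\<bar>"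
    unfolding conv_def by (rule geodesic_segmentD(3)[OF conv_geodesic])
  also have "\<dots> = \<bar>s - t\<bar> * dist x y"
    by (simp add: abs_mult flip: left_diff_distrib)
  finally show ?thesis .
qed

lemma dist_conv_left: "s \<in> {0..1} \<Longrightarrow> dist x (conv x y s) = s * dist x y"
  using dist_conv[of 0 s x y] by simp

lemma dist_conv_right: "s \<in> {0..1} \<Longrightarrow> dist (conv x y s) y = (1 - s) * dist x y"
  using dist_conv[of s 1 x y] by simp

text \<open>Comparison triangles in the plane are drawn only here. The right side is the law of
  cosines for the comparison points, so that CAT(0) becomes a polynomial inequality between
  distances.\<close>

lemma cat0_geodesics:
  fixes x y z :: "'a::hadamard_space"
  assumes g: "geodesic_segment x y g" and h: "geodesic_segment x z h"
    and s: "s \<in> {0..1}" and t: "t \<in> {0..1}"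
  shows "(dist (g (s * dist x y)) (h (t * dist x z)))\<^sup>2 \<le> s\<^sup>2 * (dist x y)\<^sup>2 + t\<^sup>2 * (dist x z)\<^sup>2
           - s * t * ((dist x y)\<^sup>2 + (dist x z)\<^sup>2 - (dist y z)\<^sup>2)"
proof -
  define P Q D where "P = dist x y" and "Q = dist x z" and "D = dist y z"
  note g0 = geodesic_segmentD(1)[OF g] and h0 = geodesic_segmentD(1)[OF h]
  have gd: "dist x (g u) = u" if "u \<in> {0..P}" for u
  proof -
    have "dist (g 0) (g u) = \<bar>0 - u\<bar>"
      using that by (intro geodesic_segmentD[OF g]) (auto simp: P_def)
    then show ?thesis using that by (simp add: g0)
  qed
  have hd: "dist x (h u) = u" if "u \<in> {0..Q}" for u
  proof -
    have "dist (h 0) (h u) = \<bar>0 - u\<bar>"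
      using that by (intro geodesic_segmentD[OF h]) (auto simp: Q_def)
    then show ?thesis using that by (simp add: h0)
  qed
  have sP: "s * P \<in> {0..P}" and tQ: "t * Q \<in> {0..Q}"
    using s t by (auto simp: mult_left_le_one_le P_def Q_def)
  show ?thesis
  proof (cases "P = 0 \<or> Q = 0")
    case True
    then show ?thesis
    proof
      assume "P = 0"
      then have "y = x" by (simp add: P_def)
      then show ?thesis using hd[OF tQ] g0 by (auto simp: Q_def power_mult_distrib)
    next
      assume "Q = 0"
      then have "z = x" by (simp add: Q_def)
      then show ?thesis using gd[OF sP] h0 by (auto simp: P_def power_mult_distrib dist_commute)
    qed
  next
    case False
    then have pos: "P > 0" "Q > 0" by (auto simp: P_def Q_def)
    \<comment> \<open>The cosine of the comparison angle at \<open>x\<close>. The triangle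
      inequalities give |k| \<le> 1, and unit vectors \<open>u\<close>, \<open>v\<close> with inner
      product \<open>k\<close> span the comparison triangle with vertex 0.\<close>
    define k where "k = (P\<^sup>2 + Q\<^sup>2 - D\<^sup>2) / (2 * P * Q)"
    have tri: "D \<le> P + Q" "\<bar>P - Q\<bar> \<le> D"
      unfolding P_def Q_def D_def
      using dist_triangle[of y z x] dist_triangle[of x y z] dist_triangle[of x z y]
      by (auto simp: dist_commute abs_le_iff)
    have "D\<^sup>2 \<le> (P + Q)\<^sup>2"
      using tri pos by (intro power_mono) (auto simp: D_def)
    then have "- (2 * P * Q) \<le> P\<^sup>2 + Q\<^sup>2 - D\<^sup>2"
      by (auto simp: power2_eq_square algebra_simps)
    moreover have "\<bar>P - Q\<bar>\<^sup>2 \<le> D\<^sup>2"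
      using tri by (intro power_mono) auto
    then have "P\<^sup>2 + Q\<^sup>2 - D\<^sup>2 \<le> 2 * P * Q"
      by (auto simp: power2_eq_square algebra_simps)
    ultimately have k: "\<bar>k\<bar> \<le> 1"
      using pos unfolding k_def by (auto simp: abs_le_iff field_simps)
    then have k2: "k\<^sup>2 \<le> 1" by (simp add: abs_square_le_1)
    define e1 e2 :: "real^2" where "e1 = axis 1 1" and "e2 = axis 2 1"
    have e: "e1 \<bullet> e1 = 1" "e2 \<bullet> e2 = 1" "e1 \<bullet> e2 = 0" "e2 \<bullet> e1 = 0"
      by (auto simp: e1_def e2_def inner_axis_axis)
    define u v where "u = e1" and "v = k *\<^sub>R e1 + sqrt (1 - k\<^sup>2) *\<^sub>R e2"
    have uv: "u \<bullet> u = 1" "u \<bullet> v = k" "v \<bullet> u = k" "v \<bullet> v = 1"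
      using k2 by (auto simp: u_def v_def e inner_add_left inner_add_right power2_eq_square)
    have nrm: "(norm (a *\<^sub>R u - b *\<^sub>R v))\<^sup>2 = a\<^sup>2 + b\<^sup>2 - 2 * a * b * k" for a b
      by (simp add: power2_norm_eq_inner inner_diff_left inner_diff_right uv)
         (simp add: power2_eq_square algebra_simps)
    have nu: "norm u = 1" "norm v = 1" using uv by (auto simp: norm_eq_sqrt_inner)
    have kk: "2 * P * Q * k = P\<^sup>2 + Q\<^sup>2 - D\<^sup>2" using pos by (simp add: k_def)
    have "(dist (P *\<^sub>R u) (Q *\<^sub>R v))\<^sup>2 = D\<^sup>2"
      using nrm[of P Q] kk by (simp add: dist_norm)
    then have dD: "dist (P *\<^sub>R u) (Q *\<^sub>R v) = D" by (auto simp: D_def)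
    have seg: "(s * P) *\<^sub>R u \<in> closed_segment 0 (P *\<^sub>R u)" "(t * Q) *\<^sub>R v \<in> closed_segment 0 (Q *\<^sub>R v)"
      using s t by (auto simp: in_segment intro: exI[of _ s] exI[of _ t])
    have "dist (g (s * P)) (h (t * Q)) \<le> dist ((s * P) *\<^sub>R u) ((t * Q) *\<^sub>R v)"
      using triangle_comparison[of x y z, unfolded triangle_comparison_def, rule_format,
          of "s * P" "t * Q" g h 0 "P *\<^sub>R u" "Q *\<^sub>R v" "(s * P) *\<^sub>R u" "(t * Q) *\<^sub>R v"]
        sP tQ g h dD seg nu pos s t by (simp add: P_def Q_def D_def dist_norm)
    then have "(dist (g (s * P)) (h (t * Q)))\<^sup>2 \<le> (dist ((s * P) *\<^sub>R u) ((t * Q) *\<^sub>R v))\<^sup>2"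
      by (intro power_mono) auto
    also have "\<dots> = (s * P)\<^sup>2 + (t * Q)\<^sup>2 - s * t * (2 * P * Q * k)"
      using nrm[of "s * P" "t * Q"] by (simp add: dist_norm algebra_simps)
    finally show ?thesis unfolding kk by (simp add: power_mult_distrib P_def Q_def D_def)
  qed
qed

lemma cat0:
  assumes "s \<in> {0..1}" "t \<in> {0..1}"
  shows "(dist (conv x y s) (conv x z t))\<^sup>2 \<le> s\<^sup>2 * (dist x y)\<^sup>2 + t\<^sup>2 * (dist x z)\<^sup>2
           - s * t * ((dist x y)\<^sup>2 + (dist x z)\<^sup>2 - (dist y z)\<^sup>2)"
  using cat0_geodesics[OF conv_geodesic conv_geodesic assms] by (simp add: conv_def)

text \<open>A triangle with \<open>y = z\<close> has a degenerate comparison triangle, so points at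
  equal parameters coincide.\<close>

lemma geodesic_segment_unique:
  fixes x y :: "'a::hadamard_space"
  assumes g: "geodesic_segment x y g" and s: "s \<in> {0..1}"
  shows "g (s * dist x y) = conv x y s"
proof -
  have "(dist (g (s * dist x y)) (conv x y s))\<^sup>2 \<le> 0"
    using cat0_geodesics[OF g conv_geodesic[of x y] s s]
    by (simp add: conv_def power2_eq_square algebra_simps)
  then show ?thesis by simp
qed

lemma conv_commute:
  assumes "s \<in> {0..1}"
  shows "conv y x s = conv x y (1 - s)"
proof -
  have "dist (geo x y (dist x y - u)) (geo x y (dist x y - v)) = \<bar>u - v\<bar>"
    if "u \<in> {0..dist x y}" "v \<in> {0..dist x y}" for u v
    using geodesic_segmentD(3)[OF conv_geodesic[of x y], of "dist x y - u" "dist x y - v"] that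
    by (simp add: abs_minus_commute)
  then have "geodesic_segment y x (\<lambda>u. geo x y (dist x y - u))"
    unfolding geodesic_segment_def dist_commute[of y x]
    using geodesic_segmentD(1,2)[OF conv_geodesic[of x y]] by simp
  from geodesic_segment_unique[OF this assms] show ?thesis
    by (simp add: conv_def algebra_simps dist_commute)
qed

text \<open>The case \<open>t = 1\<close> of \<open>cat0\<close> at the vertex \<open>y\<close>. For
  l = 1/2 this is the midpoint inequality of Bruhat and Tits.\<close>

lemma stewart:
  assumes "l \<in> {0..1}"
  shows "(dist p (conv y z l))\<^sup>2 \<le>
    (1 - l) * (dist p y)\<^sup>2 + l * (dist p z)\<^sup>2 - l * (1 - l) * (dist y z)\<^sup>2"
  using cat0[OF assms, of 1 y z p]
  by (simp add: dist_commute algebra_simps power2_eq_square)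

text \<open>Replacing \<open>dist y z\<close> by the smaller |dist p y - dist p z| turns the right
  side of \<open>stewart\<close> into a perfect square.\<close>

lemma dist_conv_convex:
  assumes l: "l \<in> {0..1}"
  shows "dist p (conv y z l) \<le> (1 - l) * dist p y + l * dist p z"
proof -
  have "\<bar>dist p y - dist p z\<bar> \<le> dist y z"
    using dist_triangle[of p y z] dist_triangle[of p z y] by (auto simp: dist_commute abs_le_iff)
  then have "(dist p y - dist p z)\<^sup>2 \<le> (dist y z)\<^sup>2"
    by (metis abs_ge_zero power2_abs power_mono)
  then have "l * (1 - l) * (dist p y - dist p z)\<^sup>2 \<le> l * (1 - l) * (dist y z)\<^sup>2"
    using l by (intro mult_left_mono) auto
  with stewart[OF l, of p y z] have "(dist p (conv y z l))\<^sup>2 \<le>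
      (1 - l) * (dist p y)\<^sup>2 + l * (dist p z)\<^sup>2 - l * (1 - l) * (dist p y - dist p z)\<^sup>2"
    by linarith
  also have "\<dots> = ((1 - l) * dist p y + l * dist p z)\<^sup>2"
    by (simp add: power2_eq_square algebra_simps)
  finally show ?thesis
    by (rule power2_le_imp_le) (use l in auto)
qed

lemma dist_conv_conv_vertex:
  assumes l: "l \<in> {0..1}"
  shows "dist (conv x y l) (conv x z l) \<le> l * dist y z"
proof -
  have "(dist (conv x y l) (conv x z l))\<^sup>2 \<le> (l * dist y z)\<^sup>2"
    using cat0[OF l l, of x y z] by (simp add: algebra_simps power2_eq_square)
  then show ?thesis by (rule power2_le_imp_le) (use l in auto)
qed

text \<open>The diagonal from \<open>x\<close> to \<open>y'\<close> splits the quadrilateral into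
  two triangles, to which \<open>dist_conv_conv_vertex\<close> applies.\<close>

lemma dist_conv_conv:
  assumes l: "l \<in> {0..1}"
  shows "dist (conv x y l) (conv x' y' l) \<le> (1 - l) * dist x x' + l * dist y y'"
proof -
  have "dist (conv x y l) (conv x' y' l) \<le> dist (conv x y l) (conv x y' l) + dist (conv x y' l) (conv x' y' l)"
    by (rule dist_triangle)
  moreover have "dist (conv x y' l) (conv x' y' l) = dist (conv y' x (1 - l)) (conv y' x' (1 - l))"
    using l conv_commute[of "1 - l" y'] by simp
  ultimately show ?thesis
    using dist_conv_conv_vertex[OF l, of x y y'] dist_conv_conv_vertex[of "1 - l" y' x x'] l by auto
qed

lemma conv_conv:
  assumes s: "s \<in> {0..1}" and l: "l \<in> {0..1}"
  shows "conv x (conv x y s) l = conv x y (l * s)"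
proof -
  let ?g = "geo x y"
  have d: "dist x (conv x y s) = s * dist x y" by (rule dist_conv_left[OF s])
  have "s * dist x y \<le> dist x y" using s by (simp add: mult_left_le_one_le)
  then have "geodesic_segment x (conv x y s) ?g"
    using geodesic_segmentD[OF conv_geodesic[of x y]] unfolding geodesic_segment_def d
    by (simp add: conv_def)
  from geodesic_segment_unique[OF this l] show ?thesis
    unfolding d by (simp add: conv_def[of x y "l * s"] mult.assoc)
qed

section \<open>Rays and the ideal boundary\<close>

lemma geodesic_rayD:
  "geodesic_ray r \<Longrightarrow> 0 \<le> s \<Longrightarrow> 0 \<le> t \<Longrightarrow> dist (r s) (r t) = \<bar>s - t\<bar>"
  by (simp add: geodesic_ray_def)

lemma conv_ray:
  fixes r :: "real \<Rightarrow> 'a::hadamard_space"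
  assumes r: "geodesic_ray r" and T: "0 \<le> T" and l: "l \<in> {0..1}"
  shows "conv (r 0) (r T) l = r (l * T)"
proof -
  have d: "dist (r 0) (r T) = T" using geodesic_rayD[OF r, of 0 T] T by simp
  have "geodesic_segment (r 0) (r T) r"
    unfolding geodesic_segment_def d using geodesic_rayD[OF r] by simp
  from geodesic_segment_unique[OF this l] show ?thesis by (simp add: d)
qed

text \<open>The distance between the rays is convex in t, and a bounded convex function on a
  half-line does not increase. The chord over [0, T] shows it up to t C / T, which the choice of
  \<open>T\<close> makes at most e.\<close>

lemma asymptotic_rays_dist_le:
  fixes r r' :: "real \<Rightarrow> 'a::hadamard_space"
  assumes r: "geodesic_ray r" and r': "geodesic_ray r'"
    and C: "\<And>t. 0 \<le> t \<Longrightarrow> dist (r t) (r' t) \<le> C" and t: "0 \<le> t"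
  shows "dist (r t) (r' t) \<le> dist (r 0) (r' 0)"
proof (rule field_le_epsilon)
  fix e :: real assume e: "e > 0"
  have C0: "C \<ge> 0" using C[of 0] zero_le_dist[of "r 0" "r' 0"] by linarith
  define T where "T = t + t * C / e + 1"
  have T: "T > 0" "t \<le> T" "t * C / e \<le> T" using t e C0 by (auto simp: T_def add_nonneg_pos)
  define l where "l = t / T"
  have l: "l \<in> {0..1}" and lT: "l * T = t" using T t by (auto simp: l_def)
  have "dist (r t) (r' t) \<le> (1 - l) * dist (r 0) (r' 0) + l * dist (r T) (r' T)"
    using dist_conv_conv[OF l, of "r 0" "r T" "r' 0" "r' T"]
      conv_ray[OF r _ l, of T] conv_ray[OF r' _ l, of T] T by (simp add: lT)
  also have "\<dots> \<le> dist (r 0) (r' 0) + l * C"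
    using l C[of T] T by (intro add_mono mult_left_mono) (auto simp: mult_left_le_one_le)
  also have "l * C \<le> e" using T e by (simp add: l_def field_simps)
  finally show "dist (r t) (r' t) \<le> dist (r 0) (r' 0) + e" by simp
qed

lemma geodesic_ray_eqI:
  fixes r r' :: "real \<Rightarrow> 'a::hadamard_space"
  assumes r: "geodesic_ray r" and r': "geodesic_ray r'" and "r 0 = r' 0"
    and C: "\<And>t. 0 \<le> t \<Longrightarrow> dist (r t) (r' t) \<le> C"
  shows "r = r'"
proof (rule extensionalityI)
  show "r \<in> extensional {0..}" "r' \<in> extensional {0..}"
    using r r' by (simp_all add: geodesic_ray_def)
  show "r t = r' t" if "t \<in> {0..}" for t
    using asymptotic_rays_dist_le[OF r r' C, of t] that assms(3) by simp
qed

lemma dist_to_ray_ge: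
  assumes "geodesic_ray r" "0 \<le> t"
  shows "t - dist x (r 0) \<le> dist x (r t)" and "dist x (r t) \<le> t + dist x (r 0)"
  using dist_triangle[of "r 0" "r t" x] dist_triangle[of x "r t" "r 0"] geodesic_rayD[OF assms(1), of 0 t]
    assms(2) by (simp_all add: dist_commute)

lemma dist_point_ray_at_top:
  assumes "geodesic_ray r"
  shows "filterlim (\<lambda>n. dist x (r (real n))) at_top sequentially"
proof (rule filterlim_at_top_mono)
  show "filterlim (\<lambda>n. - dist x (r 0) + real n) at_top sequentially"
    by (intro filterlim_tendsto_add_at_top[OF tendsto_const] filterlim_real_sequentially)
  show "eventually (\<lambda>n. - dist x (r 0) + real n \<le> dist x (r (real n))) sequentially"
    using dist_to_ray_ge(1)[OF assms, of "real _" x] by (intro always_eventually allI) (simp add: algebra_simps)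
qed

lemma eventually_unit_quotient:
  fixes X :: "nat \<Rightarrow> 'a::metric_space"
  assumes inf: "filterlim (\<lambda>n. dist p (X n)) at_top sequentially" and t: "0 \<le> t"
  shows "eventually (\<lambda>n. dist p (X n) > 0 \<and> t / dist p (X n) \<in> {0..1}) sequentially"
proof -
  have "eventually (\<lambda>n. dist p (X n) \<ge> t + 1) sequentially"
    using inf unfolding filterlim_at_top by blast
  then show ?thesis by eventually_elim (use t in \<open>auto simp: divide_le_eq\<close>)
qed

text \<open>Shared by the three constructions of rays below: asymptotic rays, limits under local
  compactness, and rays of steepest descent. Each has only to prove convergence at every fixed
  distance from \<open>p\<close>.\<close>

lemma ray_limit_of_segments:
  fixes p :: "'a::hadamard_space"
  assumes inf: "filterlim (\<lambda>n. dist p (X n)) at_top sequentially"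
    and convergent: "\<And>t. 0 \<le> t \<Longrightarrow> convergent (\<lambda>n. conv p (X n) (t / dist p (X n)))"
  obtains r where "geodesic_ray r" "r 0 = p"
    and "\<And>t. 0 \<le> t \<Longrightarrow> (\<lambda>n. conv p (X n) (t / dist p (X n))) \<longlonglongrightarrow> r t"
proof -
  define \<sigma> where "\<sigma> n t = conv p (X n) (t / dist p (X n))" for n t
  define r where "r t = (if t \<in> {0..} then lim (\<lambda>n. \<sigma> n t) else undefined)" for t
  have lim: "(\<lambda>n. \<sigma> n t) \<longlonglongrightarrow> r t" if "0 \<le> t" for t
    using convergent[OF that] that by (simp add: r_def \<sigma>_def convergent_LIMSEQ_iff)
  have iso: "dist (r s) (r t) = \<bar>s - t\<bar>" if st: "0 \<le> s" "0 \<le> t" for s t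
  proof (rule LIMSEQ_unique)
    show "(\<lambda>n. dist (\<sigma> n s) (\<sigma> n t)) \<longlonglongrightarrow> dist (r s) (r t)"
      by (intro tendsto_dist lim st)
    have "eventually (\<lambda>n. dist (\<sigma> n s) (\<sigma> n t) = \<bar>s - t\<bar>) sequentially"
      using eventually_unit_quotient[OF inf st(1)] eventually_unit_quotient[OF inf st(2)]
    proof eventually_elim
      case (elim n)
      have "dist (\<sigma> n s) (\<sigma> n t) = \<bar>s / dist p (X n) - t / dist p (X n)\<bar> * dist p (X n)"
        unfolding \<sigma>_def using elim by (intro dist_conv) auto
      also have "\<dots> = \<bar>(s - t) / dist p (X n)\<bar> * dist p (X n)" by (simp add: diff_divide_distrib)
      also have "\<dots> = \<bar>s - t\<bar>" using elim by (simp add: abs_divide)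
      finally show ?case .
    qed
    then show "(\<lambda>n. dist (\<sigma> n s) (\<sigma> n t)) \<longlonglongrightarrow> \<bar>s - t\<bar>" by (rule tendsto_eventually)
  qed
  show thesis
  proof (rule that)
    show "geodesic_ray r"
      unfolding geodesic_ray_def using iso by (auto simp: r_def extensional_def)
    have "(\<lambda>n. \<sigma> n 0) = (\<lambda>n. p)" by (simp add: \<sigma>_def)
    with lim[of 0] show "r 0 = p" by (simp add: LIMSEQ_const_iff)
    show "(\<lambda>n. conv p (X n) (t / dist p (X n))) \<longlonglongrightarrow> r t" if "0 \<le> t" for t
      using lim[OF that] by (simp add: \<sigma>_def)
  qed
qed

text \<open>The segments from \<open>x\<close> to the points \<open>r n\<close> converge by
  completeness: their lengths grow, while the differences between length and n stay bounded, so the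
  comparison angles at \<open>x\<close> tend to 0.\<close>

lemma asymptotic_ray_exists:
  fixes r :: "real \<Rightarrow> 'a::hadamard_space"
  assumes r: "geodesic_ray r"
  obtains r' where "geodesic_ray r'" "r' 0 = x"
    and "\<And>t. 0 \<le> t \<Longrightarrow> dist (r t) (r' t) \<le> 2 * dist x (r 0)"
    and "\<And>t. 0 \<le> t \<Longrightarrow>
      (\<lambda>n. conv x (r (real n)) (t / dist x (r (real n)))) \<longlonglongrightarrow> r' t"
proof -
  define d where "d = dist x (r 0)"
  have d0: "d \<ge> 0" by (simp add: d_def)
  define P where "P n = dist x (r (real n))" for n
  define \<sigma> where "\<sigma> n t = conv x (r (real n)) (t / P n)" for n t
  have P: "real n - d \<le> P n" "P n \<le> real n + d" for n
    using dist_to_ray_ge[OF r, of "real n" x] by (auto simp: P_def d_def)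
  have unit: "t / P n \<in> {0..1}" "P n > 0" "t / P n * P n = t"
    if "0 \<le> t" "d + t + 1 \<le> real n" for t n
    using P(1)[of n] that by (auto simp: field_simps)
  have cauchy: "Cauchy (\<lambda>n. \<sigma> n t)" if t: "0 \<le> t" for t
    unfolding Cauchy_altdef
  proof (intro allI impI)
    fix e :: real assume e: "e > 0"
    \<comment> \<open>The estimate below ends in 8 d t^2 / P n with P n \<ge> n - d; the summand
      \<open>2 * d\<close> also gives m / P m \<le> 2.\<close>
    obtain N where N: "real N > 8 * d * t\<^sup>2 / e\<^sup>2 + 2 * d + t + 1"
      using reals_Archimedean2 by blast
    have "dist (\<sigma> n t) (\<sigma> m t) < e" if nm: "n \<ge> N" "m > n" for n m
    proof -
      have n: "real n > 8 * d * t\<^sup>2 / e\<^sup>2 + 2 * d + t + 1" using N nm by linarith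
      moreover have "8 * d * t\<^sup>2 / e\<^sup>2 \<ge> 0" using d0 by simp
      ultimately have n': "d + t + 1 \<le> real n" "2 * d \<le> real n" using t d0 by linarith+
      then have m': "d + t + 1 \<le> real m" "2 * d \<le> real m" using nm by linarith+
      note un = unit[OF t n'(1)] and um = unit[OF t m'(1)]
      define D where "D = real m - real n"
      have D: "dist (r (real n)) (r (real m)) = D"
        using geodesic_rayD[OF r, of "real n" "real m"] nm by (simp add: D_def)
      define k where "k = t / P n * (t / P m)"
      have k0: "k \<ge> 0" using un um t by (simp add: k_def)
      have "(dist (\<sigma> n t) (\<sigma> m t))\<^sup>2 \<le> (t / P n)\<^sup>2 * (P n)\<^sup>2 + (t / P m)\<^sup>2 * (P m)\<^sup>2
          - k * ((P n)\<^sup>2 + (P m)\<^sup>2 - D\<^sup>2)"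
        using cat0[OF un(1) um(1), of x "r (real n)" "r (real m)"] unfolding \<sigma>_def k_def D
        by (simp add: P_def)
      also have "\<dots> = 2 * t\<^sup>2 - k * ((P n)\<^sup>2 + (P m)\<^sup>2 - D\<^sup>2)"
        using un um by (simp flip: power_mult_distrib)
      also have "2 * t\<^sup>2 = k * (2 * P n * P m)" using un um by (simp add: k_def power2_eq_square)
      \<comment> \<open>The first factor is bounded, since P n - n and P m - m both lie in [-d, d].
        The second grows at most linearly in m, which the factor 1 / P m in \<open>k\<close>
        absorbs.\<close>
      also have "k * (2 * P n * P m) - k * ((P n)\<^sup>2 + (P m)\<^sup>2 - D\<^sup>2)
          = k * ((D - (P m - P n)) * (D + (P m - P n)))"
        by (simp add: power2_eq_square algebra_simps)
      also have "\<dots> \<le> k * ((2 * d) * (2 * real m))"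
      proof (rule mult_left_mono[OF mult_mono k0])
        have "\<bar>P m - P n\<bar> \<le> D"
          using dist_triangle[of x "r (real m)" "r (real n)"] dist_triangle[of x "r (real n)" "r (real m)"] D
          by (simp add: P_def dist_commute abs_le_iff)
        then show "0 \<le> D + (P m - P n)" "D + (P m - P n) \<le> 2 * real m"
          by (auto simp: D_def)
        show "D - (P m - P n) \<le> 2 * d" using P(1)[of m] P(2)[of n] by (simp add: D_def)
        show "0 \<le> 2 * d" using d0 by simp
      qed
      also have "\<dots> = t\<^sup>2 * (4 * d) / P n * (real m / P m)"
        by (simp add: k_def power2_eq_square)
      also have "\<dots> \<le> t\<^sup>2 * (4 * d) / P n * 2"
      proof (rule mult_left_mono)
        show "real m / P m \<le> 2" using P(1)[of m] m' um(2) by (simp add: pos_divide_le_eq)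
        show "0 \<le> t\<^sup>2 * (4 * d) / P n" using d0 un by simp
      qed
      also have "\<dots> < e\<^sup>2"
      proof -
        have "8 * d * t\<^sup>2 / e\<^sup>2 < P n" using n P(1)[of n] d0 t by linarith
        then show ?thesis using un(2) e by (simp add: field_simps)
      qed
      finally show ?thesis using e by (simp add: power2_less_imp_less)
    qed
    then show "\<exists>M. \<forall>m\<ge>M. \<forall>n>m. dist (\<sigma> m t) (\<sigma> n t) < e" by blast
  qed
  have ev: "eventually (\<lambda>n. d + t + 1 \<le> real n) sequentially" for t
    by (intro eventually_sequentiallyI[of "nat \<lceil>d + t + 1\<rceil>"]) linarith
  obtain r' where r': "geodesic_ray r'" "r' 0 = x"
      and lim: "\<And>t. 0 \<le> t \<Longrightarrow> (\<lambda>n. \<sigma> n t) \<longlonglongrightarrow> r' t"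
  proof (rule ray_limit_of_segments[OF dist_point_ray_at_top[OF r, of x]])
    show "convergent (\<lambda>n. conv x (r (real n)) (t / dist x (r (real n))))" if "0 \<le> t" for t
      using cauchy[OF that] by (simp add: Cauchy_convergent_iff \<sigma>_def P_def)
  qed (use that in \<open>simp add: \<sigma>_def P_def\<close>)
  show thesis
  proof (rule that[OF r'])
    show "(\<lambda>n. conv x (r (real n)) (t / dist x (r (real n)))) \<longlonglongrightarrow> r' t" if "0 \<le> t" for t
      using lim[OF that] by (simp add: \<sigma>_def P_def)
    show "dist (r t) (r' t) \<le> 2 * dist x (r 0)" if t: "0 \<le> t" for t
    proof (rule tendsto_upperbound)
      show "(\<lambda>n. dist (r t) (\<sigma> n t)) \<longlonglongrightarrow> dist (r t) (r' t)"
        by (intro tendsto_dist lim t tendsto_const)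
      show "eventually (\<lambda>n. dist (r t) (\<sigma> n t) \<le> 2 * dist x (r 0)) sequentially"
        using ev[of t]
      proof eventually_elim
        case (elim n)
        note u = unit[OF t elim]
        define l where "l = t / P n"
        have l: "l \<in> {0..1}" "l * P n = t" using u by (simp_all add: l_def)
        have "dist (r (l * real n)) (\<sigma> n t) \<le> (1 - l) * dist (r 0) x"
          using dist_conv_conv[OF l(1), of "r 0" "r (real n)" x "r (real n)"]
            conv_ray[OF r _ l(1), of "real n"] by (simp add: \<sigma>_def l_def)
        also have "\<dots> \<le> d" using l(1) by (simp add: d_def dist_commute mult_left_le_one_le)
        finally have 1: "dist (r (l * real n)) (\<sigma> n t) \<le> d" .
        have "dist (r t) (r (l * real n)) = \<bar>l * (P n - real n)\<bar>"
          using geodesic_rayD[OF r t, of "l * real n"] l by (simp add: right_diff_distrib)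
        also have "\<dots> = l * \<bar>P n - real n\<bar>" using l(1) by (simp add: abs_mult)
        also have "\<dots> \<le> 1 * d"
          using l(1) P[of n] d0 by (intro mult_mono) (auto simp: abs_le_iff)
        finally show ?case
          using 1 dist_triangle[of "r t" "\<sigma> n t" "r (l * real n)"] by (simp add: d_def)
      qed
    qed simp
  qed
qed

section \<open>Boundary points as classes of rays, and the ray from a point to a boundary
  point\<close>

lemma ideal_boundary_cases:
  assumes "\<xi> \<in> ideal_boundary"
  obtains r where "geodesic_ray r"
    and "\<xi> = {r'. geodesic_ray r' \<and> (\<exists>C. \<forall>t\<ge>0. dist (r t) (r' t) \<le> C)}"
proof -
  obtain r where "geodesic_ray r" "\<xi> = asymptotic `` {r}"
    using assms by (auto simp: ideal_boundary_def elim: quotientE)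
  then show thesis by (intro that[of r]) (auto simp: asymptotic_def)
qed

lemma ideal_boundary_ray:
  "\<xi> \<in> ideal_boundary \<Longrightarrow> r \<in> \<xi> \<Longrightarrow> geodesic_ray r"
  by (auto elim!: ideal_boundary_cases)

lemma ideal_boundary_bounded:
  assumes "\<xi> \<in> ideal_boundary" "r \<in> \<xi>" "r' \<in> \<xi>"
  obtains C where "\<And>t. 0 \<le> t \<Longrightarrow> dist (r t) (r' t) \<le> C"
proof -
  obtain r0 where r0: "\<xi> = {r'. geodesic_ray r' \<and> (\<exists>C. \<forall>t\<ge>0. dist (r0 t) (r' t) \<le> C)}"
    using assms(1) by (rule ideal_boundary_cases)
  obtain C C' where C: "\<forall>t\<ge>0. dist (r0 t) (r t) \<le> C" "\<forall>t\<ge>0. dist (r0 t) (r' t) \<le> C'"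
    using assms(2,3) unfolding r0 by blast
  show thesis
  proof (rule that[of "C + C'"])
    fix t :: real assume "0 \<le> t"
    with C have "dist (r0 t) (r t) \<le> C" "dist (r0 t) (r' t) \<le> C'" by auto
    then show "dist (r t) (r' t) \<le> C + C'"
      using dist_triangle[of "r t" "r' t" "r0 t"] by (simp add: dist_commute)
  qed
qed

lemma ideal_boundary_closed:
  assumes "\<xi> \<in> ideal_boundary" "r \<in> \<xi>" "geodesic_ray r'"
    and C: "\<And>t. 0 \<le> t \<Longrightarrow> dist (r t) (r' t) \<le> C"
  shows "r' \<in> \<xi>"
proof -
  obtain r0 where r0: "\<xi> = {r'. geodesic_ray r' \<and> (\<exists>C. \<forall>t\<ge>0. dist (r0 t) (r' t) \<le> C)}"
    using assms(1) by (rule ideal_boundary_cases)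
  obtain C' where C': "\<forall>t\<ge>0. dist (r0 t) (r t) \<le> C'"
    using assms(2) unfolding r0 by blast
  have "dist (r0 t) (r' t) \<le> C' + C" if "0 \<le> t" for t
    using C[OF that] C'[rule_format, OF that] dist_triangle[of "r0 t" "r' t" "r t"] by linarith
  with assms(3) show ?thesis unfolding r0 by blast
qed

lemma ray_from_eqI:
  fixes \<xi> :: "(real \<Rightarrow> 'a::hadamard_space) set"
  assumes \<xi>: "\<xi> \<in> ideal_boundary" and r: "r \<in> \<xi>"
  shows "ray_from (r 0) \<xi> = r"
  unfolding ray_from_def
proof (rule the_equality)
  show "r \<in> \<xi> \<and> r 0 = r 0" using r by simp
  fix r' assume r': "r' \<in> \<xi> \<and> r' 0 = r 0"
  then obtain C where "\<And>t. 0 \<le> t \<Longrightarrow> dist (r' t) (r t) \<le> C"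
    using ideal_boundary_bounded[OF \<xi>, of r' r] r by blast
  then show "r' = r"
    using r' r ideal_boundary_ray[OF \<xi>] geodesic_ray_eqI[of r' r] by blast
qed

lemma ray_from:
  fixes x :: "'a::hadamard_space"
  assumes \<xi>: "\<xi> \<in> ideal_boundary"
  shows ray_from_mem: "ray_from x \<xi> \<in> \<xi>"
    and ray_from_0: "ray_from x \<xi> 0 = x"
    and geodesic_ray_ray_from: "geodesic_ray (ray_from x \<xi>)"
proof -
  obtain r where r: "geodesic_ray r"
      "\<xi> = {r'. geodesic_ray r' \<and> (\<exists>C. \<forall>t\<ge>0. dist (r t) (r' t) \<le> C)}"
    using \<xi> by (rule ideal_boundary_cases)
  obtain r' where r': "geodesic_ray r'" "r' 0 = x"
      "\<And>t. 0 \<le> t \<Longrightarrow> dist (r t) (r' t) \<le> 2 * dist x (r 0)"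
    by (rule asymptotic_ray_exists[OF r(1), of x]) (rule that)
  have mem: "r' \<in> \<xi>"
    unfolding r(2) using r'(1,3) by (intro CollectI conjI exI[of _ "2 * dist x (r 0)"]) simp_all
  with ray_from_eqI[OF \<xi> mem] r'
  show "ray_from x \<xi> \<in> \<xi>" "ray_from x \<xi> 0 = x" "geodesic_ray (ray_from x \<xi>)" by auto
qed

lemma ideal_point_of_ray:
  fixes r :: "real \<Rightarrow> 'a::hadamard_space"
  assumes r: "geodesic_ray r"
  obtains \<xi> where "\<xi> \<in> ideal_boundary" "ray_from (r 0) \<xi> = r"
proof -
  have \<xi>: "asymptotic `` {r} \<in> ideal_boundary"
    using r by (auto simp: ideal_boundary_def intro: quotientI)
  have "r \<in> asymptotic `` {r}"
    using r by (auto simp: asymptotic_def intro: exI[of _ 0])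
  from that[OF \<xi> ray_from_eqI[OF \<xi> this]] show thesis .
qed

text \<open>Describes the ray from \<open>x\<close> through any other ray of the class. Inequalities
  for segments ending on that ray thus pass to \<open>ray_from x \<xi>\<close>, which is how the
  Busemann estimates below arise.\<close>

lemma ray_from_limit:
  fixes x :: "'a::hadamard_space"
  assumes \<xi>: "\<xi> \<in> ideal_boundary" and t: "0 \<le> t"
  shows "(\<lambda>n. conv x (ray_from p \<xi> (real n)) (t / dist x (ray_from p \<xi> (real n))))
           \<longlonglongrightarrow> ray_from x \<xi> t"
proof -
  let ?r = "ray_from p \<xi>"
  obtain r' where r': "geodesic_ray r'" "r' 0 = x"
      "\<And>t. 0 \<le> t \<Longrightarrow> dist (?r t) (r' t) \<le> 2 * dist x (?r 0)"
      "\<And>t. 0 \<le> t \<Longrightarrow> (\<lambda>n. conv x (?r (real n)) (t / dist x (?r (real n)))) \<longlonglongrightarrow> r' t"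
    by (rule asymptotic_ray_exists[OF geodesic_ray_ray_from[OF \<xi>, of p], of x]) (rule that)
  have "r' \<in> \<xi>"
    by (rule ideal_boundary_closed[OF \<xi> ray_from_mem[OF \<xi>] r'(1) r'(3)])
  from ray_from_eqI[OF \<xi> this] r'(2,4) t show ?thesis by auto
qed

lemma dist_ray_from_le:
  fixes p q :: "'a::hadamard_space"
  assumes \<xi>: "\<xi> \<in> ideal_boundary" and t: "0 \<le> t"
  shows "dist (ray_from p \<xi> t) (ray_from q \<xi> t) \<le> dist p q"
proof -
  obtain C where "\<And>t. 0 \<le> t \<Longrightarrow> dist (ray_from p \<xi> t) (ray_from q \<xi> t) \<le> C"
    using ideal_boundary_bounded[OF \<xi> ray_from_mem[OF \<xi>] ray_from_mem[OF \<xi>]] by blast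
  from asymptotic_rays_dist_le[OF geodesic_ray_ray_from[OF \<xi>] geodesic_ray_ray_from[OF \<xi>] this t]
  show ?thesis by (simp add: ray_from_0[OF \<xi>])
qed

lemma dist_ray_from:
  "\<xi> \<in> ideal_boundary \<Longrightarrow> 0 \<le> s \<Longrightarrow> 0 \<le> t \<Longrightarrow> dist (ray_from p \<xi> s) (ray_from p \<xi> t) = \<bar>s - t\<bar>"
  by (rule geodesic_rayD[OF geodesic_ray_ray_from])

lemma dist_ray_from_start:
  "\<xi> \<in> ideal_boundary \<Longrightarrow> 0 \<le> t \<Longrightarrow> dist p (ray_from p \<xi> t) = t"
  using dist_ray_from[of \<xi> 0 t p] by (simp add: ray_from_0)

lemma ray_from_ray_from:
  fixes p :: "'a::hadamard_space"
  assumes \<xi>: "\<xi> \<in> ideal_boundary" and s: "0 \<le> s" and t: "0 \<le> t"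
  shows "ray_from (ray_from p \<xi> s) \<xi> t = ray_from p \<xi> (s + t)"
proof -
  define r where "r t = (if t \<in> {0..} then ray_from p \<xi> (s + t) else undefined)" for t
  have r: "geodesic_ray r"
    using s dist_ray_from[OF \<xi>, of _ _ p]
    by (auto simp: geodesic_ray_def r_def extensional_def)
  have "r \<in> \<xi>"
    using s dist_ray_from[OF \<xi>, of _ _ p]
    by (intro ideal_boundary_closed[OF \<xi> ray_from_mem[OF \<xi>, of p] r, of s]) (simp add: r_def)
  from ray_from_eqI[OF \<xi> this] show ?thesis using t by (simp add: r_def)
qed

section \<open>Busemann functions\<close>

text \<open>By the triangle inequality the expression does not increase in t, so the infimum is the
  usual limit. As an infimum it gives an upper bound for each single t, and lower bounds can be
  checked for one t at a time.\<close>

definition busemann :: "(real \<Rightarrow> 'a::metric_space) \<Rightarrow> 'a \<Rightarrow> real" where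
  "busemann r z = (INF t\<in>{0..}. dist z (r t) - t)"

context
  fixes r :: "real \<Rightarrow> 'a::metric_space"
  assumes r: "geodesic_ray r"
begin

lemma busemann_bdd_below: "bdd_below ((\<lambda>t. dist z (r t) - t) ` {0..})"
proof (rule bdd_belowI2[of _ "- dist z (r 0)"])
  fix t :: real assume "t \<in> {0..}"
  then show "- dist z (r 0) \<le> dist z (r t) - t"
    using dist_to_ray_ge(1)[OF r, of t z] by simp
qed

lemma busemann_le: "0 \<le> t \<Longrightarrow> busemann r z \<le> dist z (r t) - t"
  unfolding busemann_def by (rule cINF_lower[OF busemann_bdd_below]) simp

lemma busemann_greatest: "(\<And>t. 0 \<le> t \<Longrightarrow> c \<le> dist z (r t) - t) \<Longrightarrow> c \<le> busemann r z"
  unfolding busemann_def by (rule cINF_greatest) auto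

lemma busemann_antimono:
  assumes "0 \<le> s" "s \<le> t"
  shows "dist z (r t) - t \<le> dist z (r s) - s"
  using dist_triangle[of z "r t" "r s"] geodesic_rayD[OF r, of s t] assms by simp

lemma busemann_tendsto: "((\<lambda>t. dist z (r t) - t) \<longlongrightarrow> busemann r z) at_top"
proof (rule tendstoI)
  fix e :: real assume "e > 0"
  then have "busemann r z < busemann r z + e" by simp
  then obtain s where s: "0 \<le> s" "dist z (r s) - s < busemann r z + e"
    unfolding busemann_def by (subst (asm) cINF_less_iff[OF _ busemann_bdd_below]) auto
  have "dist (dist z (r t) - t) (busemann r z) < e" if "t \<ge> s" for t
    using busemann_antimono[OF s(1) that, of z] busemann_le[of t z] s that
    by (simp add: dist_real_def)
  then show "eventually (\<lambda>t. dist (dist z (r t) - t) (busemann r z) < e) at_top"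
    unfolding eventually_at_top_linorder by blast
qed

lemma busemann_tendsto_sequentially:
  "(\<lambda>n. dist z (r (real n)) - real n) \<longlonglongrightarrow> busemann r z"
  by (rule filterlim_compose[OF busemann_tendsto filterlim_real_sequentially])

lemma busemann_lipschitz: "\<bar>busemann r z - busemann r w\<bar> \<le> dist z w"
proof -
  have "busemann r z - dist z w \<le> busemann r w" for z w
  proof (rule busemann_greatest)
    fix t :: real assume "0 \<le> t"
    then show "busemann r z - dist z w \<le> dist w (r t) - t"
      using busemann_le[of t z] dist_triangle[of z "r t" w] by linarith
  qed
  from this[of z w] this[of w z] show ?thesis by (simp add: dist_commute abs_le_iff)
qed

lemma busemann_ray: "0 \<le> s \<Longrightarrow> busemann r (r s) = - s"
proof (rule antisym)
  assume s: "0 \<le> s"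
  show "busemann r (r s) \<le> - s" using busemann_le[OF s, of "r s"] by simp
  show "- s \<le> busemann r (r s)"
    by (rule busemann_greatest) (use s geodesic_rayD[OF r s] in simp)
qed

lemma tendsto_busemann:
  assumes "(X \<longlongrightarrow> z) F"
  shows "((\<lambda>n. busemann r (X n)) \<longlongrightarrow> busemann r z) F"
proof (rule metric_tendsto_imp_tendsto[OF assms])
  show "eventually (\<lambda>n. dist (busemann r (X n)) (busemann r z) \<le> dist (X n) z) F"
    using busemann_lipschitz by (simp add: dist_real_def)
qed

end

lemma busemann_convex:
  fixes r :: "real \<Rightarrow> 'a::hadamard_space"
  assumes r: "geodesic_ray r" and l: "l \<in> {0..1}"
  shows "busemann r (conv y z l) \<le> (1 - l) * busemann r y + l * busemann r z"
proof (rule tendsto_le[OF sequentially_bot])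
  show "(\<lambda>n. dist (conv y z l) (r (real n)) - real n) \<longlonglongrightarrow> busemann r (conv y z l)"
    by (rule busemann_tendsto_sequentially[OF r])
  show "(\<lambda>n. (1 - l) * (dist y (r (real n)) - real n) + l * (dist z (r (real n)) - real n))
      \<longlonglongrightarrow> (1 - l) * busemann r y + l * busemann r z"
    by (intro tendsto_intros busemann_tendsto_sequentially[OF r])
  have "dist (conv y z l) (r (real n)) - real n
      \<le> (1 - l) * (dist y (r (real n)) - real n) + l * (dist z (r (real n)) - real n)" for n
    using dist_conv_convex[OF l, of "r (real n)" y z] by (simp add: dist_commute algebra_simps)
  then show "eventually (\<lambda>n. dist (conv y z l) (r (real n)) - real n
      \<le> (1 - l) * (dist y (r (real n)) - real n) + l * (dist z (r (real n)) - real n)) sequentially"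
    by simp
qed

text \<open>One direction is the Lipschitz bound. For the other, the ray from \<open>p\<close> is
  approximated by segments from \<open>p\<close> to far points of the reference ray, along which the
  distance to the endpoint drops at unit speed.\<close>

lemma busemann_ray_from:
  fixes p :: "'a::hadamard_space"
  assumes \<xi>: "\<xi> \<in> ideal_boundary" and s: "0 \<le> s"
  shows "busemann (ray_from q \<xi>) (ray_from p \<xi> s) = busemann (ray_from q \<xi>) p - s"
proof (rule antisym)
  let ?r = "ray_from q \<xi>"
  note r = geodesic_ray_ray_from[OF \<xi>, of q]
  show "busemann ?r p - s \<le> busemann ?r (ray_from p \<xi> s)"
    using busemann_lipschitz[OF r, of p "ray_from p \<xi> s"] dist_ray_from_start[OF \<xi> s, of p] by simp
  define \<sigma> where "\<sigma> n = conv p (?r (real n)) (s / dist p (?r (real n)))" for n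
  show "busemann ?r (ray_from p \<xi> s) \<le> busemann ?r p - s"
  proof (rule tendsto_le[OF sequentially_bot])
    have "\<sigma> \<longlonglongrightarrow> ray_from p \<xi> s"
      using ray_from_limit[OF \<xi> s, of p q] by (simp add: \<sigma>_def[abs_def])
    then show "(\<lambda>n. busemann ?r (\<sigma> n)) \<longlonglongrightarrow> busemann ?r (ray_from p \<xi> s)"
      by (rule tendsto_busemann[OF r])
    show "(\<lambda>n. (dist p (?r (real n)) - real n) - s) \<longlonglongrightarrow> busemann ?r p - s"
      by (intro tendsto_intros busemann_tendsto_sequentially[OF r])
    show "eventually (\<lambda>n. busemann ?r (\<sigma> n) \<le> (dist p (?r (real n)) - real n) - s) sequentially"
      using eventually_unit_quotient[OF dist_point_ray_at_top[OF r] s, of p]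
    proof eventually_elim
      case (elim n)
      then have "dist (\<sigma> n) (?r (real n)) = (1 - s / dist p (?r (real n))) * dist p (?r (real n))"
        unfolding \<sigma>_def by (intro dist_conv_right) auto
      also have "\<dots> = dist p (?r (real n)) - s" using elim by (simp add: field_simps)
      finally show ?case using busemann_le[OF r, of "real n" "\<sigma> n"] by simp
    qed
  qed
qed

text \<open>Stewart's inequality for the ideal triangle \<open>q, x, \<xi>\<close>.\<close>

lemma dist_ray_from_busemann:
  fixes q :: "'a::hadamard_space"
  assumes \<xi>: "\<xi> \<in> ideal_boundary" and s: "0 \<le> s"
  shows "(dist q (ray_from x \<xi> s))\<^sup>2 \<le> (dist q x)\<^sup>2 + s\<^sup>2 - 2 * s * busemann (ray_from q \<xi>) x"
proof (rule tendsto_le[OF sequentially_bot])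
  let ?r = "ray_from q \<xi>"
  note r = geodesic_ray_ray_from[OF \<xi>, of q]
  define P where "P n = dist x (?r (real n))" for n
  define \<sigma> where "\<sigma> n = conv x (?r (real n)) (s / P n)" for n
  have "\<sigma> \<longlonglongrightarrow> ray_from x \<xi> s"
    using ray_from_limit[OF \<xi> s, of x q] by (simp add: \<sigma>_def[abs_def] P_def)
  then show "(\<lambda>n. (dist q (\<sigma> n))\<^sup>2) \<longlonglongrightarrow> (dist q (ray_from x \<xi> s))\<^sup>2"
    by (intro tendsto_intros)
  have P: "filterlim P at_top sequentially"
    unfolding P_def by (rule dist_point_ray_at_top[OF r])
  have b: "(\<lambda>n. P n - real n) \<longlonglongrightarrow> busemann ?r x"
    unfolding P_def by (rule busemann_tendsto_sequentially[OF r])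
  \<comment> \<open>Stewart's bound for \<open>q\<close>, \<open>x\<close> and the n-th point of the
    ray, rearranged so that the diverging P n and n occur only through 1 / P n and P n - n, which
    converge.\<close>
  have "(\<lambda>n. (1 - s / P n) * (dist q x)\<^sup>2 - s * ((P n - real n) * (2 - (P n - real n) / P n)) + s\<^sup>2)
      \<longlonglongrightarrow> (1 - 0) * (dist q x)\<^sup>2 - s * (busemann ?r x * (2 - 0)) + s\<^sup>2"
    by (intro tendsto_intros b tendsto_divide_0[OF b filterlim_at_top_imp_at_infinity[OF P]]
        tendsto_divide_0[OF tendsto_const filterlim_at_top_imp_at_infinity[OF P]])
  then show "(\<lambda>n. (1 - s / P n) * (dist q x)\<^sup>2 - s * ((P n - real n) * (2 - (P n - real n) / P n)) + s\<^sup>2)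
      \<longlonglongrightarrow> (dist q x)\<^sup>2 + s\<^sup>2 - 2 * s * busemann ?r x"
    by (simp add: algebra_simps)
  show "eventually (\<lambda>n. (dist q (\<sigma> n))\<^sup>2 \<le>
      (1 - s / P n) * (dist q x)\<^sup>2 - s * ((P n - real n) * (2 - (P n - real n) / P n)) + s\<^sup>2) sequentially"
    using eventually_unit_quotient[OF dist_point_ray_at_top[OF r] s, of x]
  proof eventually_elim
    case (elim n)
    then have l: "s / P n \<in> {0..1}" and pos: "P n > 0" by (simp_all add: P_def)
    have "(dist q (\<sigma> n))\<^sup>2 \<le> (1 - s / P n) * (dist q x)\<^sup>2 + s / P n * (real n)\<^sup>2
        - s / P n * (1 - s / P n) * (P n)\<^sup>2"
      using stewart[OF l, of q x "?r (real n)"] dist_ray_from_start[OF \<xi>, of "real n" q]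
      by (simp add: \<sigma>_def P_def)
    also have "\<dots> = (1 - s / P n) * (dist q x)\<^sup>2
        - s * ((P n - real n) * (2 - (P n - real n) / P n)) + s\<^sup>2"
      using pos by (simp add: field_simps power2_eq_square)
    finally show ?case .
  qed
qed

text \<open>Both functions decrease at unit speed towards \<open>\<xi>\<close>, so each bounds the
  other up to a constant, and it remains to see that the two constants have sum \<le> 0. Indeed the
  distance from \<open>q\<close> to the point at parameter s of the ray from \<open>p\<close> is at
  least s + \<open>\<beta>\<close>, while its square is at most s^2 - 2 s b + const; comparing the
  terms linear in s gives \<open>\<beta>\<close> \<le> -b.\<close>

lemma busemann_base_change:
  fixes p q :: "'a::hadamard_space"
  assumes \<xi>: "\<xi> \<in> ideal_boundary"
  shows "busemann (ray_from p \<xi>) z = busemann (ray_from q \<xi>) z - busemann (ray_from q \<xi>) p"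
proof -
  note ray = geodesic_ray_ray_from[OF \<xi>]
  have 1: "busemann (ray_from q \<xi>) z - busemann (ray_from q \<xi>) p \<le> busemann (ray_from p \<xi>) z" for p q z
  proof (rule busemann_greatest[OF ray])
    fix t :: real assume t: "0 \<le> t"
    show "busemann (ray_from q \<xi>) z - busemann (ray_from q \<xi>) p \<le> dist z (ray_from p \<xi> t) - t"
      using busemann_lipschitz[OF ray, of q z "ray_from p \<xi> t"] busemann_ray_from[OF \<xi> t, of q p]
      by linarith
  qed
  define b where "b = busemann (ray_from q \<xi>) p"
  define \<beta> where "\<beta> = busemann (ray_from p \<xi>) q"
  have "\<beta> + b \<le> 0"
  proof (rule ccontr)
    assume "\<not> \<beta> + b \<le> 0"
    then have pos: "\<beta> + b > 0" by simp
    define s where "s = \<bar>\<beta>\<bar> + (dist q p)\<^sup>2 / (\<beta> + b) + 1"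
    have quot: "(dist q p)\<^sup>2 / (\<beta> + b) \<ge> 0" using pos by simp
    then have s: "s \<ge> 0" "s + \<beta> \<ge> 0" "s > (dist q p)\<^sup>2 / (\<beta> + b)" by (auto simp: s_def)
    have "s + \<beta> \<le> dist q (ray_from p \<xi> s)"
      using busemann_le[OF ray s(1), of p q] by (simp add: \<beta>_def)
    then have "(s + \<beta>)\<^sup>2 \<le> (dist q (ray_from p \<xi> s))\<^sup>2"
      using s by (intro power_mono)
    also have "\<dots> \<le> (dist q p)\<^sup>2 + s\<^sup>2 - 2 * s * b"
      unfolding b_def by (rule dist_ray_from_busemann[OF \<xi> s(1)])
    finally have "2 * (s * (\<beta> + b)) + \<beta>\<^sup>2 \<le> (dist q p)\<^sup>2"
      by (simp add: power2_eq_square algebra_simps)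
    moreover have "(dist q p)\<^sup>2 < s * (\<beta> + b)" using s(3) pos by (simp add: pos_divide_less_eq)
    moreover have "0 \<le> (dist q p)\<^sup>2" "0 \<le> \<beta>\<^sup>2" by simp_all
    ultimately show False by linarith
  qed
  with 1[of q z p] 1[of p z q] show ?thesis
    unfolding b_def \<beta>_def by linarith
qed

lemma busemann_ray_from_self [simp]:
  "\<xi> \<in> ideal_boundary \<Longrightarrow> busemann (ray_from p \<xi>) p = 0"
  using busemann_ray[OF geodesic_ray_ray_from, of \<xi> 0 p] by (simp add: ray_from_0)

section \<open>Angles\<close>

text \<open>Angles are handled through their cosines, for which the law of cosines is algebraic and
  limits are monotone; \<open>arccos\<close> appears only where the definitions of the angles are
  unfolded or where directions are compared.\<close>

definition comparison_cos :: "'a::metric_space \<Rightarrow> 'a \<Rightarrow> 'a \<Rightarrow> real" where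
  "comparison_cos x y z =
     ((dist x y)\<^sup>2 + (dist x z)\<^sup>2 - (dist y z)\<^sup>2) / (2 * dist x y * dist x z)"

lemma comparison_angle_arccos: "comparison_angle x y z = arccos (comparison_cos x y z)"
  by (simp add: comparison_angle_def comparison_cos_def)

lemma comparison_cos_commute: "comparison_cos x y z = comparison_cos x z y"
  by (simp add: comparison_cos_def dist_commute mult.commute add.commute)

text \<open>From 2 a b \<le> a^2 + b^2. It shows that far points at bounded distance from each other
  are seen from \<open>x\<close> under a small angle.\<close>

lemma comparison_cos_ge:
  assumes "x \<noteq> y" "x \<noteq> z"
  shows "1 - (dist y z)\<^sup>2 / (2 * dist x y * dist x z) \<le> comparison_cos x y z"
proof -
  define a b d where "a = dist x y" and "b = dist x z" and "d = dist y z"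
  have pos: "a > 0" "b > 0" using assms by (simp_all add: a_def b_def)
  have "0 \<le> (a - b)\<^sup>2" by simp
  then have "2 * a * b \<le> a\<^sup>2 + b\<^sup>2" by (simp add: power2_eq_square algebra_simps)
  then have "(2 * a * b - d\<^sup>2) / (2 * a * b) \<le> (a\<^sup>2 + b\<^sup>2 - d\<^sup>2) / (2 * a * b)"
    using pos by (intro divide_right_mono) auto
  then show ?thesis
    using pos by (simp add: comparison_cos_def diff_divide_distrib flip: a_def b_def d_def)
qed

lemma comparison_cos_bounds:
  assumes "x \<noteq> y" "x \<noteq> z"
  shows "comparison_cos x y z \<in> {-1..1}"
proof -
  define a b d where "a = dist x y" and "b = dist x z" and "d = dist y z"
  have pos: "a > 0" "b > 0" using assms by (simp_all add: a_def b_def)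
  have d: "d \<le> a + b" "\<bar>a - b\<bar> \<le> d" "d \<ge> 0"
    using dist_triangle[of y z x] dist_triangle[of x y z] dist_triangle[of x z y]
    by (auto simp: a_def b_def d_def dist_commute abs_le_iff)
  have "d\<^sup>2 \<le> (a + b)\<^sup>2" using d by (intro power_mono)
  moreover have "\<bar>a - b\<bar>\<^sup>2 \<le> d\<^sup>2" using d by (intro power_mono) auto
  ultimately have "- (2 * a * b) \<le> a\<^sup>2 + b\<^sup>2 - d\<^sup>2" "a\<^sup>2 + b\<^sup>2 - d\<^sup>2 \<le> 2 * a * b"
    by (simp_all add: power2_eq_square algebra_simps)
  then show ?thesis
    using pos by (simp add: comparison_cos_def divide_le_eq le_divide_eq flip: a_def b_def d_def)
qed

text \<open>This is \<open>cat0\<close> divided by twice the product of the sides: comparison angles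
  shrink as the endpoints approach the vertex.\<close>

lemma comparison_cos_conv:
  fixes x y z :: "'a::hadamard_space"
  assumes "x \<noteq> y" "x \<noteq> z" and s: "s \<in> {0<..1}" and t: "t \<in> {0<..1}"
  shows "comparison_cos x y z \<le> comparison_cos x (conv x y s) (conv x z t)"
proof -
  define a b where "a = dist x y" and "b = dist x z"
  have pos: "a > 0" "b > 0" using assms by (simp_all add: a_def b_def)
  have st: "s \<in> {0..1}" "t \<in> {0..1}" "s > 0" "t > 0" using s t by auto
  have "(dist (conv x y s) (conv x z t))\<^sup>2 \<le> s\<^sup>2 * a\<^sup>2 + t\<^sup>2 * b\<^sup>2 - s * t * (a\<^sup>2 + b\<^sup>2 - (dist y z)\<^sup>2)"
    using cat0[OF st(1,2), of x y z] by (simp add: a_def b_def)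
  then have "s * t * (a\<^sup>2 + b\<^sup>2 - (dist y z)\<^sup>2) / (2 * (s * a) * (t * b))
      \<le> ((s * a)\<^sup>2 + (t * b)\<^sup>2 - (dist (conv x y s) (conv x z t))\<^sup>2) / (2 * (s * a) * (t * b))"
    using pos st by (intro divide_right_mono) (auto simp: power_mult_distrib)
  then show ?thesis
    using st pos by (simp add: comparison_cos_def dist_conv_left flip: a_def b_def)
qed

lemma conv_geo:
  assumes "x \<noteq> y" "0 < s" "s \<le> s'" "s' \<le> dist x y"
  shows "conv x (geo x y s') (s / s') = geo x y s"
proof -
  have d: "dist x y > 0" using assms by simp
  have "conv x (conv x y (s' / dist x y)) (s / s') = conv x y (s / s' * (s' / dist x y))"
    using assms d by (intro conv_conv) auto
  then show ?thesis using assms d by (simp add: conv_def[of x y])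
qed

lemma dist_geo: "s \<in> {0..dist x y} \<Longrightarrow> dist x (geo x y s) = s"
  using geodesic_segmentD(3)[OF conv_geodesic[of x y], of 0 s] geodesic_segmentD(1)[OF conv_geodesic[of x y]]
  by simp

lemma comparison_cos_geo_antimono:
  fixes x y z :: "'a::hadamard_space"
  assumes ne: "x \<noteq> y" "x \<noteq> z" and s: "0 < s" "s \<le> s'" "s' \<le> dist x y"
    and t: "0 < t" "t \<le> t'" "t' \<le> dist x z"
  shows "comparison_cos x (geo x y s') (geo x z t') \<le> comparison_cos x (geo x y s) (geo x z t)"
proof -
  have "x \<noteq> geo x y s'" "x \<noteq> geo x z t'"
    using dist_geo[of s' x y] dist_geo[of t' x z] s t by auto
  from comparison_cos_conv[OF this, of "s / s'" "t / t'"] s t show ?thesis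
    by (simp add: conv_geo[OF ne(1)] conv_geo[OF ne(2)])
qed

lemma cos_arccos_limit:
  assumes "(f \<longlongrightarrow> L) F" "eventually (\<lambda>x. f x \<in> {-1..1}) F" "F \<noteq> bot"
  shows "((\<lambda>x. arccos (f x)) \<longlongrightarrow> arccos L) F" "cos (arccos L) = L"
proof -
  have "L \<in> {-1..1}"
    using assms by (intro Lim_in_closed_set) auto
  then show "((\<lambda>x. arccos (f x)) \<longlongrightarrow> arccos L) F" "cos (arccos L) = L"
    using continuous_on_tendsto_compose[OF continuous_on_arccos' assms(1) _ assms(2)] by auto
qed

text \<open>By monotonicity the limit in \<open>segment_angle\<close> exists, and its cosine is the
  supremum of the comparison cosines. The two claims express this supremum; uniqueness of geodesics
  disposes of the quantifier over \<open>g\<close> and \<open>h\<close>.\<close>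

lemma segment_angle:
  fixes x y z :: "'a::hadamard_space"
  assumes ne: "x \<noteq> y" "x \<noteq> z"
  shows cos_segment_angle_ge: "0 < s \<Longrightarrow> s \<le> dist x y \<Longrightarrow> 0 < t \<Longrightarrow> t \<le> dist x z \<Longrightarrow>
      comparison_cos x (geo x y s) (geo x z t) \<le> cos (segment_angle x y z)"
    and cos_segment_angle_approx: "0 < e \<Longrightarrow> \<exists>d>0. \<forall>s t. 0 < s \<and> s < d \<and> 0 < t \<and> t < d \<longrightarrow>
      cos (segment_angle x y z) - e < comparison_cos x (geo x y s) (geo x z t)"
proof -
  define P Q where "P = dist x y" and "Q = dist x z"
  have pos: "P > 0" "Q > 0" using ne by (simp_all add: P_def Q_def)
  define F where "F s t = comparison_cos x (geo x y s) (geo x z t)" for s t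
  have mono: "F s' t' \<le> F s t" if "0 < s" "s \<le> s'" "s' \<le> P" "0 < t" "t \<le> t'" "t' \<le> Q" for s s' t t'
    using comparison_cos_geo_antimono[OF ne] that by (simp add: F_def P_def Q_def)
  have range: "F s t \<in> {-1..1}" if "0 < s" "s \<le> P" "0 < t" "t \<le> Q" for s t
    unfolding F_def
    by (rule comparison_cos_bounds)
      (use that dist_geo[of s x y] dist_geo[of t x z] in \<open>auto simp: P_def Q_def\<close>)
  define A where "A = (\<lambda>(s, t). F s t) ` ({0<..P} \<times> {0<..Q})"
  define L where "L = Sup A"
  have ne: "A \<noteq> {}" using pos by (auto simp: A_def)
  have bdd: "bdd_above A" using range by (auto simp: A_def intro!: bdd_aboveI[of _ 1])
  have le: "F s t \<le> L" if "0 < s" "s \<le> P" "0 < t" "t \<le> Q" for s t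
    unfolding L_def by (rule cSup_upper[OF _ bdd]) (use that in \<open>auto simp: A_def\<close>)
  have approx: "\<exists>d>0. d \<le> P \<and> d \<le> Q \<and> (\<forall>s t. 0 < s \<and> s < d \<and> 0 < t \<and> t < d \<longrightarrow> L - e < F s t)"
    if e: "e > 0" for e
  proof -
    have "L - e < Sup A" using e by (simp add: L_def)
    then obtain s0 t0 where st0: "0 < s0" "s0 \<le> P" "0 < t0" "t0 \<le> Q" "L - e < F s0 t0"
      using less_cSup_iff[OF ne bdd] by (auto simp: A_def)
    have "L - e < F s t" if "0 < s \<and> s < min s0 t0 \<and> 0 < t \<and> t < min s0 t0" for s t
      using mono[of s s0 t t0] st0 that by auto
    then show ?thesis using st0 by (intro exI[of _ "min s0 t0"]) auto
  qed
  let ?N = "at_right (0::real) \<times>\<^sub>F at_right (0::real)"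
  have N: "?N \<noteq> bot" by (simp add: prod_filter_eq_bot)
  have box: "eventually Z ?N" if "d > 0" "\<And>s t. 0 < s \<Longrightarrow> s < d \<Longrightarrow> 0 < t \<Longrightarrow> t < d \<Longrightarrow> Z (s, t)" for d Z
    unfolding eventually_prod_filter
    using that by (intro exI[of _ "\<lambda>s. 0 < s \<and> s < d"] conjI)
      (auto simp: eventually_at_right_field intro: exI[of _ d])
  have lim: "((\<lambda>(s, t). F s t) \<longlongrightarrow> L) ?N"
  proof (rule tendstoI)
    fix e :: real assume "e > 0"
    then obtain d where d: "d > 0" "d \<le> P" "d \<le> Q"
        "\<And>s t. 0 < s \<and> s < d \<and> 0 < t \<and> t < d \<Longrightarrow> L - e < F s t"
      using approx by blast
    show "eventually (\<lambda>u. dist (case u of (s, t) \<Rightarrow> F s t) L < e) ?N"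
    proof (rule box[OF d(1)])
      fix s t assume "0 < s" "s < d" "0 < t" "t < d"
      then show "dist (case (s, t) of (s, t) \<Rightarrow> F s t) L < e"
        using d(4)[of s t] le[of s t] d(2,3) by (simp add: dist_real_def)
    qed
  qed
  have ev: "eventually (\<lambda>u. (case u of (s, t) \<Rightarrow> F s t) \<in> {-1..1}) ?N"
    by (rule box[of "min P Q"]) (use pos range in auto)
  note lim' = cos_arccos_limit[OF lim ev N]
  have agree: "((\<lambda>(s, t). comparison_angle x (g s) (h t)) \<longlongrightarrow> a) ?N \<longleftrightarrow>
      ((\<lambda>u. arccos (case u of (s, t) \<Rightarrow> F s t)) \<longlongrightarrow> a) ?N"
    if gh: "geodesic_segment x y g" "geodesic_segment x z h" for g h a
  proof (rule tendsto_cong, rule box[of "min P Q"])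
    fix s t assume st: "0 < s" "s < min P Q" "0 < t" "t < min P Q"
    have "g s = geo x y s" "h t = geo x z t"
      using geodesic_segment_unique[OF gh(1), of "s / P"] geodesic_segment_unique[OF gh(2), of "t / Q"]
        st pos by (simp_all add: P_def Q_def conv_def)
    then show "(case (s, t) of (s, t) \<Rightarrow> comparison_angle x (g s) (h t)) =
        arccos (case (s, t) of (s, t) \<Rightarrow> F s t)"
      by (simp add: F_def comparison_angle_arccos)
  qed (use pos in auto)
  have "segment_angle x y z = arccos L"
    unfolding segment_angle_def
  proof (rule the_equality)
    show "\<forall>g h. geodesic_segment x y g \<and> geodesic_segment x z h \<longrightarrow>
        ((\<lambda>(s, t). comparison_angle x (g s) (h t)) \<longlongrightarrow> arccos L) ?N"
      using agree lim'(1) by simp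
    fix a assume "\<forall>g h. geodesic_segment x y g \<and> geodesic_segment x z h \<longrightarrow>
        ((\<lambda>(s, t). comparison_angle x (g s) (h t)) \<longlongrightarrow> a) ?N"
    then have "((\<lambda>(s, t). comparison_angle x (geo x y s) (geo x z t)) \<longlongrightarrow> a) ?N"
      using conv_geodesic by metis
    then have "((\<lambda>u. arccos (case u of (s, t) \<Rightarrow> F s t)) \<longlongrightarrow> a) ?N"
      using agree[OF conv_geodesic conv_geodesic] by simp
    then show "a = arccos L" using tendsto_unique[OF N _ lim'(1)] by blast
  qed
  then have cos: "cos (segment_angle x y z) = L" using lim'(2) by simp
  show "comparison_cos x (geo x y s) (geo x z t) \<le> cos (segment_angle x y z)"
    if "0 < s" "s \<le> dist x y" "0 < t" "t \<le> dist x z"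
    using le that by (simp add: cos F_def P_def Q_def)
  show "\<exists>d>0. \<forall>s t. 0 < s \<and> s < d \<and> 0 < t \<and> t < d \<longrightarrow>
      cos (segment_angle x y z) - e < comparison_cos x (geo x y s) (geo x z t)" if "0 < e"
    using approx[OF that] by (auto simp: cos F_def)
qed

lemma cos_segment_angle_commute:
  fixes x y z :: "'a::hadamard_space"
  assumes ne: "x \<noteq> y" "x \<noteq> z"
  shows "cos (segment_angle x y z) = cos (segment_angle x z y)"
proof -
  have "cos (segment_angle x y z) \<le> cos (segment_angle x z y)" if ne: "x \<noteq> y" "x \<noteq> z" for y z
  proof (rule field_le_epsilon)
    fix e :: real assume "e > 0"
    then obtain d where d: "d > 0" "\<And>s t. 0 < s \<and> s < d \<and> 0 < t \<and> t < d \<Longrightarrow>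
        cos (segment_angle x y z) - e < comparison_cos x (geo x y s) (geo x z t)"
      using cos_segment_angle_approx[OF ne] by blast
    define s where "s = Min {d / 2, dist x y, dist x z}"
    have s: "0 < s" "s < d" "s \<le> dist x y" "s \<le> dist x z" using d(1) ne by (auto simp: s_def min_def)
    have "cos (segment_angle x y z) - e < comparison_cos x (geo x y s) (geo x z s)"
      using d(2) s by simp
    also have "\<dots> = comparison_cos x (geo x z s) (geo x y s)" by (rule comparison_cos_commute)
    also have "\<dots> \<le> cos (segment_angle x z y)"
      using s by (intro cos_segment_angle_ge ne) auto
    finally show "cos (segment_angle x y z) \<le> cos (segment_angle x z y) + e" by simp
  qed
  from this[OF ne] this[OF ne(2,1)] show ?thesis by simp
qed

section \<open>Slopes of Busemann functions along rays\<close>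

text \<open>The derivative at \<open>p\<close> of the Busemann function of \<open>\<omega>\<close>
  along the ray to \<open>\<xi>\<close>, and equally with the two exchanged. Parameter 1 is
  arbitrary, since the angle depends only on initial pieces of the rays.\<close>

definition ray_slope :: "'a::hadamard_space \<Rightarrow> (real \<Rightarrow> 'a) set \<Rightarrow> (real \<Rightarrow> 'a) set \<Rightarrow> real" where
  "ray_slope p \<omega> \<xi> = - cos (segment_angle p (ray_from p \<omega> 1) (ray_from p \<xi> 1))"

lemma ray_from_ne:
  fixes p :: "'a::hadamard_space"
  shows "\<xi> \<in> ideal_boundary \<Longrightarrow> 0 < t \<Longrightarrow> p \<noteq> ray_from p \<xi> t"
  using dist_ray_from_start[of \<xi> t p] by auto

lemma conv_ray_from:
  fixes p :: "'a::hadamard_space"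
  assumes "\<xi> \<in> ideal_boundary" "0 \<le> T" "l \<in> {0..1}"
  shows "conv p (ray_from p \<xi> T) l = ray_from p \<xi> (l * T)"
  using conv_ray[OF geodesic_ray_ray_from[OF assms(1), of p] assms(2,3)] assms(1)
  by (simp add: ray_from_0)

lemma geo_ray_from:
  fixes p :: "'a::hadamard_space"
  assumes "\<xi> \<in> ideal_boundary" "s \<in> {0..1}"
  shows "geo p (ray_from p \<xi> 1) s = ray_from p \<xi> s"
  using conv_ray_from[of \<xi> 1 s p] assms dist_ray_from_start[of \<xi> 1 p] by (simp add: conv_def)

lemma ray_slope_commute:
  "\<omega> \<in> ideal_boundary \<Longrightarrow> \<xi> \<in> ideal_boundary \<Longrightarrow> ray_slope p \<omega> \<xi> = ray_slope p \<xi> \<omega>"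
  unfolding ray_slope_def by (subst cos_segment_angle_commute) (simp_all add: ray_from_ne)

lemma comparison_cos_rays_antimono:
  fixes p :: "'a::hadamard_space"
  assumes \<omega>: "\<omega> \<in> ideal_boundary" and \<xi>: "\<xi> \<in> ideal_boundary"
    and s: "0 < s" "s \<le> s'" and t: "0 < t" "t \<le> t'"
  shows "comparison_cos p (ray_from p \<omega> s') (ray_from p \<xi> t')
    \<le> comparison_cos p (ray_from p \<omega> s) (ray_from p \<xi> t)"
proof -
  have "comparison_cos p (ray_from p \<omega> s') (ray_from p \<xi> t')
      \<le> comparison_cos p (conv p (ray_from p \<omega> s') (s / s')) (conv p (ray_from p \<xi> t') (t / t'))"
    by (rule comparison_cos_conv)
      (use s t ray_from_ne[OF \<omega>, of s' p] ray_from_ne[OF \<xi>, of t' p] in auto)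
  then show ?thesis
    using s t by (simp add: conv_ray_from[OF \<omega>] conv_ray_from[OF \<xi>])
qed

lemma comparison_cos_le_ray_slope:
  fixes p :: "'a::hadamard_space"
  assumes \<omega>: "\<omega> \<in> ideal_boundary" and \<xi>: "\<xi> \<in> ideal_boundary" and s: "0 < s" and t: "0 < t"
  shows "comparison_cos p (ray_from p \<omega> s) (ray_from p \<xi> t) \<le> - ray_slope p \<omega> \<xi>"
proof -
  define s' t' where "s' = min s 1" and "t' = min t 1"
  have st': "0 < s'" "s' \<le> s" "s' \<le> 1" "0 < t'" "t' \<le> t" "t' \<le> 1"
    using s t by (auto simp: s'_def t'_def)
  have "comparison_cos p (ray_from p \<omega> s) (ray_from p \<xi> t)
      \<le> comparison_cos p (ray_from p \<omega> s') (ray_from p \<xi> t')"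
    using st' by (intro comparison_cos_rays_antimono \<omega> \<xi>)
  also have "\<dots> = comparison_cos p (geo p (ray_from p \<omega> 1) s') (geo p (ray_from p \<xi> 1) t')"
    using st' by (simp add: geo_ray_from \<omega> \<xi>)
  also have "\<dots> \<le> - ray_slope p \<omega> \<xi>"
    unfolding ray_slope_def minus_minus
    by (rule cos_segment_angle_ge) (use st' dist_ray_from_start[OF \<omega>, of 1 p]
        dist_ray_from_start[OF \<xi>, of 1 p] ray_from_ne[OF \<omega>] ray_from_ne[OF \<xi>] in auto)
  finally show ?thesis .
qed

lemma dist_rays_sq:
  fixes p :: "'a::hadamard_space"
  assumes \<omega>: "\<omega> \<in> ideal_boundary" and \<xi>: "\<xi> \<in> ideal_boundary" and s: "0 < s" and t: "0 < t"
  shows "(dist (ray_from p \<omega> s) (ray_from p \<xi> t))\<^sup>2 =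
    s\<^sup>2 + t\<^sup>2 - 2 * s * t * comparison_cos p (ray_from p \<omega> s) (ray_from p \<xi> t)"
  using s t dist_ray_from_start[OF \<omega>, of s p] dist_ray_from_start[OF \<xi>, of t p]
  by (simp add: comparison_cos_def)

lemma abs_ray_slope_le: "\<bar>ray_slope p \<omega> \<xi>\<bar> \<le> 1"
  by (simp add: ray_slope_def abs_cos_le_one)

text \<open>The distance between the points at parameters s and t is at least the third side of a
  Euclidean triangle with the angle of the rays at \<open>p\<close>, and that side is at least its
  projection t - s c to the ray towards \<open>\<xi>\<close>.\<close>

lemma busemann_ge_ray_slope:
  fixes p :: "'a::hadamard_space"
  assumes \<omega>: "\<omega> \<in> ideal_boundary" and \<xi>: "\<xi> \<in> ideal_boundary" and s: "0 \<le> s"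
  shows "s * ray_slope p \<omega> \<xi> \<le> busemann (ray_from p \<xi>) (ray_from p \<omega> s)"
proof (cases "s = 0")
  case True
  then show ?thesis by (simp add: ray_from_0[OF \<omega>] busemann_ray_from_self[OF \<xi>])
next
  case False
  with s have s: "s > 0" by simp
  define c where "c = - ray_slope p \<omega> \<xi>"
  have c: "\<bar>c\<bar> \<le> 1" by (simp add: c_def abs_ray_slope_le)
  have "- (s * c) \<le> busemann (ray_from p \<xi>) (ray_from p \<omega> s)"
  proof (rule busemann_greatest[OF geodesic_ray_ray_from[OF \<xi>]])
    fix t :: real assume "0 \<le> t"
    show "- (s * c) \<le> dist (ray_from p \<omega> s) (ray_from p \<xi> t) - t"
    proof (cases "t = 0")
      case True
      have "\<bar>s * c\<bar> \<le> s * 1" unfolding abs_mult using s c by (intro mult_mono) auto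
      then show ?thesis
        using True s dist_ray_from_start[OF \<omega>, of s p] by (simp add: ray_from_0[OF \<xi>] dist_commute)
    next
      case False
      with \<open>0 \<le> t\<close> have t: "t > 0" by simp
      have "(t - s * c)\<^sup>2 = t\<^sup>2 - 2 * s * t * c + s\<^sup>2 * c\<^sup>2"
        by (simp add: power2_eq_square algebra_simps)
      also have "\<dots> \<le> t\<^sup>2 - 2 * s * t * c + s\<^sup>2 * 1"
        using c by (intro add_mono mult_left_mono) (auto simp: abs_square_le_1)
      also have "\<dots> \<le> t\<^sup>2 - 2 * s * t * comparison_cos p (ray_from p \<omega> s) (ray_from p \<xi> t) + s\<^sup>2"
        using mult_left_mono[OF comparison_cos_le_ray_slope[OF \<omega> \<xi> s t, of p], of "2 * s * t"] s t
        by (simp add: c_def)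
      also have "\<dots> = (dist (ray_from p \<omega> s) (ray_from p \<xi> t))\<^sup>2"
        by (simp add: dist_rays_sq[OF \<omega> \<xi> s t])
      finally have "t - s * c \<le> dist (ray_from p \<omega> s) (ray_from p \<xi> t)"
        by (rule power2_le_imp_le) simp
      then show ?thesis by simp
    qed
  qed
  then show ?thesis by (simp add: c_def)
qed

text \<open>The converse of \<open>busemann_ge_ray_slope\<close> up to e, at a scale where the
  comparison angle is almost the angle. A single s is enough, as convexity will take over from
  there.\<close>

lemma busemann_le_ray_slope_approx:
  fixes p :: "'a::hadamard_space"
  assumes \<omega>: "\<omega> \<in> ideal_boundary" and \<xi>: "\<xi> \<in> ideal_boundary" and e: "0 < e"
  shows "\<exists>s>0. busemann (ray_from p \<xi>) (ray_from p \<omega> s) \<le> s * (ray_slope p \<omega> \<xi> + e)"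
proof -
  define c where "c = - ray_slope p \<omega> \<xi>"
  have c: "\<bar>c\<bar> \<le> 1" by (simp add: c_def abs_ray_slope_le)
  obtain d where d: "d > 0" "\<And>s t. 0 < s \<and> s < d \<and> 0 < t \<and> t < d \<Longrightarrow>
      c - e / 2 < comparison_cos p (geo p (ray_from p \<omega> 1) s) (geo p (ray_from p \<xi> 1) t)"
    using cos_segment_angle_approx[of p "ray_from p \<omega> 1" "ray_from p \<xi> 1" "e / 2"] e
      ray_from_ne[OF \<omega>] ray_from_ne[OF \<xi>] by (auto simp: c_def ray_slope_def)
  define t where "t = min d 1 / 2"
  \<comment> \<open>Small compared with t, so that the quadratic term s^2 / (2 t) of
    \<open>u\<close> is at most s e / 2.\<close>
  define s where "s = t * min 1 e"
  have t: "0 < t" "t < d" "t \<le> 1" using d(1) by (auto simp: t_def min_def)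
  have s: "0 < s" "s \<le> t" "s \<le> t * e"
    using t e unfolding s_def by (simp_all add: mult_left_le)
  then have s': "s < d" "s \<le> 1" using t by linarith+
  define u where "u = s\<^sup>2 / (2 * t) - s * (c - e / 2)"
  have ut: "2 * t * u = s\<^sup>2 - 2 * s * t * (c - e / 2)" using t by (simp add: u_def field_simps)
  have "c - e / 2 < comparison_cos p (ray_from p \<omega> s) (ray_from p \<xi> t)"
    using d(2)[of s t] s s' t by (simp add: geo_ray_from \<omega> \<xi>)
  then have "(dist (ray_from p \<omega> s) (ray_from p \<xi> t))\<^sup>2 \<le> s\<^sup>2 + t\<^sup>2 - 2 * s * t * (c - e / 2)"
    unfolding dist_rays_sq[OF \<omega> \<xi> s(1) t(1)] using s(1) t(1) by simp
  also have "\<dots> = t\<^sup>2 + 2 * t * u" by (simp add: ut)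
  also have "\<dots> \<le> (t + u)\<^sup>2" by (simp add: power2_eq_square algebra_simps)
  finally have sq: "(dist (ray_from p \<omega> s) (ray_from p \<xi> t))\<^sup>2 \<le> (t + u)\<^sup>2" .
  have "s * (c - e / 2) \<le> s * 1" using c e s by (intro mult_left_mono) auto
  moreover have "0 \<le> s\<^sup>2 / (2 * t)" using t by simp
  ultimately have "0 \<le> t + u" using s(2) unfolding u_def by linarith
  with sq have "dist (ray_from p \<omega> s) (ray_from p \<xi> t) \<le> t + u" by (rule power2_le_imp_le)
  then have "busemann (ray_from p \<xi>) (ray_from p \<omega> s) \<le> u"
    using busemann_le[OF geodesic_ray_ray_from[OF \<xi>, of p], of t "ray_from p \<omega> s"] t(1) by linarith
  also have "s\<^sup>2 / (2 * t) \<le> s * (e / 2)"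
  proof -
    have "s * s \<le> s * (t * e)" using s by (intro mult_left_mono) auto
    then show ?thesis using t by (simp add: field_simps power2_eq_square)
  qed
  then have "u \<le> s * (ray_slope p \<omega> \<xi> + e)"
    by (simp add: u_def c_def algebra_simps)
  finally show ?thesis using s(1) by blast
qed

text \<open>The increment of a convex function over [0, m] is at most m times its forward slope at
  m. That slope is read off by prolonging the ray slightly to m + s; symmetry of the angle puts it
  into the stated form.\<close>

lemma busemann_push_le_ray_slope:
  fixes p :: "'a::hadamard_space"
  assumes \<omega>: "\<omega> \<in> ideal_boundary" and \<xi>: "\<xi> \<in> ideal_boundary" and m: "0 \<le> m"
  shows "busemann (ray_from q \<omega>) (ray_from p \<xi> m) - busemann (ray_from q \<omega>) p
    \<le> m * ray_slope (ray_from p \<xi> m) \<omega> \<xi>"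
proof (rule field_le_epsilon)
  fix e :: real assume e: "e > 0"
  define h where "h s = busemann (ray_from q \<omega>) (ray_from p \<xi> s)" for s
  define p' where "p' = ray_from p \<xi> m"
  define e' where "e' = e / (m + 1)"
  have e': "e' > 0" "m * e' \<le> e" using e m by (auto simp: e'_def field_simps)
  obtain s where s: "s > 0"
      "busemann (ray_from p' \<omega>) (ray_from p' \<xi> s) \<le> s * (ray_slope p' \<xi> \<omega> + e')"
    using busemann_le_ray_slope_approx[OF \<xi> \<omega> e'(1)] by blast
  define k where "k = ray_slope p' \<xi> \<omega>"
  define l where "l = m / (m + s)"
  have l: "l \<in> {0..1}" "l * (m + s) = m" using m s(1) by (simp_all add: l_def)
  have "busemann (ray_from p' \<omega>) (ray_from p' \<xi> s) = h (m + s) - h m"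
    using busemann_base_change[OF \<omega>, of p' "ray_from p' \<xi> s" q] ray_from_ray_from[OF \<xi> m, of s p] s(1)
    by (simp add: p'_def h_def)
  with s(2) have 1: "h (m + s) - h m \<le> s * (k + e')" by (simp add: k_def)
  have "h m \<le> (1 - l) * h 0 + l * h (m + s)"
    using busemann_convex[OF geodesic_ray_ray_from[OF \<omega>, of q] l(1), of p "ray_from p \<xi> (m + s)"]
      conv_ray_from[OF \<xi> _ l(1), of "m + s" p] l(2) m s(1) by (simp add: h_def ray_from_0[OF \<xi>])
  then have "(m + s) * h m \<le> (m + s) * ((1 - l) * h 0 + l * h (m + s))"
    using m s(1) by (intro mult_left_mono) auto
  also have "\<dots> = (m + s - l * (m + s)) * h 0 + (l * (m + s)) * h (m + s)"
    by (simp add: algebra_simps)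
  also have "\<dots> = s * h 0 + m * h (m + s)" unfolding l(2) by simp
  finally have "s * (h m - h 0) \<le> m * (h (m + s) - h m)" by (simp add: algebra_simps)
  also have "\<dots> \<le> m * (s * (k + e'))" using 1 m by (rule mult_left_mono)
  finally have "s * (h m - h 0) \<le> s * (m * k + m * e')" by (simp add: algebra_simps)
  then have "h m - h 0 \<le> m * k + m * e'" using s(1) by simp
  with e'(2) have "h m - h 0 \<le> m * k + e" by linarith
  then show "busemann (ray_from q \<omega>) (ray_from p \<xi> m) - busemann (ray_from q \<omega>) p
      \<le> m * ray_slope (ray_from p \<xi> m) \<omega> \<xi> + e"
    by (simp add: h_def k_def p'_def ray_from_0[OF \<xi>] ray_slope_commute[OF \<omega> \<xi>])
qed


section \<open>The Tits angle and the slope of a configuration\<close>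

text \<open>The distances \<open>a\<close> and \<open>b\<close> differ by at most 2 dist p q and are
  at most 2 s, so their squares differ by O(s). After division by 2 s^2 an error O(1/s) remains,
  which makes the Tits angle independent of the base point.\<close>

lemma comparison_cos_base_change:
  fixes p q :: "'a::hadamard_space"
  assumes \<omega>: "\<omega> \<in> ideal_boundary" and \<xi>: "\<xi> \<in> ideal_boundary" and s: "0 < s"
  shows "comparison_cos p (ray_from p \<omega> s) (ray_from p \<xi> s)
    \<le> comparison_cos q (ray_from q \<omega> s) (ray_from q \<xi> s) + 4 * dist p q / s"
proof -
  define a b where "a = dist (ray_from p \<omega> s) (ray_from p \<xi> s)"
    and "b = dist (ray_from q \<omega> s) (ray_from q \<xi> s)"
  have "b \<le> a + 2 * dist p q"
    using dist_triangle[of "ray_from q \<omega> s" "ray_from q \<xi> s" "ray_from p \<omega> s"]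
      dist_triangle[of "ray_from p \<omega> s" "ray_from q \<xi> s" "ray_from p \<xi> s"]
      dist_ray_from_le[OF \<omega>, of s p q] dist_ray_from_le[OF \<xi>, of s p q] s
    by (simp add: a_def b_def dist_commute)
  moreover have "a \<le> 2 * s"
    using dist_triangle[of "ray_from p \<omega> s" "ray_from p \<xi> s" p] dist_ray_from_start[OF \<omega>, of s p]
      dist_ray_from_start[OF \<xi>, of s p] s by (simp add: a_def dist_commute)
  moreover have "b \<le> 2 * s"
    using dist_triangle[of "ray_from q \<omega> s" "ray_from q \<xi> s" q] dist_ray_from_start[OF \<omega>, of s q]
      dist_ray_from_start[OF \<xi>, of s q] s by (simp add: b_def dist_commute)
  ultimately have "(b - a) * (b + a) \<le> (2 * dist p q) * (4 * s)"
  proof (cases "b \<le> a")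
    case True
    then have "(b - a) * (b + a) \<le> 0" by (intro mult_nonpos_nonneg) (auto simp: a_def b_def)
    moreover have "0 \<le> (2 * dist p q) * (4 * s)" using s by simp
    ultimately show ?thesis by linarith
  qed (intro mult_mono, auto simp: a_def b_def)
  then have "b\<^sup>2 - a\<^sup>2 \<le> 8 * s * dist p q" by (simp add: power2_eq_square algebra_simps)
  moreover have "a\<^sup>2 = s\<^sup>2 + s\<^sup>2 - 2 * s * s * comparison_cos p (ray_from p \<omega> s) (ray_from p \<xi> s)"
    unfolding a_def by (rule dist_rays_sq[OF \<omega> \<xi> s s])
  moreover have "b\<^sup>2 = s\<^sup>2 + s\<^sup>2 - 2 * s * s * comparison_cos q (ray_from q \<omega> s) (ray_from q \<xi> s)"
    unfolding b_def by (rule dist_rays_sq[OF \<omega> \<xi> s s])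
  ultimately have "2 * s * (s * comparison_cos p (ray_from p \<omega> s) (ray_from p \<xi> s)) \<le>
      2 * s * (s * comparison_cos q (ray_from q \<omega> s) (ray_from q \<xi> s) + 4 * dist p q)"
    by (simp add: algebra_simps)
  then have "s * comparison_cos p (ray_from p \<omega> s) (ray_from p \<xi> s) \<le>
      s * comparison_cos q (ray_from q \<omega> s) (ray_from q \<xi> s) + 4 * dist p q"
    by (rule mult_left_le_imp_le) (use s in simp)
  then show ?thesis using s by (simp add: field_simps)
qed

text \<open>The counterpart of \<open>segment_angle\<close> at infinity: comparison cosines decrease
  as the points move outwards, so the limit is their infimum. Only the upper estimate is kept, which
  yields lower bounds for Busemann functions.\<close>

lemma cos_tits_angle:
  fixes p :: "'a::hadamard_space"
  assumes \<omega>: "\<omega> \<in> ideal_boundary" and \<xi>: "\<xi> \<in> ideal_boundary" and e: "0 < e"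
  shows "\<exists>N>0. \<forall>s\<ge>N. \<forall>t\<ge>N.
    comparison_cos p (ray_from p \<omega> s) (ray_from p \<xi> t) < cos (tits_angle \<omega> \<xi>) + e"
proof -
  define F where "F b s t = comparison_cos b (ray_from b \<omega> s) (ray_from b \<xi> t)" for b s t
  have mono: "F b s' t' \<le> F b s t" if "0 < s" "s \<le> s'" "0 < t" "t \<le> t'" for b s s' t t'
    using comparison_cos_rays_antimono[OF \<omega> \<xi> that] by (simp add: F_def)
  have range: "F b s t \<in> {-1..1}" if "0 < s" "0 < t" for b s t
    unfolding F_def by (rule comparison_cos_bounds) (use that ray_from_ne \<omega> \<xi> in auto)
  define A where "A b = (\<lambda>(s, t). F b s t) ` ({0<..} \<times> {0<..})" for b
  define L where "L b = Inf (A b)" for b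
  have ne: "A b \<noteq> {}" for b by (auto simp: A_def)
  have bdd: "bdd_below (A b)" for b
    by (rule bdd_belowI[of _ "-1"]) (use range in \<open>auto simp: A_def\<close>)
  have le: "L b \<le> F b s t" if "0 < s" "0 < t" for b s t
    unfolding L_def by (rule cInf_lower[OF _ bdd]) (use that in \<open>auto simp: A_def\<close>)
  have approx: "\<exists>N>0. \<forall>s\<ge>N. \<forall>t\<ge>N. F b s t < L b + e" if e: "e > 0" for e b
  proof -
    have "Inf (A b) < L b + e" using e by (simp add: L_def)
    then obtain s0 t0 where st0: "0 < s0" "0 < t0" "F b s0 t0 < L b + e"
      using cInf_less_iff[OF ne bdd] by (auto simp: A_def)
    have "F b s t < L b + e" if "max s0 t0 \<le> s" "max s0 t0 \<le> t" for s t
      using mono[of s0 s t0 t b] st0 that by auto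
    then show ?thesis using st0 by (intro exI[of _ "max s0 t0"]) auto
  qed
  have "L b \<le> L q" for b q
  proof (rule field_le_epsilon)
    fix e :: real assume e: "e > 0"
    then obtain N where N: "N > 0" "\<And>s t. s \<ge> N \<Longrightarrow> t \<ge> N \<Longrightarrow> F q s t < L q + e / 2"
      using approx[of "e / 2" q] by auto
    define s where "s = N + 8 * dist b q / e"
    have "8 * dist b q / e \<ge> 0" using e by simp
    then have s: "s \<ge> N" "8 * dist b q / e \<le> s" "s > 0" using N(1) by (simp_all add: s_def add_pos_nonneg)
    have "L b \<le> F b s s" using le s by simp
    also have "\<dots> \<le> F q s s + 4 * dist b q / s"
      unfolding F_def by (rule comparison_cos_base_change[OF \<omega> \<xi> s(3)])
    also have "4 * dist b q / s \<le> e / 2" using s e by (simp add: field_simps)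
    also have "F q s s \<le> L q + e / 2" using N(2)[OF s(1) s(1)] by simp
    finally show "L b \<le> L q + e" by simp
  qed
  then have L: "L b = L p" for b by (meson antisym)
  let ?N = "(at_top :: real filter) \<times>\<^sub>F (at_top :: real filter)"
  have N: "?N \<noteq> bot" by (simp add: prod_filter_eq_bot)
  have quadrant: "eventually Z ?N" if "\<And>s t. d \<le> s \<Longrightarrow> d \<le> t \<Longrightarrow> Z (s, t)" for d Z
    unfolding eventually_prod_filter
    using that eventually_ge_at_top[of d] by (intro exI[of _ "\<lambda>s. d \<le> s"] conjI) auto
  have lim: "((\<lambda>(s, t). F b s t) \<longlongrightarrow> L p) ?N" for b
  proof (rule tendstoI)
    fix e :: real assume "e > 0"
    then obtain d where d: "d > 0" "\<And>s t. d \<le> s \<Longrightarrow> d \<le> t \<Longrightarrow> F b s t < L p + e"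
      using approx[of e b] L[of b] by auto
    show "eventually (\<lambda>u. dist (case u of (s, t) \<Rightarrow> F b s t) (L p) < e) ?N"
    proof (rule quadrant[of d])
      fix s t assume "d \<le> s" "d \<le> t"
      then show "dist (case (s, t) of (s, t) \<Rightarrow> F b s t) (L p) < e"
        using d(1) d(2)[of s t] le[of s t b] L[of b] by (simp add: dist_real_def)
    qed
  qed
  have ev: "eventually (\<lambda>u. (case u of (s, t) \<Rightarrow> F b s t) \<in> {-1..1}) ?N" for b
    by (rule quadrant[of 1]) (use range in auto)
  note lim' = cos_arccos_limit[OF lim ev N]
  have eq: "(\<lambda>(s, t). comparison_angle b (ray_from b \<omega> s) (ray_from b \<xi> t)) =
      (\<lambda>u. arccos (case u of (s, t) \<Rightarrow> F b s t))" for b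
    by (auto simp: F_def comparison_angle_arccos)
  have "tits_angle \<omega> \<xi> = arccos (L p)"
    unfolding tits_angle_def eq
  proof (rule the_equality)
    show "\<forall>b. ((\<lambda>u. arccos (case u of (s, t) \<Rightarrow> F b s t)) \<longlongrightarrow> arccos (L p)) ?N"
      using lim'(1) by blast
    show "a = arccos (L p)" if "\<forall>b. ((\<lambda>u. arccos (case u of (s, t) \<Rightarrow> F b s t)) \<longlongrightarrow> a) ?N" for a
      using tendsto_unique[OF N that[rule_format] lim'(1)] .
  qed
  then show ?thesis using lim'(2) approx[OF e, of p] by (simp add: F_def)
qed

text \<open>Write d(s)^2 - s^2 = (d(s) - s) (2 s + (d(s) - s)) and divide by s. As s tends to
  infinity the right side tends to twice the Busemann function, and the comparison angle bounds the
  left side below by t^2 / s - 2 t c. The bound \<open>N\<close> serves both parameters, so t can be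
  fixed first.\<close>

lemma busemann_ge_tits_angle:
  fixes p :: "'a::hadamard_space"
  assumes \<omega>: "\<omega> \<in> ideal_boundary" and \<xi>: "\<xi> \<in> ideal_boundary" and e: "0 < e"
  shows "eventually (\<lambda>t. t * (- cos (tits_angle \<xi> \<omega>) - e)
    \<le> busemann (ray_from p \<xi>) (ray_from p \<omega> t)) at_top"
proof -
  define c where "c = cos (tits_angle \<xi> \<omega>) + e"
  obtain N where N: "N > 0" "\<And>s t. s \<ge> N \<Longrightarrow> t \<ge> N \<Longrightarrow>
      comparison_cos p (ray_from p \<xi> s) (ray_from p \<omega> t) < c"
    using cos_tits_angle[OF \<xi> \<omega> e, of p] by (auto simp: c_def)
  note ray = geodesic_ray_ray_from[OF \<xi>, of p]
  have "t * (- c) \<le> busemann (ray_from p \<xi>) (ray_from p \<omega> t)" if t: "t \<ge> N" for t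
  proof -
    let ?z = "ray_from p \<omega> t"
    define d where "d s = dist ?z (ray_from p \<xi> s)" for s
    define b where "b = busemann (ray_from p \<xi>) ?z"
    have lim: "((\<lambda>s. d s - s) \<longlongrightarrow> b) at_top"
      unfolding d_def b_def by (rule busemann_tendsto[OF ray])
    have inf: "filterlim (\<lambda>s::real. s) at_infinity at_top"
      by (rule filterlim_at_top_imp_at_infinity[OF filterlim_ident])
    have "((\<lambda>s. (d s - s) * (2 + (d s - s) / s)) \<longlongrightarrow> b * (2 + 0)) at_top"
      by (intro tendsto_intros lim tendsto_divide_0[OF lim inf])
    moreover have "((\<lambda>s. t\<^sup>2 / s - 2 * t * c) \<longlongrightarrow> 0 - 2 * t * c) at_top"
      by (intro tendsto_intros tendsto_divide_0[OF tendsto_const inf])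
    moreover have "eventually (\<lambda>s. t\<^sup>2 / s - 2 * t * c \<le> (d s - s) * (2 + (d s - s) / s)) at_top"
      using eventually_ge_at_top[of N]
    proof eventually_elim
      case (elim s)
      have st: "s > 0" "t > 0" using elim t N(1) by auto
      have "(d s)\<^sup>2 = s\<^sup>2 + t\<^sup>2 - 2 * s * t * comparison_cos p (ray_from p \<xi> s) (ray_from p \<omega> t)"
        using dist_rays_sq[OF \<xi> \<omega> st, of p] by (simp add: d_def dist_commute)
      moreover have "2 * s * t * comparison_cos p (ray_from p \<xi> s) (ray_from p \<omega> t) \<le> 2 * s * t * c"
        using N(2)[OF elim t] st by (intro mult_left_mono) auto
      ultimately have "t\<^sup>2 - s * (2 * t * c) \<le> (d s - s) * (2 * s + (d s - s))"
        by (simp add: power2_eq_square algebra_simps)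
      then have "(t\<^sup>2 - s * (2 * t * c)) / s \<le> ((d s - s) * (2 * s + (d s - s))) / s"
        using st by (intro divide_right_mono) auto
      moreover have "(t\<^sup>2 - s * (2 * t * c)) / s = t\<^sup>2 / s - 2 * t * c"
        "((d s - s) * (2 * s + (d s - s))) / s = (d s - s) * (2 + (d s - s) / s)"
        using st by (simp_all add: field_simps)
      ultimately show ?case by simp
    qed
    ultimately have "0 - 2 * t * c \<le> b * (2 + 0)"
      by (rule tendsto_le[OF trivial_limit_at_top_linorder])
    then show ?thesis by (simp add: b_def mult.commute)
  qed
  then show ?thesis unfolding eventually_at_top_linorder by (auto simp: c_def)
qed

section \<open>Weighted configurations\<close>

definition config_weight :: "'a::hadamard_space config \<Rightarrow> real" where
  "config_weight c = (\<Sum>(\<xi>, m)\<leftarrow>c. m)"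

text \<open>The function f of the overview, with all summands based at \<open>p\<close> so that it
  vanishes there.\<close>

definition config_busemann :: "'a::hadamard_space \<Rightarrow> 'a config \<Rightarrow> 'a \<Rightarrow> real" where
  "config_busemann p c x = (\<Sum>(\<xi>, m)\<leftarrow>c. m * busemann (ray_from p \<xi>) x)"

lemma weighted_configuration_Cons [simp]:
  "weighted_configuration ((\<xi>, m) # c) \<longleftrightarrow>
     \<xi> \<in> ideal_boundary \<and> 0 < m \<and> weighted_configuration c"
  by (auto simp: weighted_configuration_def)

lemma weak_contraction_simps [simp]:
  "weak_contraction [] x = x"
  "weak_contraction ((\<xi>, m) # c) x = weak_contraction c (ray_from x \<xi> m)"
  by (simp_all add: weak_contraction_def push_def)

lemma config_weight_simps [simp]:
  "config_weight [] = 0" "config_weight ((\<xi>, m) # c) = m + config_weight c"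
  by (simp_all add: config_weight_def)

lemma config_busemann_simps [simp]:
  "config_busemann p [] x = 0"
  "config_busemann p ((\<xi>, m) # c) x = m * busemann (ray_from p \<xi>) x + config_busemann p c x"
  by (simp_all add: config_busemann_def)

lemma slope_simps [simp]:
  "slope [] \<eta> = 0" "slope ((\<xi>, m) # c) \<eta> = m * (- cos (tits_angle \<xi> \<eta>)) + slope c \<eta>"
  by (simp_all add: slope_def)

lemma config_weight_nonneg: "weighted_configuration c \<Longrightarrow> 0 \<le> config_weight c"
  by (induction c) auto

lemma weak_contraction_nonexpansive:
  "weighted_configuration c \<Longrightarrow> dist (weak_contraction c x) (weak_contraction c y) \<le> dist x y"
proof (induction c arbitrary: x y)
  case (Cons a c)
  obtain \<xi> m where a: "a = (\<xi>, m)" by force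
  have "dist (weak_contraction c (ray_from x \<xi> m)) (weak_contraction c (ray_from y \<xi> m))
      \<le> dist (ray_from x \<xi> m) (ray_from y \<xi> m)"
    using Cons by (simp add: a)
  also have "\<dots> \<le> dist x y" using Cons.prems by (intro dist_ray_from_le) (auto simp: a)
  finally show ?case by (simp add: a)
qed simp

lemma config_busemann_lipschitz:
  "weighted_configuration c \<Longrightarrow>
    \<bar>config_busemann p c x - config_busemann p c y\<bar> \<le> config_weight c * dist x y"
proof (induction c)
  case (Cons a c)
  obtain \<xi> m where a: "a = (\<xi>, m)" by force
  let ?b = "busemann (ray_from p \<xi>)"
  have "\<bar>m * (?b x - ?b y)\<bar> \<le> m * dist x y"
    unfolding abs_mult using Cons.prems busemann_lipschitz[OF geodesic_ray_ray_from, of \<xi> p x y]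
    by (intro mult_mono) (auto simp: a)
  then show ?case using Cons by (simp add: a algebra_simps abs_le_iff)
qed simp

lemma config_busemann_self: "weighted_configuration c \<Longrightarrow> config_busemann p c p = 0"
  by (induction c) auto

lemma config_busemann_convex:
  assumes l: "l \<in> {0..1}"
  shows "weighted_configuration c \<Longrightarrow>
    config_busemann p c (conv y z l) \<le> (1 - l) * config_busemann p c y + l * config_busemann p c z"
proof (induction c)
  case (Cons a c)
  obtain \<xi> m where a: "a = (\<xi>, m)" by force
  let ?b = "busemann (ray_from p \<xi>)"
  have "m * ?b (conv y z l) \<le> m * ((1 - l) * ?b y + l * ?b z)"
    using Cons.prems l by (intro mult_left_mono busemann_convex geodesic_ray_ray_from) (auto simp: a)
  then show ?case using Cons by (simp add: a algebra_simps)
qed simp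

text \<open>Iterates \<open>dist_ray_from_busemann\<close>. Moving \<open>x\<close> by m costs 2 m
  \<open>config_weight c\<close> through the Lipschitz bound, which is exactly the cross term in the
  square of the total weight.\<close>

lemma dist_weak_contraction_sq:
  "weighted_configuration c \<Longrightarrow> (dist p (weak_contraction c x))\<^sup>2
    \<le> (dist p x)\<^sup>2 + (config_weight c)\<^sup>2 - 2 * config_busemann p c x"
proof (induction c arbitrary: x)
  case (Cons a c)
  obtain \<xi> m where a: "a = (\<xi>, m)" by force
  have \<xi>: "\<xi> \<in> ideal_boundary" and m: "m > 0" and c: "weighted_configuration c"
    using Cons.prems by (auto simp: a)
  let ?y = "ray_from x \<xi> m"
  have "(dist p (weak_contraction c ?y))\<^sup>2
      \<le> (dist p ?y)\<^sup>2 + (config_weight c)\<^sup>2 - 2 * config_busemann p c ?y"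
    by (rule Cons.IH[OF c])
  moreover have "(dist p ?y)\<^sup>2 \<le> (dist p x)\<^sup>2 + m\<^sup>2 - 2 * m * busemann (ray_from p \<xi>) x"
    using m by (intro dist_ray_from_busemann \<xi>) simp
  moreover have "config_busemann p c x - config_weight c * m \<le> config_busemann p c ?y"
    using config_busemann_lipschitz[OF c, of p x ?y] dist_ray_from_start[OF \<xi>, of m x] m by simp
  ultimately show ?case by (simp add: a power2_eq_square algebra_simps)
qed simp

lemma config_busemann_ge_slope:
  assumes c: "weighted_configuration c" and \<eta>: "\<eta> \<in> ideal_boundary" and e: "0 < e"
  shows "eventually (\<lambda>t. t * (slope c \<eta> - e) \<le> config_busemann p c (ray_from p \<eta> t)) at_top"
proof -
  define e' where "e' = e / (config_weight c + 1)"
  have e': "e' > 0" "config_weight c * e' \<le> e"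
    using e config_weight_nonneg[OF c] by (auto simp: e'_def field_simps)
  \<comment> \<open>With \<open>e'\<close> fixed, the error \<open>config_weight c * e'\<close> is
    additive over the list, as the induction requires.\<close>
  have "eventually (\<lambda>t. t * (slope c \<eta> - config_weight c * e')
      \<le> config_busemann p c (ray_from p \<eta> t)) at_top"
    using c
  proof (induction c)
    case (Cons a c)
    obtain \<xi> m where a: "a = (\<xi>, m)" by force
    have \<xi>: "\<xi> \<in> ideal_boundary" and m: "m > 0" and c: "weighted_configuration c"
      using Cons.prems by (auto simp: a)
    show ?case
      using Cons.IH[OF c] busemann_ge_tits_angle[OF \<eta> \<xi> e'(1), of p]
    proof eventually_elim
      case (elim t)
      then have "m * (t * (- cos (tits_angle \<xi> \<eta>) - e')) \<le> m * busemann (ray_from p \<xi>) (ray_from p \<eta> t)"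
        using m by (intro mult_left_mono) auto
      with elim(1) show ?case by (simp add: a algebra_simps)
    qed
  qed simp
  then show ?thesis
    using eventually_ge_at_top[of 0]
  proof eventually_elim
    case (elim t)
    have "t * (slope c \<eta> - e) \<le> t * (slope c \<eta> - config_weight c * e')"
      using elim e' by (intro mult_left_mono) auto
    with elim(1) show ?case by linarith
  qed
qed

text \<open>The way in which a ray constructed in X comes into conflict with stability (v = 0) or
  semistability (v < 0).\<close>

lemma slope_le_of_linear_bound:
  assumes c: "weighted_configuration c" and \<eta>: "\<eta> \<in> ideal_boundary"
    and le: "\<And>t. 0 \<le> t \<Longrightarrow> config_busemann p c (ray_from p \<eta> t) \<le> v * t"
  shows "slope c \<eta> \<le> v"
proof (rule field_le_epsilon)
  fix e :: real assume e: "e > 0"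
  have "eventually (\<lambda>t. t * (slope c \<eta> - e) \<le> config_busemann p c (ray_from p \<eta> t) \<and> 1 \<le> t) at_top"
    using config_busemann_ge_slope[OF c \<eta> e] eventually_ge_at_top[of 1] by eventually_elim auto
  then obtain t where t: "t * (slope c \<eta> - e) \<le> config_busemann p c (ray_from p \<eta> t)" "1 \<le> t"
    using eventually_happens'[OF trivial_limit_at_top_linorder] by blast
  then have "t * (slope c \<eta> - e) \<le> t * v" using le[of t] unfolding mult.commute[of t v] by linarith
  then have "slope c \<eta> - e \<le> v" by (rule mult_left_le_imp_le) (use t(2) in simp)
  then show "slope c \<eta> \<le> v + e" by simp
qed


section \<open>Fixed points of nonexpansive maps\<close>

text \<open>
  As \<open>k - l \<le> 1 - l k\<close>, this makes \<open>l d(p, T x\<^sub>l)\<^sup>2\<close> monotone in \<open>l\<close> and, if it is bounded, makes the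
  fixed points \<open>x\<^sub>l\<close> of \<open>x \<mapsto> (1 - l) p + l T x\<close> a Cauchy net as \<open>l \<rightarrow> 1\<close> (Browder's argument).
\<close>

lemma browder_estimate:
  fixes p :: "'a::hadamard_space"
  assumes T: "dist (T x) (T y) \<le> dist x y"
    and x: "x = conv p (T x) l" and y: "y = conv p (T y) k" and l: "l \<in> {0..1}" and k: "k \<in> {0..1}"
  shows "(1 - l * k) * (dist x y)\<^sup>2 \<le> (k - l) * (k * (dist p (T y))\<^sup>2 - l * (dist p (T x))\<^sup>2)"
proof -
  have "(dist x y)\<^sup>2 \<le> l\<^sup>2 * (dist p (T x))\<^sup>2 + k\<^sup>2 * (dist p (T y))\<^sup>2
      - l * k * ((dist p (T x))\<^sup>2 + (dist p (T y))\<^sup>2 - (dist (T x) (T y))\<^sup>2)"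
    using cat0[OF l k, of p "T x" "T y"] by (simp flip: x y)
  moreover have "l * k * (dist (T x) (T y))\<^sup>2 \<le> l * k * (dist x y)\<^sup>2"
    using l k T by (intro mult_left_mono power_mono) auto
  ultimately show ?thesis by (simp add: power2_eq_square algebra_simps)
qed

text \<open>The alternatives are whether the increasing sequence \<open>N\<close> is bounded. Of the
  escaping points only this is recorded: each lies strictly between \<open>p\<close> and its
  image.\<close>

lemma fixed_point_or_escape:
  fixes T :: "'a::hadamard_space \<Rightarrow> 'a"
  assumes T: "\<And>x y. dist (T x) (T y) \<le> dist x y"
  shows "(\<exists>x. T x = x) \<or>
    (\<exists>X. filterlim (\<lambda>n. dist p (X n)) at_top sequentially \<and>
      (\<forall>n::nat. \<exists>l\<in>{0<..<1}. X n = conv p (T (X n)) l))"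
proof -
  \<comment> \<open>Strictly increasing to 1 and at least 1/2, so that \<open>N\<close> and the
    squared distances from \<open>p\<close> to the images are comparable.\<close>
  define l where "l n = real (n + 1) / real (n + 2)" for n
  have l: "0 < l n" "l n < 1" "1 / 2 \<le> l n" "1 - l n = 1 / real (n + 2)" for n
    by (simp_all add: l_def field_simps)
  then have l': "l n \<in> {0..1}" for n by (simp add: less_imp_le)
  have "\<exists>x. conv p (T x) (l n) = x" for n
  proof -
    have "dist (conv p (T x) (l n)) (conv p (T y) (l n)) \<le> l n * dist x y" for x y
    proof -
      have "dist (conv p (T x) (l n)) (conv p (T y) (l n)) \<le> l n * dist (T x) (T y)"
        by (rule dist_conv_conv_vertex[OF l'])
      also have "\<dots> \<le> l n * dist x y" using T l(1)[of n] by simp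
      finally show ?thesis .
    qed
    then show ?thesis using banach_fix_type[of "l n" "\<lambda>x. conv p (T x) (l n)"] l(1,2)[of n] by auto
  qed
  then obtain X where "\<forall>n. conv p (T (X n)) (l n) = X n" by metis
  then have X: "X n = conv p (T (X n)) (l n)" for n by simp
  define N where "N n = l n * (dist p (T (X n)))\<^sup>2" for n
  have dX: "dist p (X n) = l n * dist p (T (X n))" for n
    using dist_conv_left[OF l', of p "T (X n)" n] by (simp flip: X)
  have est: "(dist (X n) (X m))\<^sup>2 \<le> N m - N n" "N n \<le> N m" if "n < m" for n m
  proof -
    have lt: "l n < l m" using that by (simp add: l_def field_simps)
    have lm: "l m - l n \<le> 1 - l n * l m"
    proof -
      have "0 \<le> (1 - l m) * (1 + l n)" using l(1)[of n] l(2)[of m] by simp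
      then show ?thesis by (simp add: algebra_simps)
    qed
    have est: "(1 - l n * l m) * (dist (X n) (X m))\<^sup>2 \<le> (l m - l n) * (N m - N n)"
      using browder_estimate[of T "X n" "X m" p "l n" "l m", OF T X X l' l'] by (simp add: N_def)
    have "(l m - l n) * (dist (X n) (X m))\<^sup>2 \<le> (1 - l n * l m) * (dist (X n) (X m))\<^sup>2"
      using lm by (intro mult_right_mono) auto
    with est have "(l m - l n) * (dist (X n) (X m))\<^sup>2 \<le> (l m - l n) * (N m - N n)" by linarith
    with lt show *: "(dist (X n) (X m))\<^sup>2 \<le> N m - N n" by simp
    have "0 \<le> (dist (X n) (X m))\<^sup>2" by simp
    with * show "N n \<le> N m" by linarith
  qed
  have mono: "N n \<le> N m" if "n \<le> m" for n m
    using est(2)[of n m] that by (cases "n = m") auto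
  show ?thesis
  proof (cases "bdd_above (range N)")
    case True
    then obtain B where B: "\<And>n. N n \<le> B" by (auto simp: bdd_above_def)
    have "convergent N"
      using Bseq_mono_convergent[of N] mono BseqI'[of N B] B l(1)
      by (metis N_def abs_of_nonneg less_imp_le mult_nonneg_nonneg real_norm_def zero_le_power2)
    then have "Cauchy N" by (simp add: Cauchy_convergent_iff)
    have "Cauchy X"
      unfolding Cauchy_altdef
    proof (intro allI impI)
      fix e :: real assume e: "e > 0"
      then have "e\<^sup>2 > 0" by simp
      then obtain M where M: "\<forall>m\<ge>M. \<forall>n>m. dist (N m) (N n) < e\<^sup>2"
        using \<open>Cauchy N\<close> unfolding Cauchy_altdef by blast
      have "dist (X m) (X n) < e" if "m \<ge> M" "n > m" for m n
      proof -
        have "(dist (X m) (X n))\<^sup>2 < e\<^sup>2"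
          using est[OF that(2)] M that by (fastforce simp: dist_real_def)
        then show ?thesis using e by (simp add: power2_less_imp_less)
      qed
      then show "\<exists>M. \<forall>m\<ge>M. \<forall>n>m. dist (X m) (X n) < e" by blast
    qed
    then obtain x where x: "X \<longlonglongrightarrow> x" by (auto simp: Cauchy_convergent_iff convergent_def)
    have Tx: "(\<lambda>n. T (X n)) \<longlonglongrightarrow> T x"
      by (rule metric_tendsto_imp_tendsto[OF x]) (use T in simp)
    \<comment> \<open>A bound for a distance whose square is at most 2 B, from 2 d \<le> d^2 +
      1.\<close>
    define Q where "Q = 2 * B + 1"
    have Q: "dist p (T (X n)) \<le> Q" for n
    proof -
      have "(dist p (T (X n)))\<^sup>2 = 2 * (1 / 2 * (dist p (T (X n)))\<^sup>2)" by simp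
      also have "\<dots> \<le> 2 * N n"
        unfolding N_def using l(3)[of n] by (intro mult_left_mono mult_right_mono) auto
      also have "\<dots> \<le> 2 * B" using B by simp
      finally have sq: "(dist p (T (X n)))\<^sup>2 \<le> 2 * B" .
      have "0 \<le> (dist p (T (X n)) - 1)\<^sup>2" by simp
      with sq have "2 * dist p (T (X n)) \<le> Q" by (simp add: Q_def power2_diff)
      then show ?thesis using zero_le_dist[of p "T (X n)"] by linarith
    qed
    have "(\<lambda>n. dist (X n) (T (X n))) \<longlonglongrightarrow> 0"
    proof (rule tendsto_sandwich[OF _ _ tendsto_const])
      show "eventually (\<lambda>n. dist (X n) (T (X n)) \<le> Q / real (n + 2)) sequentially"
      proof (intro always_eventually allI)
        fix n
        have "dist (X n) (T (X n)) = (1 - l n) * dist p (T (X n))"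
          using dist_conv_right[OF l', of p "T (X n)" n] by (simp flip: X)
        also have "\<dots> \<le> (1 - l n) * Q" using Q l(2)[of n] by (intro mult_left_mono) auto
        finally show "dist (X n) (T (X n)) \<le> Q / real (n + 2)" by (simp add: l(4))
      qed
      show "(\<lambda>n. Q / real (n + 2)) \<longlonglongrightarrow> 0"
        using LIMSEQ_ignore_initial_segment[OF lim_const_over_n[of Q], of 2] by simp
    qed simp
    moreover have "(\<lambda>n. dist (X n) (T (X n))) \<longlonglongrightarrow> dist x (T x)" by (intro tendsto_dist x Tx)
    ultimately have "dist x (T x) = 0" using LIMSEQ_unique by blast
    then have "T x = x" by simp
    then show ?thesis by blast
  next
    case False
    have "filterlim (\<lambda>n. dist p (X n)) at_top sequentially"
      unfolding filterlim_at_top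
    proof
      fix Z :: real
      \<comment> \<open>The factor 2 makes up for \<open>l m \<ge> 1 / 2\<close> in the identity
        between \<open>l m * N m\<close> and the squared distance from \<open>p\<close> to
        \<open>X m\<close>.\<close>
      obtain n where n: "2 * Z\<^sup>2 < N n"
        using False by (auto simp: bdd_above_def not_le)
      have "Z \<le> dist p (X m)" if "m \<ge> n" for m
      proof -
        have "2 * Z\<^sup>2 \<le> N m" using n mono[OF that] by simp
        then have "1 / 2 * (2 * Z\<^sup>2) \<le> l m * N m" using l(1,3)[of m] by (intro mult_mono) auto
        also have "l m * N m = (dist p (X m))\<^sup>2" by (simp add: dX N_def power2_eq_square)
        finally have "Z\<^sup>2 \<le> (dist p (X m))\<^sup>2" by simp
        then show ?thesis by (rule power2_le_imp_le) simp
      qed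
      then show "eventually (\<lambda>n. Z \<le> dist p (X n)) sequentially"
        unfolding eventually_sequentially by blast
    qed
    moreover have "\<forall>n. \<exists>k\<in>{0<..<1}. X n = conv p (T (X n)) k"
      using X l by (meson greaterThanLessThan_iff)
    ultimately show ?thesis by blast
  qed
qed


section \<open>Locally compact Hadamard spaces\<close>

lemma compact_finite_ball_cover:
  fixes S :: "'a::metric_space set"
  assumes S: "compact S" and e: "\<And>x. 0 < e x"
  obtains A where "A \<subseteq> S" "finite A" "S \<subseteq> (\<Union>x\<in>A. ball x (e x))"
proof (rule compactE_image[OF S, of S "\<lambda>x. ball x (e x)"])
  show "S \<subseteq> (\<Union>x\<in>S. ball x (e x))" using e by force
qed (use that in auto)

text \<open>The Hopf-Rinow theorem. The radii of compact balls about \<open>p\<close> form an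
  interval. It can be prolonged from any of its points by a finite cover with small compact balls,
  and it contains its supremum if finite, because geodesics to \<open>p\<close> move a ball into a
  slightly smaller one, so that it is totally bounded. Hence it is unbounded.\<close>

lemma locally_compact_cball:
  fixes p :: "'a::hadamard_space"
  assumes lc: "locally compact (UNIV :: 'a set)"
  shows "compact (cball p R)"
proof -
  have small: "\<exists>e>0. compact (cball x e)" for x :: 'a
  proof -
    have "openin (top_of_set UNIV) (UNIV :: 'a set) \<and> x \<in> UNIV" by simp
    then obtain U K where UK: "openin (top_of_set UNIV) U" "compact K" "x \<in> U" "U \<subseteq> K"
      using lc unfolding locally_def by meson
    have "open U" using UK(1) by simp
    then obtain e where e: "e > 0" "cball x e \<subseteq> U"
      using UK(3) open_contains_cball[of U] by blast
    have "K \<inter> cball x e = cball x e" using e(2) UK(4) by blast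
    then have "compact (cball x e)" using compact_Int_closed[OF UK(2) closed_cball, of x e] by simp
    then show ?thesis using e(1) by blast
  qed
  define S where "S = {r. 0 \<le> r \<and> compact (cball p r)}"
  have down: "s \<in> S" if "r \<in> S" "0 \<le> s" "s \<le> r" for r s
  proof -
    have "cball p s = cball p r \<inter> cball p s" using that(3) by auto
    then show ?thesis using that compact_Int_closed[of "cball p r" "cball p s"] by (auto simp: S_def)
  qed
  have up: "\<exists>e>0. r + e \<in> S" if r: "r \<in> S" for r
  proof -
    obtain e where "\<forall>x::'a. e x > 0 \<and> compact (cball x (e x))"
      using choice[of "\<lambda>x::'a. \<lambda>e. e > 0 \<and> compact (cball x e)"] small by blast
    then have e: "e x > 0" "compact (cball x (e x))" for x :: 'a by auto
    have "compact (cball p r)" using r by (simp add: S_def)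
    then obtain A where A: "A \<subseteq> cball p r" "finite A" "cball p r \<subseteq> (\<Union>x\<in>A. ball x (e x))"
      by (rule compact_finite_ball_cover[where e = e]) (use e that in auto)
    define K where "K = (\<Union>x\<in>A. cball x (e x))"
    have K: "compact K" unfolding K_def by (intro compact_UN A e)
    have "open (\<Union>x\<in>A. ball x (e x))" by auto
    with \<open>compact (cball p r)\<close> A(3) obtain d where d: "d > 0" "(\<Union>x\<in>cball p r. ball x d) \<subseteq> (\<Union>x\<in>A. ball x (e x))"
      using compact_subset_open_imp_ball_epsilon_subset by metis
    have "cball p (r + d / 2) \<subseteq> K"
    proof
      fix y assume y: "y \<in> cball p (r + d / 2)"
      have r0: "r \<ge> 0" using r by (simp add: S_def)
      show "y \<in> K"
      proof (cases "dist p y \<le> r")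
        case True
        then have "y \<in> cball p r" by simp
        then have "y \<in> (\<Union>x\<in>A. ball x (e x))" by (rule subsetD[OF A(3)])
        then show ?thesis by (force simp: K_def)
      next
        case False
        define z where "z = conv p y (r / dist p y)"
        have l: "r / dist p y \<in> {0..1}" and pos: "dist p y > 0" using False r0 by (auto simp: divide_le_eq)
        have "dist p z = r" "dist z y = dist p y - r"
          using dist_conv_left[OF l, of p y] dist_conv_right[OF l, of p y] pos
          by (auto simp: z_def field_simps)
        then have "z \<in> cball p r" "y \<in> ball z d" using y d(1) by auto
        then have "y \<in> (\<Union>x\<in>A. ball x (e x))" using d(2) by blast
        then show ?thesis by (force simp: K_def)
      qed
    qed
    then have "cball p (r + d / 2) = K \<inter> cball p (r + d / 2)" by auto
    then have "compact (cball p (r + d / 2))" using compact_Int_closed[OF K closed_cball] by metis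
    then show ?thesis using d(1) r by (intro exI[of _ "d / 2"]) (auto simp: S_def)
  qed
  have closed: "r \<in> S" if r: "r > 0" "\<And>s. 0 \<le> s \<Longrightarrow> s < r \<Longrightarrow> s \<in> S" for r
  proof -
    have "\<exists>k. finite k \<and> cball p r \<subseteq> (\<Union>x\<in>k. ball x e)" if e: "e > 0" for e
    proof -
      define s where "s = max 0 (r - e / 2)"
      have s: "0 \<le> s" "s < r" "r - s \<le> e / 2" using e r(1) by (auto simp: s_def max_def)
      then have "compact (cball p s)" using r(2) by (auto simp: S_def)
      then obtain A where A: "A \<subseteq> cball p s" "finite A" "cball p s \<subseteq> (\<Union>x\<in>A. ball x (e / 2))"
        by (rule compact_finite_ball_cover[where e = "\<lambda>_. e / 2"]) (use e that in auto)
      have "cball p r \<subseteq> (\<Union>x\<in>A. ball x e)"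
      proof
        fix y assume y: "y \<in> cball p r"
        define z where "z = conv p y (s / r)"
        have l: "s / r \<in> {0..1}" using s by auto
        have y': "dist p y \<le> r" using y by simp
        have "dist p z = s / r * dist p y" unfolding z_def by (rule dist_conv_left[OF l])
        also have "\<dots> \<le> s / r * r" using y' by (rule mult_left_mono) (use l in simp)
        finally have "z \<in> cball p s" using r(1) by simp
        have "dist z y = (1 - s / r) * dist p y" unfolding z_def by (rule dist_conv_right[OF l])
        also have "\<dots> \<le> (1 - s / r) * r" using y' by (rule mult_left_mono) (use l in simp)
        also have "\<dots> = r - s" using r(1) by (simp add: field_simps)
        finally have "dist z y \<le> e / 2" using s(3) by simp
        note z = \<open>z \<in> cball p s\<close> this
        then obtain x where "x \<in> A" "dist x z < e / 2" using A(3) by auto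
        then show "y \<in> (\<Union>x\<in>A. ball x e)" using z(2) dist_triangle[of x y z] by force
      qed
      then show ?thesis using A(2) by blast
    qed
    then have "compact (cball p r)"
      unfolding compact_eq_totally_bounded complete_eq_closed by simp
    then show ?thesis using r(1) by (simp add: S_def)
  qed
  have "0 \<in> S" by (simp add: S_def)
  have "\<not> bdd_above S"
  proof
    assume bdd: "bdd_above S"
    define r where "r = Sup S"
    have up': "s \<le> r" if "s \<in> S" for s unfolding r_def by (rule cSup_upper[OF that bdd])
    obtain e where "e > 0" "0 + e \<in> S" using up[OF \<open>0 \<in> S\<close>] by blast
    then have "r > 0" using up'[of "0 + e"] by simp
    moreover have "s \<in> S" if s: "0 \<le> s" "s < r" for s
    proof -
      obtain s' where "s' \<in> S" "s < s'"
        using s(2) less_cSup_iff[of S s] \<open>0 \<in> S\<close> bdd by (auto simp: r_def)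
      then show ?thesis using down[of s' s] s(1) by simp
    qed
    ultimately have "r \<in> S" by (rule closed)
    then obtain e' where "e' > 0" "r + e' \<in> S" using up by blast
    then show False using up'[of "r + e'"] by simp
  qed
  then obtain r where r: "r \<in> S" "r \<ge> R" by (auto simp: bdd_above_def not_le intro: less_imp_le)
  show ?thesis
  proof (cases "R \<ge> 0")
    case True
    then show ?thesis using down[OF r(1), of R] r(2) by (simp add: S_def)
  qed simp
qed

text \<open>A diagonal sequence gives convergence at all integer distances from \<open>p\<close>;
  contraction towards \<open>p\<close> transfers it from an integer j > t to t.\<close>

lemma locally_compact_ray_subsequence:
  fixes p :: "'a::hadamard_space"
  assumes lc: "locally compact (UNIV :: 'a set)"
    and inf: "filterlim (\<lambda>n. dist p (X n)) at_top sequentially"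
  obtains k r where "strict_mono (k :: nat \<Rightarrow> nat)" "geodesic_ray r" "r 0 = p"
    and "\<And>t. 0 \<le> t \<Longrightarrow> (\<lambda>n. conv p (X (k n)) (t / dist p (X (k n)))) \<longlonglongrightarrow> r t"
proof -
  define \<sigma> where "\<sigma> n t = conv p (X n) (t / dist p (X n))" for n t
  define P where "P j s \<longleftrightarrow> convergent (\<lambda>n. \<sigma> (s n) (real j))" for j :: nat and s :: "nat \<Rightarrow> nat"
  have inf': "filterlim (\<lambda>n. dist p (X (s n))) at_top sequentially" if "strict_mono s" for s :: "nat \<Rightarrow> nat"
    by (rule filterlim_compose[OF inf filterlim_subseq[OF that]])
  interpret subseqs P
  proof
    fix j and s :: "nat \<Rightarrow> nat" assume s: "strict_mono s"
    have "eventually (\<lambda>n. \<sigma> (s n) (real j) \<in> cball p (real j)) sequentially"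
      using eventually_unit_quotient[OF inf'[OF s] of_nat_0_le_iff[of j]]
    proof (rule eventually_mono)
      fix n assume n: "dist p (X (s n)) > 0 \<and> real j / dist p (X (s n)) \<in> {0..1}"
      then show "\<sigma> (s n) (real j) \<in> cball p (real j)"
        by (simp add: \<sigma>_def dist_conv_left)
    qed
    \<comment> \<open>The segments reach distance j only eventually, so the sequence is shifted by
      \<open>N\<close> to lie in the compact ball.\<close>
    then obtain N where N: "\<And>n. n \<ge> N \<Longrightarrow> \<sigma> (s n) (real j) \<in> cball p (real j)"
      unfolding eventually_sequentially by blast
    have "seq_compact (cball p (real j))"
      using locally_compact_cball[OF lc] compact_eq_seq_compact_metric by blast
    then obtain l r where r: "strict_mono r" "((\<lambda>n. \<sigma> (s (n + N)) (real j)) \<circ> r) \<longlonglongrightarrow> l"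
      using N unfolding seq_compact_def by (metis le_add2)
    have "strict_mono (\<lambda>n. r n + N)" using r(1) by (simp add: strict_mono_def)
    moreover have "P j (s \<circ> (\<lambda>n. r n + N))"
      using r(2) by (auto simp: P_def convergent_def o_def)
    ultimately show "\<exists>r'. strict_mono r' \<and> P j (s \<circ> r')" by blast
  qed
  have stable: "P j (s \<circ> r)" if "strict_mono r" "P j s" for j r s
    using that convergent_subseq_convergent[of "\<lambda>n. \<sigma> (s n) (real j)" r] by (simp add: P_def o_def)
  have P: "convergent (\<lambda>n. \<sigma> (diagseq n) (real j))" for j
  proof -
    have "P j (diagseq \<circ> ((+) (Suc j)))" by (rule diagseq_holds[OF stable])
    then obtain l where "(\<lambda>n. \<sigma> (diagseq (n + Suc j)) (real j)) \<longlonglongrightarrow> l"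
      by (auto simp: P_def convergent_def o_def add.commute)
    then have "(\<lambda>n. \<sigma> (diagseq n) (real j)) \<longlonglongrightarrow> l" by (rule LIMSEQ_offset)
    then show ?thesis by (auto simp: convergent_def)
  qed
  note inf'' = inf'[OF subseq_diagseq]
  have "convergent (\<lambda>n. \<sigma> (diagseq n) t)" if t: "0 \<le> t" for t
  proof -
    obtain j where j: "t + 1 \<le> real j" using real_arch_simple by blast
    obtain l where l: "(\<lambda>n. \<sigma> (diagseq n) (real j)) \<longlonglongrightarrow> l"
      using P by (auto simp: convergent_def)
    have tj: "t / real j \<in> {0..1}" using t j by (auto simp: divide_le_eq)
    have "(\<lambda>n. conv p (\<sigma> (diagseq n) (real j)) (t / real j)) \<longlonglongrightarrow> conv p l (t / real j)"
    proof (rule metric_tendsto_imp_tendsto[OF l], intro always_eventually allI)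
      fix n
      have "dist (conv p (\<sigma> (diagseq n) (real j)) (t / real j)) (conv p l (t / real j))
          \<le> t / real j * dist (\<sigma> (diagseq n) (real j)) l" by (rule dist_conv_conv_vertex[OF tj])
      also have "\<dots> \<le> dist (\<sigma> (diagseq n) (real j)) l"
        by (rule mult_left_le_one_le) (use tj in auto)
      finally show "dist (conv p (\<sigma> (diagseq n) (real j)) (t / real j)) (conv p l (t / real j))
          \<le> dist (\<sigma> (diagseq n) (real j)) l" .
    qed
    moreover have "eventually (\<lambda>n. conv p (\<sigma> (diagseq n) (real j)) (t / real j) = \<sigma> (diagseq n) t) sequentially"
      using eventually_unit_quotient[OF inf'' of_nat_0_le_iff[of j]]
    proof (rule eventually_mono)
      fix n assume n: "dist p (X (diagseq n)) > 0 \<and> real j / dist p (X (diagseq n)) \<in> {0..1}"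
      then have "conv p (\<sigma> (diagseq n) (real j)) (t / real j)
          = conv p (X (diagseq n)) (t / real j * (real j / dist p (X (diagseq n))))"
        unfolding \<sigma>_def by (intro conv_conv tj) simp
      then show "conv p (\<sigma> (diagseq n) (real j)) (t / real j) = \<sigma> (diagseq n) t"
        using j t by (simp add: \<sigma>_def)
    qed
    ultimately have "(\<lambda>n. \<sigma> (diagseq n) t) \<longlonglongrightarrow> conv p l (t / real j)"
      by (rule Lim_transform_eventually)
    then show ?thesis by (auto simp: convergent_def)
  qed
  then obtain r where "geodesic_ray r" "r 0 = p"
      "\<And>t. 0 \<le> t \<Longrightarrow> (\<lambda>n. conv p (X (diagseq n)) (t / dist p (X (diagseq n)))) \<longlonglongrightarrow> r t"
    using ray_limit_of_segments[OF inf''] unfolding \<sigma>_def by blast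
  then show thesis using that[OF subseq_diagseq] by blast
qed

lemma lipschitz_tendsto:
  fixes f :: "'a::metric_space \<Rightarrow> real"
  assumes lip: "\<And>x y. \<bar>f x - f y\<bar> \<le> M * dist x y" and X: "X \<longlonglongrightarrow> x"
  shows "(\<lambda>n. f (X n)) \<longlonglongrightarrow> f x"
proof -
  have "(\<lambda>n. M * dist (X n) x) \<longlonglongrightarrow> 0"
    by (rule tendsto_mult_right_zero[OF tendsto_dist_iff[THEN iffD1, OF X]])
  moreover have "eventually (\<lambda>n. norm (f (X n) - f x) \<le> M * dist (X n) x) sequentially"
    using lip by simp
  ultimately have "(\<lambda>n. f (X n) - f x) \<longlonglongrightarrow> 0" by (rule Lim_null_comparison[rotated])
  then show ?thesis by (simp add: LIM_zero_iff)
qed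

lemma fixed_point_locally_compact:
  fixes c :: "'a::hadamard_space config"
  assumes c: "weighted_configuration c" and stable: "stable_configuration c"
    and lc: "locally compact (UNIV :: 'a set)"
  shows "\<exists>x. weak_contraction c x = x"
proof (rule ccontr)
  assume no: "\<nexists>x. weak_contraction c x = x"
  define p :: 'a where "p = undefined"
  define f where "f = config_busemann p c"
  define B where "B = (config_weight c)\<^sup>2 / 2"
  obtain X where inf: "filterlim (\<lambda>n. dist p (X n)) at_top sequentially"
      and X: "\<And>n. \<exists>l\<in>{0<..<1}. X n = conv p (weak_contraction c (X n)) l"
    using fixed_point_or_escape[of "weak_contraction c" p] weak_contraction_nonexpansive[OF c] no by blast
  \<comment> \<open>\<open>X n\<close> lies between \<open>p\<close> and its image, hence is no
    farther from \<open>p\<close> than the image; \<open>dist_weak_contraction_sq\<close> then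
    leaves only the constant.\<close>
  have f: "f (X n) \<le> B" for n
  proof -
    obtain l where l: "l \<in> {0<..<1}" "X n = conv p (weak_contraction c (X n)) l" using X by blast
    have "dist p (X n) = l * dist p (weak_contraction c (X n))"
      using dist_conv_left[of l p "weak_contraction c (X n)"] l by simp
    also have "\<dots> \<le> dist p (weak_contraction c (X n))"
      by (rule mult_left_le_one_le) (use l in auto)
    finally have "(dist p (X n))\<^sup>2 \<le> (dist p (weak_contraction c (X n)))\<^sup>2" by (rule power_mono) simp
    with dist_weak_contraction_sq[OF c, of p "X n"] show ?thesis unfolding f_def B_def by linarith
  qed
  obtain k r where k: "strict_mono k" and r: "geodesic_ray r" "r 0 = p"
      and lim: "\<And>t. 0 \<le> t \<Longrightarrow> (\<lambda>n. conv p (X (k n)) (t / dist p (X (k n)))) \<longlonglongrightarrow> r t"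
    by (rule locally_compact_ray_subsequence[OF lc inf]) (rule that)
  have inf': "filterlim (\<lambda>n. dist p (X (k n))) at_top sequentially"
    by (rule filterlim_compose[OF inf filterlim_subseq[OF k]])
  \<comment> \<open>On the segment from \<open>p\<close>, where f is 0, to a point at distance d
    with f \<le> B, convexity gives at most (t / d) B at distance t, and d tends to
    infinity.\<close>
  have le: "f (r t) \<le> 0" if t: "0 \<le> t" for t
  proof (rule tendsto_le[OF sequentially_bot])
    show "(\<lambda>n. f (conv p (X (k n)) (t / dist p (X (k n))))) \<longlonglongrightarrow> f (r t)" 
      unfolding f_def by (rule lipschitz_tendsto[OF config_busemann_lipschitz[OF c] lim[OF t]])
    show "(\<lambda>n. t / dist p (X (k n)) * B) \<longlonglongrightarrow> 0"
      by (intro tendsto_mult_left_zero tendsto_divide_0[OF tendsto_const]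
          filterlim_at_top_imp_at_infinity[OF inf'])
    show "eventually (\<lambda>n. f (conv p (X (k n)) (t / dist p (X (k n)))) \<le> t / dist p (X (k n)) * B) sequentially"
      using eventually_unit_quotient[OF inf' t]
    proof eventually_elim
      case (elim n)
      then have l: "t / dist p (X (k n)) \<in> {0..1}" by simp
      have "f (conv p (X (k n)) (t / dist p (X (k n)))) \<le> t / dist p (X (k n)) * f (X (k n))"
        using config_busemann_convex[OF l c, of p p "X (k n)"] config_busemann_self[OF c] by (simp add: f_def)
      also have "\<dots> \<le> t / dist p (X (k n)) * B" using f by (rule mult_left_mono) (use l in simp)
      finally show ?case .
    qed
  qed
  obtain \<eta> where \<eta>: "\<eta> \<in> ideal_boundary" "ray_from (r 0) \<eta> = r"
    by (rule ideal_point_of_ray[OF r(1)]) (rule that)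
  have "slope c \<eta> \<le> 0"
    by (rule slope_le_of_linear_bound[OF c \<eta>(1), of p]) (use le \<eta>(2) r(2) in \<open>simp add: f_def\<close>)
  moreover have "slope c \<eta> > 0" using stable \<eta>(1) by (simp add: stable_configuration_def)
  ultimately show False by simp
qed


section \<open>Rays of steepest descent\<close>

text \<open>
  A convex Lipschitz function of negative minimal asymptotic slope has a ray of steepest descent,
  without any compactness: midpoints show that points which almost realize the minimal slope lie
  in almost the same direction.
\<close>

lemma descent_ray:
  fixes f :: "'a::hadamard_space \<Rightarrow> real"
  assumes convex: "\<And>y z l. l \<in> {0..1} \<Longrightarrow> f (conv y z l) \<le> (1 - l) * f y + l * f z"
    and lip: "\<And>x y. \<bar>f x - f y\<bar> \<le> M * dist x y" and fp: "f p = 0" and e: "0 < e"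
    and descent: "\<And>R. \<exists>x. R \<le> dist p x \<and> f x \<le> - e * dist p x"
  obtains r v where "geodesic_ray r" "r 0 = p" "0 < v" "\<And>t. 0 \<le> t \<Longrightarrow> f (r t) \<le> - v * t"
proof -
  have lower: "- M * dist p x \<le> f x" for x using lip[of x p] by (simp add: fp dist_commute abs_le_iff)
  have M: "M > 0"
  proof -
    obtain x where x: "1 \<le> dist p x" "f x \<le> - e * dist p x" using descent by blast
    then have "e * dist p x \<le> M * dist p x" using lower[of x] by linarith
    moreover have "0 < dist p x" using x(1) by linarith
    ultimately have "e \<le> M" by (rule mult_right_le_imp_le)
    then show ?thesis using e by simp
  qed
  define A where "A R = (\<lambda>x. f x / dist p x) ` {x. R \<le> dist p x}" for R
  define Q where "Q R = Inf (A R)" for R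
  have ne: "A R \<noteq> {}" for R using descent[of R] by (auto simp: A_def)
  have bdd: "bdd_below (A R)" if R: "R > 0" for R
    using lower R unfolding A_def by (intro bdd_belowI2[of _ "- M"]) (auto simp: le_divide_eq)
  have Q_e: "Q R \<le> - e" if R: "R > 0" for R
  proof -
    obtain x where x: "R \<le> dist p x" "f x \<le> - e * dist p x" using descent by blast
    then have "Q R \<le> f x / dist p x" unfolding Q_def by (intro cInf_lower bdd[OF R]) (auto simp: A_def)
    also have "\<dots> \<le> - e"
    proof -
      have "dist p x > 0" using x(1) R by linarith
      then show ?thesis using x(2) by (simp only: pos_divide_le_eq)
    qed
    finally show ?thesis .
  qed
  have bddQ: "bdd_above (range (\<lambda>n. Q (real (Suc n))))"
    by (rule bdd_aboveI2[of _ _ "- e"]) (rule Q_e, simp)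
  \<comment> \<open>\<open>Q R\<close> increases with R, so -v is the lower limit of f(x) / d(p, x)
    at infinity.\<close>
  define v where "v = - (SUP n. Q (real (Suc n)))"
  have "(SUP n. Q (real (Suc n))) \<le> - e" by (rule cSUP_least) (simp, rule Q_e, simp)
  then have v: "v \<ge> e" by (simp add: v_def)
  then have v0: "v > 0" using e by simp
  have L: "\<exists>T0>0. \<forall>z. T0 \<le> dist p z \<longrightarrow> - (v + \<tau>) * dist p z \<le> f z" if \<tau>: "\<tau> > 0" for \<tau>
  proof -
    have "- v - \<tau> < (SUP n. Q (real (Suc n)))" using \<tau> by (simp add: v_def)
    then obtain n where n: "- v - \<tau> < Q (real (Suc n))" using less_cSUP_iff[OF _ bddQ] by auto
    have "- (v + \<tau>) * dist p z \<le> f z" if z: "real (Suc n) \<le> dist p z" for z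
    proof -
      have pos: "dist p z > 0" using z by linarith
      have "Q (real (Suc n)) \<le> f z / dist p z"
        unfolding Q_def using z by (intro cInf_lower bdd) (auto simp: A_def)
      with n have "- (v + \<tau>) \<le> f z / dist p z" by simp
      then show ?thesis using pos by (simp only: pos_le_divide_eq)
    qed
    then show ?thesis by (intro exI[of _ "real (Suc n)"]) auto
  qed
  have "\<exists>x. real (Suc n) \<le> dist p x \<and> f x \<le> (- v + 1 / real (Suc n)) * dist p x" for n
  proof -
    have "Q (real (Suc n)) \<le> - v" using cSUP_upper[OF _ bddQ, of n] by (simp add: v_def)
    then have "Inf (A (real (Suc n))) < - v + 1 / real (Suc n)"
      unfolding Q_def by (smt (verit) of_nat_0_less_iff zero_less_Suc zero_less_divide_1_iff)
    then obtain a where "a \<in> A (real (Suc n))" "a < - v + 1 / real (Suc n)"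
      using cInf_less_iff[OF ne bdd, of "real (Suc n)"] by auto
    then obtain x where x: "real (Suc n) \<le> dist p x" "f x / dist p x < - v + 1 / real (Suc n)"
      by (auto simp: A_def)
    then have "dist p x > 0" by linarith
    then have "f x < (- v + 1 / real (Suc n)) * dist p x" using x(2) by (simp only: pos_divide_less_eq)
    with x(1) show ?thesis by (intro exI[of _ x]) simp
  qed
  then obtain X where X: "\<And>n. real (Suc n) \<le> dist p (X n)"
      "\<And>n. f (X n) \<le> (- v + 1 / real (Suc n)) * dist p (X n)" by metis
  have inf: "filterlim (\<lambda>n. dist p (X n)) at_top sequentially"
  proof (rule filterlim_at_top_mono[OF filterlim_real_sequentially], intro always_eventually allI)
    show "real n \<le> dist p (X n)" for n using X(1)[of n] by linarith
  qed
  define \<sigma> where "\<sigma> n t = conv p (X n) (t / dist p (X n))" for n t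
  have f\<sigma>: "f (\<sigma> n t) \<le> t * (- v + 1 / real (Suc n))"
    if t: "0 \<le> t" "t \<le> dist p (X n)" for n t
  proof -
    have pos: "dist p (X n) > 0" using X(1)[of n] by linarith
    have l: "t / dist p (X n) \<in> {0..1}" using t pos by (auto simp: divide_le_eq)
    have "f (\<sigma> n t) \<le> t / dist p (X n) * f (X n)" using convex[OF l, of p "X n"] by (simp add: \<sigma>_def fp)
    also have "\<dots> \<le> t / dist p (X n) * ((- v + 1 / real (Suc n)) * dist p (X n))"
      using X(2) by (rule mult_left_mono) (use l in simp)
    also have "\<dots> = t * (- v + 1 / real (Suc n))" using pos by simp
    finally show ?thesis .
  qed
  have cauchy: "Cauchy (\<lambda>n. \<sigma> n t)" if t: "0 \<le> t" for t
    unfolding Cauchy_altdef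
  proof (intro allI impI)
    fix \<epsilon> :: real assume \<epsilon>: "\<epsilon> > 0"
    \<comment> \<open>The final estimate bounds the squared distance by 16 t^2 \<open>\<tau>\<close>
      / v, which this makes less than \<open>\<epsilon>\<^sup>2\<close>; the + 1 covers t = 0, and v
      / 2 keeps v - \<open>\<tau>\<close> positive.\<close>
    define \<tau> where "\<tau> = min (v / 2) (v * \<epsilon>\<^sup>2 / (32 * (t\<^sup>2 + 1)))"
    have \<tau>: "\<tau> > 0" "\<tau> \<le> v / 2" "\<tau> \<le> v * \<epsilon>\<^sup>2 / (32 * (t\<^sup>2 + 1))"
    proof -
      have "0 < 32 * (t\<^sup>2 + 1)" by (simp add: add_nonneg_pos)
      then have "0 < v * \<epsilon>\<^sup>2 / (32 * (t\<^sup>2 + 1))" using v0 \<epsilon> by (intro divide_pos_pos mult_pos_pos) auto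
      then show "\<tau> > 0" using v0 unfolding \<tau>_def by (simp only: min_less_iff_conj) simp
    qed (simp_all only: \<tau>_def min.cobounded1 min.cobounded2)
    obtain T0 where T0: "T0 > 0" "\<And>z. T0 \<le> dist p z \<Longrightarrow> - (v + \<tau>) * dist p z \<le> f z"
      using L[OF \<tau>(1)] by blast
    \<comment> \<open>So large that f \<le> -T (v - \<open>\<tau>\<close>) cannot hold within
      distance \<open>T0\<close> of \<open>p\<close>, where f \<ge> -M T0. This places the midpoint
      below in the range of the lower bound.\<close>
    define T where "T = t + M * T0 / (v - \<tau>) + 1"
    have v\<tau>: "v - \<tau> > 0" using \<tau> v0 by linarith
    have MT: "M * T0 / (v - \<tau>) > 0" using M T0 v\<tau> by simp
    have T: "T > 0" "t \<le> T" "M * T0 < T * (v - \<tau>)"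
    proof -
      show "T > 0" "t \<le> T" using MT t by (auto simp: T_def)
      have "M * T0 / (v - \<tau>) < T" using t by (simp add: T_def)
      then show "M * T0 < T * (v - \<tau>)" using v\<tau> by (simp add: divide_less_eq)
    qed
    obtain N where N: "real N > T + 1 / \<tau>" using reals_Archimedean2 by blast
    have close: "dist (\<sigma> n t) (\<sigma> m t) < \<epsilon>" if nm: "n \<ge> N" "m \<ge> N" for n m
    proof -
      have big: "T \<le> dist p (X n) \<and> f (\<sigma> n T) \<le> - (T * (v - \<tau>)) \<and> dist p (\<sigma> n T) = T \<and>
          conv p (\<sigma> n T) (t / T) = \<sigma> n t" if "n \<ge> N" for n
      proof -
        have "1 / \<tau> > 0" using \<tau> by simp
        moreover have "real N \<le> real (Suc n)" using that by simp
        ultimately have n: "T \<le> real (Suc n)" "1 / \<tau> \<le> real (Suc n)" using N T(1) by linarith+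
        then have d: "T \<le> dist p (X n)" using X(1)[of n] by linarith
        then have ne: "p \<noteq> X n" using T(1) by auto
        have l: "T / dist p (X n) \<in> {0..1}" using d T by (auto simp: divide_le_eq)
        have "1 / real (Suc n) \<le> \<tau>" using n(2) \<tau>(1) by (simp add: field_simps)
        then have "T * (- v + 1 / real (Suc n)) \<le> T * (- v + \<tau>)" using T(1) by (intro mult_left_mono) auto
        then have "f (\<sigma> n T) \<le> - (T * (v - \<tau>))" using f\<sigma>[of T n] T(1) d by (simp add: algebra_simps)
        moreover have "dist p (\<sigma> n T) = T" using dist_conv_left[OF l, of p "X n"] ne by (simp add: \<sigma>_def)
        moreover have "conv p (\<sigma> n T) (t / T) = \<sigma> n t"
          using conv_conv[OF l, of "t / T" p "X n"] t T by (simp add: \<sigma>_def)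
        ultimately show ?thesis using d by simp
      qed
      have bn: "f (\<sigma> n T) \<le> - (T * (v - \<tau>))" "dist p (\<sigma> n T) = T" "conv p (\<sigma> n T) (t / T) = \<sigma> n t"
        using big[OF nm(1)] by blast+
      have bm: "f (\<sigma> m T) \<le> - (T * (v - \<tau>))" "dist p (\<sigma> m T) = T" "conv p (\<sigma> m T) (t / T) = \<sigma> m t"
        using big[OF nm(2)] by blast+
      define q where "q = t\<^sup>2 + 1"
      have q: "q > 0" "t\<^sup>2 < 2 * q" by (simp_all add: q_def add_nonneg_pos)
      \<comment> \<open>By convexity f is as low at the midpoint as at the two points, so the
        midpoint is at distance at least T (v - \<open>\<tau>\<close>) / (v + \<open>\<tau>\<close>)
        from \<open>p\<close>. Two points at distance T with such a midpoint are close, by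
        Stewart.\<close>
      define y where "y = conv (\<sigma> n T) (\<sigma> m T) (1 / 2)"
      define D where "D = dist (\<sigma> n T) (\<sigma> m T)"
      have "f y \<le> (1 - 1 / 2) * f (\<sigma> n T) + 1 / 2 * f (\<sigma> m T)"
        unfolding y_def by (rule convex) simp
      also have "\<dots> \<le> (1 - 1 / 2) * - (T * (v - \<tau>)) + 1 / 2 * - (T * (v - \<tau>))"
        by (intro add_mono mult_left_mono bn bm) auto
      also have "\<dots> = - (T * (v - \<tau>))" by simp
      finally have fy: "f y \<le> - (T * (v - \<tau>))" .
      have "T0 \<le> dist p y"
      proof (rule ccontr)
        assume "\<not> T0 \<le> dist p y"
        then have "M * dist p y \<le> M * T0" using M by simp
        then have "- (M * T0) \<le> f y" using lower[of y] by simp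
        also note fy
        finally show False using T(3) by simp
      qed
      then have "- (v + \<tau>) * dist p y \<le> f y" by (rule T0(2))
      then have "T * (v - \<tau>) \<le> (v + \<tau>) * dist p y" using fy by (simp add: algebra_simps)
      then have "(T * (v - \<tau>))\<^sup>2 \<le> ((v + \<tau>) * dist p y)\<^sup>2"
        using T(1) v\<tau> by (intro power_mono) auto
      then have "T\<^sup>2 * (v - \<tau>)\<^sup>2 \<le> (v + \<tau>)\<^sup>2 * (dist p y)\<^sup>2"
        by (simp only: power_mult_distrib)
      also have "(dist p y)\<^sup>2 \<le> T\<^sup>2 - D\<^sup>2 / 4"
        using stewart[of "1 / 2" p "\<sigma> n T" "\<sigma> m T"] bn bm by (simp add: y_def D_def)
      then have "(v + \<tau>)\<^sup>2 * (dist p y)\<^sup>2 \<le> (v + \<tau>)\<^sup>2 * (T\<^sup>2 - D\<^sup>2 / 4)"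
        by (rule mult_left_mono) simp
      finally have "(v + \<tau>)\<^sup>2 * D\<^sup>2 / 4 \<le> T\<^sup>2 * ((v + \<tau>)\<^sup>2 - (v - \<tau>)\<^sup>2)"
        by (simp add: right_diff_distrib mult.commute)
      also have "(v + \<tau>)\<^sup>2 - (v - \<tau>)\<^sup>2 = 4 * v * \<tau>" by (simp add: power2_eq_square algebra_simps)
      finally have 1: "(v + \<tau>)\<^sup>2 * D\<^sup>2 \<le> 16 * T\<^sup>2 * v * \<tau>" by simp
      have "v\<^sup>2 * D\<^sup>2 \<le> (v + \<tau>)\<^sup>2 * D\<^sup>2" using v0 \<tau>(1) by (intro mult_right_mono power_mono) auto
      with 1 have "v * (v * D\<^sup>2) \<le> v * (16 * T\<^sup>2 * \<tau>)" by (simp add: power2_eq_square algebra_simps)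
      then have 2: "v * D\<^sup>2 \<le> 16 * T\<^sup>2 * \<tau>" using v0 by (rule mult_left_le_imp_le)
      have "dist (\<sigma> n t) (\<sigma> m t) \<le> t / T * D"
        using dist_conv_conv_vertex[of "t / T" p "\<sigma> n T" "\<sigma> m T"] bn bm t T by (simp add: D_def)
      then have "(dist (\<sigma> n t) (\<sigma> m t))\<^sup>2 \<le> (t / T * D)\<^sup>2" by (rule power_mono) simp
      then have "v * (dist (\<sigma> n t) (\<sigma> m t))\<^sup>2 \<le> v * (t / T * D)\<^sup>2" using v0 by simp
      also have "\<dots> = (t / T)\<^sup>2 * (v * D\<^sup>2)"
        unfolding power_mult_distrib by (rule mult.left_commute)
      also have "\<dots> \<le> (t / T)\<^sup>2 * (16 * T\<^sup>2 * \<tau>)" using 2 by (rule mult_left_mono) simp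
      also have "\<dots> = 16 * t\<^sup>2 * \<tau>" using T(1) by (simp add: power_divide)
      also have "\<dots> \<le> 16 * t\<^sup>2 * (v * \<epsilon>\<^sup>2 / (32 * q))"
        using \<tau>(3) unfolding q_def by (rule mult_left_mono) simp
      also have "\<dots> = v * \<epsilon>\<^sup>2 * (t\<^sup>2 / (2 * q))" using q(1) by (simp add: field_simps)
      also have "\<dots> < v * \<epsilon>\<^sup>2 * 1"
        using q v0 \<epsilon> by (intro mult_strict_left_mono) (simp_all add: pos_divide_less_eq)
      finally have "(dist (\<sigma> n t) (\<sigma> m t))\<^sup>2 < \<epsilon>\<^sup>2" using v0 by simp
      then show ?thesis using \<epsilon> by (simp add: power2_less_imp_less)
    qed
    then show "\<exists>M. \<forall>m\<ge>M. \<forall>n>m. dist (\<sigma> m t) (\<sigma> n t) < \<epsilon>"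
      by (intro exI[of _ N]) simp
  qed
  obtain r where r: "geodesic_ray r" "r 0 = p" and lim: "\<And>t. 0 \<le> t \<Longrightarrow> (\<lambda>n. \<sigma> n t) \<longlonglongrightarrow> r t"
  proof (rule ray_limit_of_segments[OF inf])
    show "convergent (\<lambda>n. conv p (X n) (t / dist p (X n)))" if "0 \<le> t" for t
      using cauchy[OF that] by (simp add: Cauchy_convergent_iff \<sigma>_def)
  qed (use that in \<open>simp add: \<sigma>_def\<close>)
  have "f (r t) \<le> - v * t" if t: "0 \<le> t" for t
  proof (rule tendsto_le[OF sequentially_bot])
    show "(\<lambda>n. f (\<sigma> n t)) \<longlonglongrightarrow> f (r t)" by (rule lipschitz_tendsto[OF lip lim[OF t]])
    have "(\<lambda>n. 1 / real (Suc n)) \<longlonglongrightarrow> 0" using LIMSEQ_Suc[OF lim_const_over_n[of 1]] by simp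
    then have "(\<lambda>n. t * (- v + 1 / real (Suc n))) \<longlonglongrightarrow> t * (- v + 0)" by (intro tendsto_intros)
    then show "(\<lambda>n. t * (- v + 1 / real (Suc n))) \<longlonglongrightarrow> - v * t" by (simp add: mult.commute)
    have "eventually (\<lambda>n. t \<le> dist p (X n)) sequentially"
      using inf unfolding filterlim_at_top by blast
    then show "eventually (\<lambda>n. f (\<sigma> n t) \<le> t * (- v + 1 / real (Suc n))) sequentially"
      by eventually_elim (rule f\<sigma>[OF t])
  qed
  with r v0 show thesis by (intro that)
qed

lemma semistable_sublinear_lower_bound:
  assumes c: "weighted_configuration c" and semistable: "semistable_configuration c" and e: "0 < e"
  shows "\<exists>R. \<forall>x. R \<le> dist p x \<longrightarrow> - e * dist p x < config_busemann p c x"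
proof (rule ccontr)
  assume "\<nexists>R. \<forall>x. R \<le> dist p x \<longrightarrow> - e * dist p x < config_busemann p c x"
  then have descent: "\<exists>x. R \<le> dist p x \<and> config_busemann p c x \<le> - e * dist p x" for R
    by (meson not_le)
  obtain r v where r: "geodesic_ray r" "r 0 = p" "0 < v"
      and le: "\<And>t. 0 \<le> t \<Longrightarrow> config_busemann p c (r t) \<le> - v * t"
  proof (rule descent_ray[of "config_busemann p c" "config_weight c" p e])
    show "config_busemann p c (conv y z l) \<le>
        (1 - l) * config_busemann p c y + l * config_busemann p c z" if "l \<in> {0..1}" for y z l
      by (rule config_busemann_convex[OF that c])
  qed (use config_busemann_lipschitz[OF c] config_busemann_self[OF c] e descent that in auto)
  obtain \<eta> where \<eta>: "\<eta> \<in> ideal_boundary" "ray_from (r 0) \<eta> = r"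
    by (rule ideal_point_of_ray[OF r(1)]) (rule that)
  have "slope c \<eta> \<le> - v"
    by (rule slope_le_of_linear_bound[OF c \<eta>(1), of p]) (use le \<eta>(2) r(2) in simp)
  moreover have "0 \<le> slope c \<eta>" using semistable \<eta>(1) by (simp add: semistable_configuration_def)
  ultimately show False using r(3) by simp
qed

section \<open>Affine Weyl groups\<close>

lemma hyperplane_reflection_affine:
  fixes w :: "real^'d \<Rightarrow> real^'d"
  assumes "w \<in> hyperplane_reflections"
  shows "orthogonal_transformation (rotational_part w)"
    and "w (w u) = u"
proof -
  obtain v b where w: "w = (\<lambda>x. x - (2 * (v \<bullet> x - b)) *\<^sub>R v)" and v: "norm v = 1"
    using assms by (auto simp: hyperplane_reflections_def)
  have vv: "v \<bullet> v = 1" using v by (simp add: norm_eq_1)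
  have rot: "rotational_part w = (\<lambda>x. x - (2 * (v \<bullet> x)) *\<^sub>R v)"
    by (auto simp: rotational_part_def w algebra_simps)
  have lin: "linear (rotational_part w)"
    unfolding rot by (rule linearI) (simp_all add: inner_add_right algebra_simps)
  have "rotational_part w x \<bullet> rotational_part w y = x \<bullet> y" for x y
    by (simp add: rot inner_diff_left inner_diff_right vv inner_commute algebra_simps)
  with lin show "orthogonal_transformation (rotational_part w)"
    by (simp add: orthogonal_transformation_def)
  have k: "2 * (v \<bullet> w u - b) = - (2 * (v \<bullet> u - b))" by (simp add: w inner_diff_right vv)
  have "w (w u) = w u - (2 * (v \<bullet> w u - b)) *\<^sub>R v" using fun_cong[OF w, of "w u"] by simp
  also have "\<dots> = w u + (2 * (v \<bullet> u - b)) *\<^sub>R v" unfolding k scaleR_minus_left diff_minus_eq_add ..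
  also have "\<dots> = u" using fun_cong[OF w, of u] by simp
  finally show "w (w u) = u" .
qed

section \<open>The group of all bijections, and orbits of the rotational part\<close>

lemma mult_BijGroup_UNIV:
  "f \<in> carrier (BijGroup UNIV) \<Longrightarrow> g \<in> carrier (BijGroup UNIV) \<Longrightarrow> f \<otimes>\<^bsub>BijGroup UNIV\<^esub> g = f \<circ> g"
  by (auto simp: BijGroup_def compose_def fun_eq_iff)

lemma one_BijGroup_UNIV: "\<one>\<^bsub>BijGroup UNIV\<^esub> = id"
  by (auto simp: BijGroup_def fun_eq_iff)

lemma hyperplane_reflections_carrier:
  "(hyperplane_reflections :: (real^'d \<Rightarrow> real^'d) set) \<subseteq> carrier (BijGroup UNIV)"
proof
  fix w :: "real^'d \<Rightarrow> real^'d" assume "w \<in> hyperplane_reflections"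
  then have "bij w" using hyperplane_reflection_affine(2)[of w] by (intro o_bij[of w]) (auto simp: fun_eq_iff)
  then show "w \<in> carrier (BijGroup UNIV)" by (simp add: BijGroup_def Bij_def)
qed

context
  fixes G :: "(real^'d \<Rightarrow> real^'d) set"
  assumes G: "affine_weyl_group G"
begin

lemma affine_weyl_group_subgroup: "subgroup G (BijGroup UNIV)"
proof -
  obtain R where "R \<subseteq> hyperplane_reflections" "G = generate (BijGroup UNIV) R"
    using G by (auto simp: affine_weyl_group_def)
  then show ?thesis
    using group.generate_is_subgroup[OF group_BijGroup] hyperplane_reflections_carrier by blast
qed

text \<open>Induction over words in reflections: a reflection is its own inverse, and rotational
  parts multiply as soon as the left one is linear.\<close>

lemma orthogonal_rotational_part:
  assumes "w \<in> G"
  shows "orthogonal_transformation (rotational_part w)"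
proof -
  obtain R where R: "R \<subseteq> hyperplane_reflections" "G = generate (BijGroup UNIV) R"
    using G by (auto simp: affine_weyl_group_def)
  have carrier: "h \<in> generate (BijGroup UNIV) R \<Longrightarrow> h \<in> carrier (BijGroup UNIV)" for h
    using group.generate_in_carrier[OF group_BijGroup] R(1) hyperplane_reflections_carrier by blast
  have "w \<in> generate (BijGroup UNIV) R" using assms R(2) by simp
  then show "orthogonal_transformation (rotational_part w)"
  proof induction
    case one
    have "rotational_part id = (id :: real^'d \<Rightarrow> real^'d)" by (auto simp: rotational_part_def)
    then show ?case by (simp add: one_BijGroup_UNIV orthogonal_transformation_id id_def)
  next
    case (incl h)
    then show ?case using R(1) hyperplane_reflection_affine(1) by blast
  next
    case (inv h)
    then have h: "h \<in> hyperplane_reflections" "h \<in> carrier (BijGroup UNIV)"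
      using R(1) hyperplane_reflections_carrier by blast+
    have "h \<otimes>\<^bsub>BijGroup UNIV\<^esub> h = \<one>\<^bsub>BijGroup UNIV\<^esub>"
      using hyperplane_reflection_affine(2)[OF h(1)]
      by (simp add: mult_BijGroup_UNIV h(2) one_BijGroup_UNIV fun_eq_iff)
    then have "inv\<^bsub>BijGroup UNIV\<^esub> h = h" by (rule group.inv_equality[OF group_BijGroup _ h(2) h(2)])
    then show ?case using hyperplane_reflection_affine(1)[OF h(1)] by simp
  next
    case (eng h1 h2)
    have "rotational_part (h1 \<circ> h2) = rotational_part h1 \<circ> rotational_part h2"
    proof
      fix u
      have lin: "linear (rotational_part h1)" using eng by (simp add: orthogonal_transformation_linear)
      have "rotational_part (h1 \<circ> h2) u = rotational_part h1 (h2 u) - rotational_part h1 (h2 0)"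
        by (simp add: rotational_part_def)
      then show "rotational_part (h1 \<circ> h2) u = (rotational_part h1 \<circ> rotational_part h2) u"
        by (simp add: linear_diff[OF lin, symmetric] rotational_part_def[of h2])
    qed
    moreover have "h1 \<otimes>\<^bsub>BijGroup UNIV\<^esub> h2 = h1 \<circ> h2" using eng by (intro mult_BijGroup_UNIV carrier)
    ultimately show ?case using eng orthogonal_transformation_compose by metis
  qed
qed

lemma rotational_part_comp:
  assumes "v \<in> G"
  shows "rotational_part (v \<circ> w) = rotational_part v \<circ> rotational_part w"
proof
  fix u
  note lin = orthogonal_transformation_linear[OF orthogonal_rotational_part[OF assms]]
  have "rotational_part (v \<circ> w) u = rotational_part v (w u) - rotational_part v (w 0)"
    by (simp add: rotational_part_def)
  then show "rotational_part (v \<circ> w) u = (rotational_part v \<circ> rotational_part w) u"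
    by (simp add: linear_diff[OF lin, symmetric] rotational_part_def[of w])
qed

lemma affine_weyl_group_comp: "v \<in> G \<Longrightarrow> w \<in> G \<Longrightarrow> v \<circ> w \<in> G"
  using subgroup.m_closed[OF affine_weyl_group_subgroup, of v w]
    subgroup.mem_carrier[OF affine_weyl_group_subgroup] by (simp add: mult_BijGroup_UNIV)

lemma affine_weyl_group_id: "id \<in> G"
  using subgroup.one_closed[OF affine_weyl_group_subgroup] by (simp add: one_BijGroup_UNIV)

lemma affine_weyl_group_inv:
  assumes w: "w \<in> G"
  obtains w' where "w' \<in> G" "w' \<circ> w = id"
proof
  let ?w = "inv\<^bsub>BijGroup UNIV\<^esub> w"
  note carr = subgroup.mem_carrier[OF affine_weyl_group_subgroup w]
  show w': "?w \<in> G" by (rule subgroup.m_inv_closed[OF affine_weyl_group_subgroup w])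
  have "?w \<otimes>\<^bsub>BijGroup UNIV\<^esub> w = \<one>\<^bsub>BijGroup UNIV\<^esub>"
    by (rule group.l_inv[OF group_BijGroup carr])
  then show "?w \<circ> w = id"
    by (simp add: mult_BijGroup_UNIV carr subgroup.mem_carrier[OF affine_weyl_group_subgroup w'] one_BijGroup_UNIV)
qed

lemma weyl_orbit_iff: "u \<in> weyl_orbit G v \<longleftrightarrow> (\<exists>w\<in>G. u = rotational_part w v)"
  by (auto simp: weyl_orbit_def)

lemma weyl_orbit_self: "v \<in> weyl_orbit G v"
  unfolding weyl_orbit_iff using affine_weyl_group_id by (intro bexI[of _ id]) (simp_all add: rotational_part_def)

lemma finite_weyl_orbit: "finite (weyl_orbit G v)"
  using G by (simp add: weyl_orbit_def affine_weyl_group_def)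

lemma weyl_orbit_closed: "u \<in> weyl_orbit G v \<Longrightarrow> w \<in> G \<Longrightarrow> rotational_part w u \<in> weyl_orbit G v"
  unfolding weyl_orbit_iff using affine_weyl_group_comp rotational_part_comp by (metis comp_apply)

lemma weyl_orbit_transitive:
  assumes "u \<in> weyl_orbit G v" "u' \<in> weyl_orbit G v"
  obtains w where "w \<in> G" "u' = rotational_part w u"
proof -
  obtain a b where ab: "a \<in> G" "b \<in> G" "u = rotational_part a v" "u' = rotational_part b v"
    using assms by (auto simp: weyl_orbit_iff)
  obtain a' where a': "a' \<in> G" "a' \<circ> a = id" using affine_weyl_group_inv[OF ab(1)] by blast
  have "rotational_part a' u = rotational_part id v"
    using rotational_part_comp[OF a'(1), of a] a'(2) by (simp add: ab(3) fun_eq_iff)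
  then have "rotational_part a' u = v" by (simp add: rotational_part_def)
  then have "u' = rotational_part (b \<circ> a') u"
    using rotational_part_comp[OF ab(2), of a'] ab(4) by simp
  then show thesis using that affine_weyl_group_comp[OF ab(2) a'(1)] by blast
qed

lemma weyl_orbit_eq:
  assumes "u \<in> weyl_orbit G v"
  shows "weyl_orbit G u = weyl_orbit G v"
proof
  show "weyl_orbit G u \<subseteq> weyl_orbit G v"
    using weyl_orbit_closed[OF assms] by (auto simp: weyl_orbit_iff[of _ u])
  show "weyl_orbit G v \<subseteq> weyl_orbit G u"
  proof
    fix x assume "x \<in> weyl_orbit G v"
    then obtain w where "w \<in> G" "x = rotational_part w u" by (rule weyl_orbit_transitive[OF assms])
    then show "x \<in> weyl_orbit G u" by (auto simp: weyl_orbit_iff)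
  qed
qed

lemma rotational_part_dist:
  assumes "w \<in> G"
  shows "dist (rotational_part w u) (rotational_part w v) = dist u v"
proof -
  note o = orthogonal_rotational_part[OF assms]
  have "rotational_part w u - rotational_part w v = rotational_part w (u - v)"
    by (simp add: linear_diff[OF orthogonal_transformation_linear[OF o]])
  then show ?thesis using orthogonal_transformation_norm[OF o] by (simp add: dist_norm)
qed

lemma norm_weyl_orbit: "u \<in> weyl_orbit G v \<Longrightarrow> norm u = norm v"
  unfolding weyl_orbit_iff using orthogonal_rotational_part orthogonal_transformation_norm by blast

lemma weyl_orbit_uminus: "weyl_orbit G (- v) = uminus ` weyl_orbit G v"
proof -
  have "rotational_part w (- v) = - rotational_part w v" if "w \<in> G" for w
    using orthogonal_transformation_linear[OF orthogonal_rotational_part[OF that]] by (rule linear_neg)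
  then show ?thesis unfolding weyl_orbit_def image_image by (intro image_cong) auto
qed

lemma weyl_chamber_orbit:
  assumes "\<delta> \<in> weyl_chamber G"
  shows "finite \<delta>" "\<delta> \<noteq> {}" and "v \<in> \<delta> \<Longrightarrow> norm v = 1" and "v \<in> \<delta> \<Longrightarrow> \<delta> = weyl_orbit G v"
proof -
  obtain u where u: "norm u = 1" "\<delta> = weyl_orbit G u" using assms by (auto simp: weyl_chamber_def)
  show "finite \<delta>" "\<delta> \<noteq> {}" using u finite_weyl_orbit weyl_orbit_self by auto
  show "v \<in> \<delta> \<Longrightarrow> norm v = 1" using u norm_weyl_orbit by auto
  show "v \<in> \<delta> \<Longrightarrow> \<delta> = weyl_orbit G v" using u weyl_orbit_eq by auto
qed

end

lemma abs_inner_unit_le: "norm v = 1 \<Longrightarrow> norm w = 1 \<Longrightarrow> \<bar>v \<bullet> w\<bar> \<le> 1"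
  using Cauchy_Schwarz_ineq2[of v w] by simp

section \<open>Directions in Euclidean buildings\<close>

context euclidean_building
begin

lemma direction_props:
  assumes "x \<noteq> y"
  shows "finite (\<theta> x y)" "\<theta> x y \<noteq> {}" and "v \<in> \<theta> x y \<Longrightarrow> norm v = 1"
    and "v \<in> \<theta> x y \<Longrightarrow> \<theta> x y = weyl_orbit G v"
  using weyl_chamber_orbit[OF affine_weyl_group EB1_direction[OF assms]] by blast+

text \<open>(EB1) with chords for angles: orbits are finite, so \<open>chamber_dist\<close> is
  attained by some \<open>v\<close>, \<open>w\<close>, and the squared chord is 2 - 2 (v \<bullet>
  w). Far points at bounded distance thus have directions with close representatives.\<close>

lemma close_directions:
  assumes ne: "x \<noteq> y" "x \<noteq> z"
  obtains v w where "v \<in> \<theta> x y" "w \<in> \<theta> x z" "(dist v w)\<^sup>2 * (dist x y * dist x z) \<le> (dist y z)\<^sup>2"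
proof -
  note vy = direction_props[OF ne(1)] and vz = direction_props[OF ne(2)]
  have eq: "orbit_distances (\<theta> x y) (\<theta> x z) = (\<lambda>(v, w). arccos (v \<bullet> w)) ` (\<theta> x y \<times> \<theta> x z)"
    by (auto simp: orbit_distances_def)
  have "finite (orbit_distances (\<theta> x y) (\<theta> x z))" "orbit_distances (\<theta> x y) (\<theta> x z) \<noteq> {}"
    unfolding eq using vy(1,2) vz(1,2) by auto
  then have "chamber_dist (\<theta> x y) (\<theta> x z) \<in> orbit_distances (\<theta> x y) (\<theta> x z)"
    unfolding chamber_dist_def using Min_in cInf_eq_Min by metis
  then obtain v w where vw: "v \<in> \<theta> x y" "w \<in> \<theta> x z"
      "arccos (v \<bullet> w) = chamber_dist (\<theta> x y) (\<theta> x z)"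
    by (auto simp: orbit_distances_def)
  have "arccos (v \<bullet> w) \<le> arccos (comparison_cos x y z)"
    using EB1_comparison[OF ne] vw(3) by (simp add: comparison_angle_arccos)
  moreover have nv: "norm v = 1" "norm w = 1" using vw vy(3) vz(3) by auto
  ultimately have "comparison_cos x y z \<le> v \<bullet> w"
    using comparison_cos_bounds[OF ne] abs_inner_unit_le[of v w]
    by (subst (asm) arccos_le_mono) (auto simp: abs_le_iff)
  then have "1 - (dist y z)\<^sup>2 / (2 * dist x y * dist x z) \<le> v \<bullet> w"
    using comparison_cos_ge[OF ne] by linarith
  moreover have "(dist v w)\<^sup>2 = 2 - 2 * (v \<bullet> w)"
    using nv by (simp add: dist_norm power2_norm_eq_inner inner_diff_left inner_diff_right
        inner_commute norm_eq_1)
  ultimately have "(dist v w)\<^sup>2 \<le> (dist y z)\<^sup>2 / (dist x y * dist x z)" by simp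
  moreover have "0 < dist x y * dist x z" using ne by simp
  ultimately show thesis using that[OF vw(1,2)] by (simp only: pos_le_divide_eq)
qed

lemma direction_commute:
  assumes "x \<noteq> y"
  shows "\<theta> y x = uminus ` \<theta> x y"
proof -
  note g = conv_geodesic[of x y]
  obtain \<iota> where \<iota>: "\<iota> \<in> \<A>" "geo x y ` {0..dist x y} \<subseteq> range \<iota>" using EB3_segment[OF g] by blast
  have "geo x y 0 \<in> range \<iota>" "geo x y (dist x y) \<in> range \<iota>" using \<iota>(2) by (auto simp: image_subset_iff)
  then obtain u v where uv: "x = \<iota> u" "y = \<iota> v"
    using geodesic_segmentD(1,2)[OF g] by (metis rangeE)
  then have "u \<noteq> v" using assms by auto
  then have "\<theta> x y = weyl_orbit G (sgn (v - u))" "\<theta> y x = weyl_orbit G (sgn (u - v))"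
    unfolding uv using EB3_direction[OF \<iota>(1)] by auto
  moreover have "sgn (u - v) = - sgn (v - u)" using sgn_minus[of "v - u"] by simp
  ultimately show ?thesis by (simp add: weyl_orbit_uminus[OF affine_weyl_group])
qed

text \<open>In an apartment containing the ray, equality in the triangle inequality makes the
  coordinate vectors to the two points proportional.\<close>

lemma direction_ray_constant:
  assumes r: "geodesic_ray r" and s: "0 < s" "s \<le> t"
  shows "\<theta> (r 0) (r s) = \<theta> (r 0) (r t)"
proof -
  obtain \<iota> where \<iota>: "\<iota> \<in> \<A>" "r ` {0..} \<subseteq> range \<iota>" using EB3_ray[OF r] by blast
  have mem: "r 0 \<in> range \<iota>" "r s \<in> range \<iota>" "r t \<in> range \<iota>"
    using \<iota>(2) s by (auto simp: image_subset_iff)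
  obtain a where a: "r 0 = \<iota> a" using mem(1) by (rule rangeE)
  obtain b where b: "r s = \<iota> b" using mem(2) by (rule rangeE)
  obtain d where d: "r t = \<iota> d" using mem(3) by (rule rangeE)
  have "dist a b = s" "dist b d = t - s" "dist a d = t"
    using geodesic_rayD[OF r, of 0 s] geodesic_rayD[OF r, of s t] geodesic_rayD[OF r, of 0 t] s
      EB3_isometric[OF \<iota>(1)] by (simp_all add: a b d)
  then have n: "norm (b - a) = s" "norm (d - b) = t - s" "norm (d - a) = t"
    by (simp_all add: dist_norm norm_minus_commute)
  have ne: "b \<noteq> a" "d \<noteq> a" using n s by auto
  have "norm ((b - a) + (d - b)) = norm (b - a) + norm (d - b)" using n by simp
  then have "s *\<^sub>R (d - b) = (t - s) *\<^sub>R (b - a)"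
    using norm_triangle_eq[of "b - a" "d - b"] n by simp
  then have "s *\<^sub>R (d - a) = t *\<^sub>R (b - a)" by (simp add: algebra_simps)
  then have "sgn (s *\<^sub>R (d - a)) = sgn (t *\<^sub>R (b - a))" by simp
  then have "sgn (d - a) = sgn (b - a)" using s by (simp add: sgn_scaleR)
  then show ?thesis using EB3_direction[OF \<iota>(1)] ne by (simp add: a b d)
qed

lemma direction_ray_from_constant:
  assumes \<xi>: "\<xi> \<in> ideal_boundary" and s: "0 < s"
  shows "\<theta> p (ray_from p \<xi> s) = \<theta> p (ray_from p \<xi> 1)"
  using direction_ray_constant[OF geodesic_ray_ray_from[OF \<xi>, of p], of s 1]
    direction_ray_constant[OF geodesic_ray_ray_from[OF \<xi>, of p], of 1 s] s
  by (cases "s \<le> 1") (simp_all add: ray_from_0[OF \<xi>])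

text \<open>So the type of a boundary point is well defined. (EB1) compares directions at a common
  vertex only, hence two comparisons, at \<open>p\<close> and at a far point \<open>y'\<close> of
  the ray from \<open>q\<close>, linked by reversing the segment between them. Both errors tend to 0
  as \<open>y'\<close> moves away, and two finite orbits at distance 0 coincide.\<close>

lemma direction_ideal_point:
  assumes \<xi>: "\<xi> \<in> ideal_boundary"
  shows "\<theta> p (ray_from p \<xi> 1) = \<theta> q (ray_from q \<xi> 1)"
proof (rule ccontr)
  assume neq: "\<theta> p (ray_from p \<xi> 1) \<noteq> \<theta> q (ray_from q \<xi> 1)"
  define P where "P = \<theta> p (ray_from p \<xi> 1)"
  define Q where "Q = \<theta> q (ray_from q \<xi> 1)"
  note np = ray_from_ne[OF \<xi>, of 1 p] and nq = ray_from_ne[OF \<xi>, of 1 q]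
  have pne: "p \<noteq> ray_from p \<xi> 1" "q \<noteq> ray_from q \<xi> 1" using np nq by auto
  note Pp = direction_props[OF pne(1), folded P_def] and Qp = direction_props[OF pne(2), folded Q_def]
  define d where "d = dist p q"
  have d0: "d \<ge> 0" by (simp add: d_def)
  have "\<exists>v\<in>P. \<exists>u\<in>Q. dist v u < e" if e: "e > 0" for e
  proof -
    define s where "s = 2 * d + 2 * d / e + 2 * d / e + 1"
    have de: "2 * d / e \<ge> 0" using d0 e by simp
    have s: "s > 0" "s - d > 0" "4 * d / e < s - d" using de d0 by (auto simp: s_def)
    define y y' where "y = ray_from p \<xi> s" and "y' = ray_from q \<xi> s"
    have dy: "dist p y = s" "dist q y' = s" "dist y y' \<le> d"
      using dist_ray_from_start[OF \<xi>, of s] dist_ray_from_le[OF \<xi>, of s p q] s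
      by (simp_all add: y_def y'_def d_def)
    have b: "s - d \<le> dist p y'" using dist_triangle[of q y' p] dy(2) by (simp add: d_def dist_commute)
    have ne: "p \<noteq> y" "p \<noteq> y'" "y' \<noteq> p" "y' \<noteq> q" using dy b s by auto
    have small: "dist v w < e / 2"
      if "(dist v w)\<^sup>2 * (a * b) \<le> c\<^sup>2" "c \<le> d" "0 \<le> c" "s - d \<le> a" "s - d \<le> b"
      for v w :: "real^'d" and a b c
    proof -
      have "(s - d) * (s - d) \<le> a * b" using that s by (intro mult_mono) auto
      then have "(dist v w)\<^sup>2 * ((s - d) * (s - d)) \<le> (dist v w)\<^sup>2 * (a * b)" by (rule mult_left_mono) simp
      also have "\<dots> \<le> c\<^sup>2" by (rule that(1))
      also have "\<dots> \<le> d\<^sup>2" using that by (intro power_mono)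
      finally have "(dist v w * (s - d))\<^sup>2 \<le> d\<^sup>2"
        by (simp only: power_mult_distrib power2_eq_square[of "s - d"])
      then have "dist v w * (s - d) \<le> d" using d0 by (rule power2_le_imp_le)
      also have "d < e / 2 * (s - d)" using s(3) e d0 s(2) by (simp add: divide_less_eq mult.commute)
      finally show ?thesis using s(2) by simp
    qed
    obtain v w where vw: "v \<in> \<theta> p y" "w \<in> \<theta> p y'" "(dist v w)\<^sup>2 * (dist p y * dist p y') \<le> (dist y y')\<^sup>2"
      by (rule close_directions[OF ne(1,2)])
    have 1: "dist v w < e / 2" by (rule small[OF vw(3)]) (use dy b s d0 in auto)
    obtain w' u where wu: "w' \<in> \<theta> y' p" "u \<in> \<theta> y' q" "(dist w' u)\<^sup>2 * (dist y' p * dist y' q) \<le> (dist p q)\<^sup>2"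
      by (rule close_directions[OF ne(3,4)])
    have 2: "dist w' u < e / 2"
      by (rule small[OF wu(3)]) (use dy b s d0 in \<open>auto simp: d_def dist_commute\<close>)
    have w': "- w' \<in> \<theta> p y'" using wu(1) direction_commute[OF ne(2)] by auto
    have u: "- u \<in> Q"
      using wu(2) direction_commute[of q y'] ne(4) direction_ray_from_constant[OF \<xi> s(1), of q]
      by (auto simp: y'_def Q_def)
    have v: "v \<in> P" using vw(1) direction_ray_from_constant[OF \<xi> s(1), of p] by (simp add: y_def P_def)
    have orb: "\<theta> p y' = weyl_orbit G w" by (rule direction_props(4)[OF ne(2) vw(2)])
    \<comment> \<open>The two comparisons produce different representatives \<open>w\<close> and
      \<open>- w'\<close> of the same direction; a Weyl group element aligns them without leaving
      the orbits.\<close>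
    obtain g where g: "g \<in> G" "- w' = rotational_part g w"
      using weyl_orbit_transitive[OF affine_weyl_group, of w w "- w'"] w'
        weyl_orbit_self[OF affine_weyl_group, of w] unfolding orb by blast
    have "rotational_part g v \<in> P"
      using weyl_orbit_closed[OF affine_weyl_group _ g(1), of v v] weyl_orbit_self[OF affine_weyl_group, of v]
        Pp(4)[OF v] by simp
    moreover have "dist (rotational_part g v) (- u) < e"
    proof -
      have "dist (rotational_part g v) (- w') < e / 2"
        unfolding g(2) rotational_part_dist[OF affine_weyl_group g(1)] by (rule 1)
      moreover have "dist (- w') (- u) < e / 2" using 2 by (simp add: dist_minus)
      ultimately show ?thesis using dist_triangle[of "rotational_part g v" "- u" "- w'"] by linarith
    qed
    ultimately show ?thesis using u by blast
  qed
  note close = this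
  have disj: "dist v u > 0" if "v \<in> P" "u \<in> Q" for v u
  proof (rule ccontr)
    assume "\<not> dist v u > 0"
    then have "v = u" by simp
    with Pp(4)[OF that(1)] Qp(4)[OF that(2)] neq show False by (simp add: P_def Q_def)
  qed
  define D where "D = (\<lambda>(v, u). dist v u) ` (P \<times> Q)"
  have D: "finite D" "D \<noteq> {}" using Pp(1,2) Qp(1,2) by (auto simp: D_def)
  then have "Min D \<in> D" by (rule Min_in)
  then have "Min D > 0" using disj by (auto simp: D_def)
  then obtain v u where "v \<in> P" "u \<in> Q" "dist v u < Min D" using close by blast
  then have "dist v u \<in> D" by (auto simp: D_def)
  from Min_le[OF D(1) this] \<open>dist v u < Min D\<close> show False by (rule leD[THEN notE])
qed

text \<open>(EB2), with the types of the boundary points read off at arbitrary points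
  \<open>a\<close> and \<open>b\<close>: the finite set does not move with \<open>p\<close>.\<close>

lemma ray_slope_finite_values:
  assumes \<omega>: "\<omega> \<in> ideal_boundary" and \<xi>: "\<xi> \<in> ideal_boundary"
  shows "ray_slope p \<omega> \<xi> \<in>
    (\<lambda>(v, w). - (v \<bullet> w)) ` (\<theta> a (ray_from a \<omega> 1) \<times> \<theta> b (ray_from b \<xi> 1))"
proof -
  have ne: "p \<noteq> ray_from p \<omega> 1" "p \<noteq> ray_from p \<xi> 1"
    using ray_from_ne[OF \<omega>, of 1 p] ray_from_ne[OF \<xi>, of 1 p] by simp_all
  obtain v w where vw: "v \<in> \<theta> p (ray_from p \<omega> 1)" "w \<in> \<theta> p (ray_from p \<xi> 1)"
      "segment_angle p (ray_from p \<omega> 1) (ray_from p \<xi> 1) = arccos (v \<bullet> w)"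
    using EB2[OF ne] by (auto simp: orbit_distances_def)
  have "\<bar>v \<bullet> w\<bar> \<le> 1"
    using abs_inner_unit_le direction_props(3)[OF ne(1) vw(1)] direction_props(3)[OF ne(2) vw(2)] by blast
  then have "ray_slope p \<omega> \<xi> = - (v \<bullet> w)" unfolding ray_slope_def vw(3) by (simp add: cos_arccos_abs)
  then show ?thesis
    using vw(1,2) direction_ideal_point[OF \<omega>, of p a] direction_ideal_point[OF \<xi>, of p b] by force
qed

end

section \<open>Fixed points in Euclidean buildings\<close>

text \<open>
  Both slopes belong to Busemann functions of \<open>\<xi>\<close> along parallel rays to \<open>\<omega>\<close>, hence to functions
  at bounded distance. As the slopes are quantized, their order cannot be violated over a long
  distance \<open>L\<close>.
\<close>

lemma ray_slope_le_of_gap: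
  fixes x q :: "'a::hadamard_space"
  assumes \<omega>: "\<omega> \<in> ideal_boundary" and \<xi>: "\<xi> \<in> ideal_boundary"
    and M: "dist q x \<le> M" and L: "0 \<le> L" "2 * M < L * g"
    and gap: "ray_slope (ray_from x \<omega> L) \<omega> \<xi> < ray_slope q \<omega> \<xi> \<Longrightarrow>
      g \<le> ray_slope q \<omega> \<xi> - ray_slope (ray_from x \<omega> L) \<omega> \<xi>"
  shows "ray_slope q \<omega> \<xi> \<le> ray_slope (ray_from x \<omega> L) \<omega> \<xi>"
proof (rule ccontr)
  let ?b = "busemann (ray_from x \<xi>)"
  let ?\<kappa> = "ray_slope (ray_from x \<omega> L) \<omega> \<xi>"
  note ray = geodesic_ray_ray_from[OF \<xi>, of x]
  assume "\<not> ray_slope q \<omega> \<xi> \<le> ?\<kappa>"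
  then have "g \<le> ray_slope q \<omega> \<xi> - ?\<kappa>" using gap by simp
  then have "L * g \<le> L * (ray_slope q \<omega> \<xi> - ?\<kappa>)" using L(1) by (rule mult_left_mono)
  then have Lg: "L * g \<le> L * ray_slope q \<omega> \<xi> - L * ?\<kappa>" by (simp only: right_diff_distrib)
  \<comment> \<open>The function of \<open>\<xi>\<close> grows over length L at least with its
    initial slope on the ray from \<open>q\<close> and at most with its final slope on the ray from
    \<open>x\<close>. The rays are within M of each other at both ends, so the slope difference is
    at most 2 M / L < g.\<close>
  have 1: "L * ray_slope q \<omega> \<xi> \<le> ?b (ray_from q \<omega> L) - ?b q"
    using busemann_ge_ray_slope[OF \<omega> \<xi> L(1), of q] busemann_base_change[OF \<xi>, of q "ray_from q \<omega> L" x]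
    by simp
  have 2: "?b (ray_from x \<omega> L) - ?b x \<le> L * ?\<kappa>"
    using busemann_push_le_ray_slope[OF \<xi> \<omega> L(1), of x x]
    by (simp add: ray_slope_commute[OF \<omega> \<xi>])
  have 3: "?b (ray_from q \<omega> L) - ?b (ray_from x \<omega> L) \<le> M"
    using busemann_lipschitz[OF ray, of "ray_from q \<omega> L" "ray_from x \<omega> L"]
      dist_ray_from_le[OF \<omega> L(1), of q x] M by linarith
  have 4: "?b x - ?b q \<le> M"
    using busemann_lipschitz[OF ray, of x q] M by (simp add: dist_commute)
  show False using Lg 1 2 3 4 L(2) by linarith
qed

text \<open>All intermediate points stay within \<open>config_weight c\<close> of \<open>y\<close>,
  so a bound on the slopes in that ball controls every push.\<close>

lemma busemann_weak_contraction_le: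
  fixes y :: "'a::hadamard_space"
  assumes \<omega>: "\<omega> \<in> ideal_boundary"
  shows "weighted_configuration c \<Longrightarrow>
    (\<And>q \<xi> m. dist q y \<le> config_weight c \<Longrightarrow> (\<xi>, m) \<in> set c \<Longrightarrow> ray_slope q \<omega> \<xi> \<le> \<kappa> \<xi>) \<Longrightarrow>
    busemann (ray_from x \<omega>) (weak_contraction c y) - busemann (ray_from x \<omega>) y
      \<le> (\<Sum>(\<xi>, m)\<leftarrow>c. m * \<kappa> \<xi>)"
proof (induction c arbitrary: y)
  case (Cons a c)
  obtain \<xi> m where a: "a = (\<xi>, m)" by force
  have \<xi>: "\<xi> \<in> ideal_boundary" and m: "m > 0" and c: "weighted_configuration c"
    using Cons.prems(1) by (auto simp: a)
  define z where "z = ray_from y \<xi> m"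
  have z: "dist z y = m" using dist_ray_from_start[OF \<xi>, of m y] m by (simp add: z_def dist_commute)
  have "ray_slope z \<omega> \<xi> \<le> \<kappa> \<xi>"
    using config_weight_nonneg[OF c] by (intro Cons.prems(2)[of z \<xi> m]) (simp_all add: z a)
  then have "m * ray_slope z \<omega> \<xi> \<le> m * \<kappa> \<xi>" using m by simp
  moreover have "busemann (ray_from x \<omega>) z - busemann (ray_from x \<omega>) y \<le> m * ray_slope z \<omega> \<xi>"
    using busemann_push_le_ray_slope[OF \<omega> \<xi>, of m x y] m by (simp add: z_def)
  moreover have "busemann (ray_from x \<omega>) (weak_contraction c z) - busemann (ray_from x \<omega>) z
      \<le> (\<Sum>(\<xi>, m)\<leftarrow>c. m * \<kappa> \<xi>)"
  proof (rule Cons.IH[OF c])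
    fix q \<xi>' m' assume q: "dist q z \<le> config_weight c" "(\<xi>', m') \<in> set c"
    then have "dist q y \<le> config_weight (a # c)"
      using dist_triangle[of q y z] z by (simp add: a)
    then show "ray_slope q \<omega> \<xi>' \<le> \<kappa> \<xi>'" using Cons.prems(2)[of q \<xi>' m'] q(2) by simp
  qed
  ultimately show ?case by (simp add: a z_def)
qed simp

lemma config_busemann_ray_ge:
  fixes z :: "'a::hadamard_space"
  assumes \<omega>: "\<omega> \<in> ideal_boundary" and h: "0 \<le> h"
  shows "weighted_configuration c \<Longrightarrow>
    config_busemann p c z + h * (\<Sum>(\<xi>, m)\<leftarrow>c. m * ray_slope z \<omega> \<xi>) \<le> config_busemann p c (ray_from z \<omega> h)"
proof (induction c)
  case (Cons a c)
  obtain \<xi> m where a: "a = (\<xi>, m)" by force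
  have \<xi>: "\<xi> \<in> ideal_boundary" and m: "m > 0" and c: "weighted_configuration c"
    using Cons.prems(1) by (auto simp: a)
  let ?b = "busemann (ray_from p \<xi>)"
  have "h * ray_slope z \<omega> \<xi> \<le> ?b (ray_from z \<omega> h) - ?b z"
    using busemann_ge_ray_slope[OF \<omega> \<xi> h, of z] busemann_base_change[OF \<xi>, of z "ray_from z \<omega> h" p]
    by simp
  then have "m * (h * ray_slope z \<omega> \<xi>) \<le> m * (?b (ray_from z \<omega> h) - ?b z)"
    using m by (intro mult_left_mono) auto
  with Cons.IH[OF c] show ?case by (simp add: a algebra_simps)
qed simp

section \<open>Finite sets of slope values and their gaps\<close>

lemma finite_weighted_sums:
  fixes S :: "real set"
  assumes "finite S"
  shows "finite {\<Sum>(\<xi>, m)\<leftarrow>c. m * \<kappa> \<xi> | \<kappa>. \<forall>(\<xi>, m)\<in>set c. \<kappa> \<xi> \<in> S}"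
proof (induction c)
  case (Cons a c)
  obtain \<xi> m where a: "a = (\<xi>, m)" by force
  have "{\<Sum>(\<xi>, m)\<leftarrow>a # c. m * \<kappa> \<xi> | \<kappa>. \<forall>(\<xi>, m)\<in>set (a # c). \<kappa> \<xi> \<in> S}
    \<subseteq> (\<lambda>(s, t). m * s + t) ` (S \<times> {\<Sum>(\<xi>, m)\<leftarrow>c. m * \<kappa> \<xi> | \<kappa>. \<forall>(\<xi>, m)\<in>set c. \<kappa> \<xi> \<in> S})"
    by (auto simp: a image_iff)
  then show ?case by (rule finite_subset) (use Cons assms in auto)
qed simp

lemma finite_positive_gap:
  fixes A :: "real set"
  assumes "finite A"
  obtains g where "0 < g" "\<And>a. a \<in> A \<Longrightarrow> 0 < a \<Longrightarrow> g \<le> a"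
proof -
  \<comment> \<open>The element 1 keeps the set nonempty if \<open>A\<close> has no positive
    element.\<close>
  define B where "B = insert 1 {a \<in> A. 0 < a}"
  have B: "finite B" "B \<noteq> {}" using assms by (auto simp: B_def)
  have "Min B \<in> B" using B by (rule Min_in)
  then have "0 < Min B" by (auto simp: B_def)
  moreover have "Min B \<le> a" if "a \<in> A" "0 < a" for a
    using that B by (intro Min_le) (auto simp: B_def)
  ultimately show thesis by (rule that)
qed

context euclidean_building
begin

lemma chart_through:
  obtains \<iota> u v where "\<iota> \<in> \<A>" "x = \<iota> u" "y = \<iota> v"
proof -
  note g = conv_geodesic[of x y]
  obtain \<iota> where \<iota>: "\<iota> \<in> \<A>" "geo x y ` {0..dist x y} \<subseteq> range \<iota>" using EB3_segment[OF g] by blast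
  have "geo x y 0 \<in> range \<iota>" "geo x y (dist x y) \<in> range \<iota>" using \<iota>(2) by (auto simp: image_subset_iff)
  then have "x \<in> range \<iota>" "y \<in> range \<iota>" unfolding geodesic_segmentD(1,2)[OF g] by auto
  then show thesis using that \<iota>(1) by blast
qed

lemma apartment_ray:
  assumes \<iota>: "\<iota> \<in> \<A>" and e: "norm e = 1"
  obtains \<omega> where "\<omega> \<in> ideal_boundary" "\<And>s. 0 \<le> s \<Longrightarrow> ray_from (\<iota> b) \<omega> s = \<iota> (b - s *\<^sub>R e)"
    and "\<And>q. \<theta> q (ray_from q \<omega> 1) = weyl_orbit G (- e)"
proof -
  define r where "r s = (if s \<in> {0..} then \<iota> (b - s *\<^sub>R e) else undefined)" for s
  have "dist (r s) (r t) = \<bar>s - t\<bar>" if "0 \<le> s" "0 \<le> t" for s t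
  proof -
    have "dist (r s) (r t) = norm ((t - s) *\<^sub>R e)"
      using that by (simp add: r_def EB3_isometric[OF \<iota>] dist_norm algebra_simps)
    then show ?thesis using e by (simp add: abs_minus_commute)
  qed
  then have r: "geodesic_ray r" by (auto simp: geodesic_ray_def r_def extensional_def)
  have r0: "r 0 = \<iota> b" by (simp add: r_def)
  obtain \<omega> where \<omega>: "\<omega> \<in> ideal_boundary" "ray_from (r 0) \<omega> = r"
    by (rule ideal_point_of_ray[OF r]) (rule that)
  have ray: "ray_from (\<iota> b) \<omega> s = \<iota> (b - s *\<^sub>R e)" if "0 \<le> s" for s
    using \<omega>(2) that unfolding r0 by (simp add: r_def)
  have ne: "b \<noteq> b - e" using e by auto
  have "sgn (- e) = - e" using e by (simp add: sgn_div_norm)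
  then have "\<theta> (\<iota> b) (ray_from (\<iota> b) \<omega> 1) = weyl_orbit G (- e)"
    using EB3_direction[OF \<iota> ne] ray[of 1] by simp
  then have "\<theta> q (ray_from q \<omega> 1) = weyl_orbit G (- e)" for q
    using direction_ideal_point[OF \<omega>(1), of q "\<iota> b"] by simp
  with \<omega>(1) ray show thesis by (rule that)
qed

text \<open>
  If the fixed points \<open>x\<close> of the contractions escape to infinity, the directions from \<open>x\<close> back to
  \<open>p\<close> subconverge in the model space. Within an apartment through \<open>p\<close> and \<open>x\<close>, the ray from
  \<open>x\<close> in the limit direction, to \<open>\<omega>\<close> say, still passes near \<open>p\<close>, and its type does not depend on \<open>x\<close>;
  so the slopes along rays to \<open>\<omega>\<close> lie in a fixed finite set. Semistability excludes that the sum of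
  the slopes at distance \<open>L\<close> from \<open>x\<close> is positive, and by quantization this sum bounds the
  increment of the Busemann function of \<open>\<omega>\<close> from \<open>x\<close> to its image. But the image lies on the
  extension of the segment \<open>p x\<close> beyond \<open>x\<close>, hence further away from \<open>\<omega>\<close> than \<open>x\<close>.
\<close>

lemma fixed_point_semistable:
  fixes c :: "'a config"
  assumes c: "weighted_configuration c" and semistable: "semistable_configuration c"
  shows "\<exists>x. weak_contraction c x = x"
proof (rule ccontr)
  assume no: "\<nexists>x. weak_contraction c x = x"
  define p :: 'a where "p = undefined"
  define f where "f = config_busemann p c"
  define M where "M = config_weight c"
  have M: "M \<ge> 0" unfolding M_def by (rule config_weight_nonneg[OF c])
  obtain X where inf: "filterlim (\<lambda>n. dist p (X n)) at_top sequentially"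
      and X: "\<And>n. \<exists>l\<in>{0<..<1}. X n = conv p (weak_contraction c (X n)) l"
    using fixed_point_or_escape[of "weak_contraction c" p] weak_contraction_nonexpansive[OF c] no by blast
  \<comment> \<open>The charts vary with n and are not related to each other; only the coordinate
    directions from \<open>p\<close> to \<open>X n\<close>, in the fixed model space, are
    compared.\<close>
  have "\<exists>\<iota> a b. \<iota> \<in> \<A> \<and> p = \<iota> a \<and> X n = \<iota> b" for n by (rule chart_through[of p "X n"]) blast
  then obtain \<iota> a b where chart: "\<And>n. \<iota> n \<in> \<A>" "\<And>n. p = \<iota> n (a n)" "\<And>n. X n = \<iota> n (b n)"
    by metis
  have dist_ab: "norm (b n - a n) = dist p (X n)" for n
  proof -
    have "dist p (X n) = dist (\<iota> n (a n)) (\<iota> n (b n))" using chart(2,3)[of n] by simp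
    then show ?thesis by (simp add: EB3_isometric[OF chart(1)] dist_norm norm_minus_commute)
  qed
  have unit: "\<forall>n. sgn (b n - a n) \<in> cball 0 1" by (simp add: norm_sgn)
  obtain e k where k: "strict_mono (k :: nat \<Rightarrow> nat)"
      and lim: "((\<lambda>n. sgn (b n - a n)) \<circ> k) \<longlonglongrightarrow> e"
    by (rule seq_compactE[OF compact_cball[unfolded compact_eq_seq_compact_metric] unit]) (rule that)
  have inf': "filterlim (\<lambda>n. dist p (X (k n))) at_top sequentially"
    by (rule filterlim_compose[OF inf filterlim_subseq[OF k]])
  have large: "eventually (\<lambda>n. R \<le> dist p (X (k n))) sequentially" for R
    using inf' unfolding filterlim_at_top by blast
  have e: "norm e = 1"
  proof (rule LIMSEQ_unique[OF tendsto_norm[OF lim]])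
    have "eventually (\<lambda>n. norm (((\<lambda>n. sgn (b n - a n)) \<circ> k) n) = 1) sequentially"
      using large[of 1]
    proof eventually_elim
      case (elim n)
      then have "b (k n) - a (k n) \<noteq> 0" using dist_ab[of "k n"] by auto
      then show ?case by (simp add: norm_sgn)
    qed
    then show "(\<lambda>n. norm (((\<lambda>n. sgn (b n - a n)) \<circ> k) n)) \<longlonglongrightarrow> 1" by (rule tendsto_eventually)
  qed
  \<comment> \<open>All slopes towards a boundary point of the type of -e, at any point of X; fixed
    before the boundary point itself is chosen.\<close>
  define S where "S = (\<Union>(\<xi>, m)\<in>set c. (\<lambda>(v, w). - (v \<bullet> w)) ` (weyl_orbit G (- e) \<times> \<theta> p (ray_from p \<xi> 1)))"
  have "finite S"
  proof -
    have "finite (\<theta> p (ray_from p \<xi> 1))" if "(\<xi>, m) \<in> set c" for \<xi> m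
    proof (rule direction_props(1))
      have "\<xi> \<in> ideal_boundary" using c that by (auto simp: weighted_configuration_def)
      then show "p \<noteq> ray_from p \<xi> 1" by (rule ray_from_ne) simp
    qed
    then show ?thesis unfolding S_def using finite_weyl_orbit[OF affine_weyl_group] by auto
  qed
  then have "finite ((\<lambda>(s, t). s - t) ` (S \<times> S))" by simp
  then obtain g where g: "0 < g" "\<And>s t. s \<in> S \<Longrightarrow> t \<in> S \<Longrightarrow> t < s \<Longrightarrow> g \<le> s - t"
    by (rule finite_positive_gap) (force intro: that)
  \<comment> \<open>The possible values of the weighted sum \<open>K\<close> below, whose least
    positive one is at least \<open>s0\<close>.\<close>
  define KS where "KS = {\<Sum>(\<xi>, m)\<leftarrow>c. m * \<kappa> \<xi> | \<kappa>. \<forall>(\<xi>, m)\<in>set c. \<kappa> \<xi> \<in> S}"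
  have "finite KS" unfolding KS_def by (rule finite_weighted_sums[OF \<open>finite S\<close>])
  then obtain s0 where s0: "0 < s0" "\<And>K. K \<in> KS \<Longrightarrow> 0 < K \<Longrightarrow> s0 \<le> K"
    by (rule finite_positive_gap) (rule that)
  \<comment> \<open>Meets the requirement 2 M < L g of \<open>ray_slope_le_of_gap\<close> for points
    within M of \<open>x\<close>.\<close>
  define L where "L = 2 * M / g + 1"
  have L: "L > 0" "2 * M < L * g"
    using M g(1) by (auto simp: L_def field_simps add_nonneg_pos)
  \<comment> \<open>The ray from \<open>x\<close> will pass within R h of \<open>p\<close>. There f
    is at most R s0 / 4 as M h \<le> s0 / 4, and h < 1 makes the Busemann function of the ray
    negative at \<open>p\<close>.\<close>
  define h where "h = min (1 / 2) (s0 / (4 * (M + 1)))"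
  have h: "0 < h" "h < 1" "M * h \<le> s0 / 4"
  proof -
    show "0 < h" "h < 1" using s0(1) M by (auto simp: h_def)
    have "M * h \<le> (M + 1) * h" using \<open>0 < h\<close> by (intro mult_right_mono) auto
    also have "\<dots> \<le> (M + 1) * (s0 / (4 * (M + 1)))" using M by (intro mult_left_mono) (auto simp: h_def)
    also have "\<dots> = s0 / 4" using M by (simp add: field_simps)
    finally show "M * h \<le> s0 / 4" .
  qed
  obtain R0 where R0: "\<And>x. R0 \<le> dist p x \<Longrightarrow> - (s0 / 4) * dist p x < f x"
    using semistable_sublinear_lower_bound[OF c semistable, of "s0 / 4" p] s0(1) by (auto simp: f_def)
  \<comment> \<open>If K \<ge> s0, the estimates below give R < 2 L (s0 + M) / s0; the summand L
    also keeps \<open>z\<close> on the piece of the ray before parameter R.\<close>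
  define R1 where "R1 = max R0 (L + 2 * L * (s0 + M) / s0 + 1)"
  have "eventually (\<lambda>n. R1 \<le> dist p (X (k n)) \<and> dist (((\<lambda>n. sgn (b n - a n)) \<circ> k) n) e < h) sequentially"
    using large[of R1] tendstoD[OF lim h(1)] by eventually_elim simp
  then obtain n where n: "R1 \<le> dist p (X (k n))" "dist (sgn (b (k n) - a (k n))) e < h"
    using eventually_happens'[OF sequentially_bot] by fastforce
  define x where "x = X (k n)"
  define R where "R = dist p x"
  have R: "R0 \<le> R" "L + 2 * L * (s0 + M) / s0 + 1 \<le> R" using n(1) by (simp_all add: R1_def R_def x_def)
  have quot: "2 * L * (s0 + M) / s0 \<ge> 0" using L s0(1) M by simp
  have RL: "L \<le> R" "0 < R" using R(2) L(1) quot by linarith+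
  obtain \<omega> where \<omega>: "\<omega> \<in> ideal_boundary"
      and ray: "\<And>s. 0 \<le> s \<Longrightarrow> ray_from (\<iota> (k n) (b (k n))) \<omega> s = \<iota> (k n) (b (k n) - s *\<^sub>R e)"
      and type_\<omega>: "\<And>q. \<theta> q (ray_from q \<omega> 1) = weyl_orbit G (- e)"
    by (rule apartment_ray[OF chart(1)[of "k n"] e, of "b (k n)"]) (rule that)
  have slopes: "ray_slope q \<omega> \<xi> \<in> S" if "(\<xi>, m) \<in> set c" for q \<xi> m
  proof -
    have "\<xi> \<in> ideal_boundary" using c that by (auto simp: weighted_configuration_def)
    from ray_slope_finite_values[OF \<omega> this, of q p p] that show ?thesis
      unfolding type_\<omega> S_def by blast
  qed
  have near: "dist p (ray_from x \<omega> R) < R * h"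
  proof -
    have "ray_from x \<omega> R = \<iota> (k n) (b (k n) - R *\<^sub>R e)"
      using ray[of R] RL(2) chart(3)[of "k n"] by (simp add: x_def)
    then have "dist p (ray_from x \<omega> R) = dist (\<iota> (k n) (a (k n))) (\<iota> (k n) (b (k n) - R *\<^sub>R e))"
      using chart(2)[of "k n"] by simp
    also have "\<dots> = norm ((b (k n) - a (k n)) - R *\<^sub>R e)"
      by (simp add: EB3_isometric[OF chart(1)] dist_norm norm_minus_commute algebra_simps)
    also have "b (k n) - a (k n) = R *\<^sub>R sgn (b (k n) - a (k n))"
      using dist_ab[of "k n"] RL(2) by (simp add: sgn_div_norm R_def x_def)
    also have "norm (R *\<^sub>R sgn (b (k n) - a (k n)) - R *\<^sub>R e) = R * dist (sgn (b (k n) - a (k n))) e"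
      using RL(2) by (simp add: dist_norm flip: scaleR_diff_right)
    also have "\<dots> < R * h" using n(2) RL(2) by simp
    finally show ?thesis .
  qed
  define z where "z = ray_from x \<omega> L"
  define K where "K = (\<Sum>(\<xi>, m)\<leftarrow>c. m * ray_slope z \<omega> \<xi>)"
  have "K \<in> KS" unfolding KS_def K_def using slopes by blast
  \<comment> \<open>Otherwise f would rise by at least (R - L) s0 from \<open>z\<close> to the point
    near \<open>p\<close>, where it is at most R s0 / 4; but at \<open>x\<close>, and so up to M L
    at \<open>z\<close>, it is above -R s0 / 4.\<close>
  have "K \<le> 0"
  proof (rule ccontr)
    assume "\<not> K \<le> 0"
    then have "s0 \<le> K" using s0(2)[OF \<open>K \<in> KS\<close>] by simp
    then have "(R - L) * s0 \<le> (R - L) * K" using RL(1) by (intro mult_left_mono) auto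
    also have "f z + (R - L) * K \<le> f (ray_from z \<omega> (R - L))"
      unfolding f_def K_def using RL(1) by (intro config_busemann_ray_ge \<omega> c) simp
    then have "(R - L) * K \<le> f (ray_from z \<omega> (R - L)) - f z" by simp
    also have "ray_from z \<omega> (R - L) = ray_from x \<omega> R"
      using ray_from_ray_from[OF \<omega>, of L "R - L" x] L(1) RL(1) by (simp add: z_def)
    finally have 1: "(R - L) * s0 \<le> f (ray_from x \<omega> R) - f z" .
    have lip: "\<bar>f u - f v\<bar> \<le> M * dist u v" for u v
      unfolding f_def M_def by (rule config_busemann_lipschitz[OF c])
    have "f p = 0" unfolding f_def by (rule config_busemann_self[OF c])
    then have "f (ray_from x \<omega> R) \<le> M * dist p (ray_from x \<omega> R)"
      using lip[of "ray_from x \<omega> R" p] by (simp add: dist_commute)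
    also have "\<dots> \<le> M * (R * h)" using near M by (intro mult_left_mono) auto
    also have "\<dots> = R * (M * h)" by simp
    also have "\<dots> \<le> R * (s0 / 4)" using h(3) RL(2) by (intro mult_left_mono) auto
    finally have 2: "f (ray_from x \<omega> R) \<le> R * (s0 / 4)" .
    have 3: "f x - M * L \<le> f z"
      using lip[of x z] dist_ray_from_start[OF \<omega>, of L x] L(1) by (simp add: z_def)
    have 4: "- (s0 / 4) * R < f x" using R0[of x] R(1) by (simp add: R_def)
    have "R * (s0 / 2) < L * (s0 + M)"
      using 1 2 3 4 by (simp add: algebra_simps)
    then have "R * s0 < 2 * L * (s0 + M)" by simp
    then have "R < 2 * L * (s0 + M) / s0" using s0(1) by (simp add: pos_less_divide_eq)
    then show False using R(2) L(1) by linarith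
  qed
  have x_weak: "busemann (ray_from x \<omega>) (weak_contraction c x) - busemann (ray_from x \<omega>) x \<le> K"
    unfolding K_def
  proof (rule busemann_weak_contraction_le[OF \<omega> c])
    fix q \<xi> m assume q: "dist q x \<le> config_weight c" "(\<xi>, m) \<in> set c"
    then have \<xi>: "\<xi> \<in> ideal_boundary" using c by (auto simp: weighted_configuration_def)
    show "ray_slope q \<omega> \<xi> \<le> ray_slope z \<omega> \<xi>"
      unfolding z_def
      by (rule ray_slope_le_of_gap[OF \<omega> \<xi> q(1), of L g])
        (use L g(2) slopes[OF q(2)] in \<open>auto simp: M_def\<close>)
  qed
  have b0: "busemann (ray_from x \<omega>) x = 0" by (rule busemann_ray_from_self[OF \<omega>])
  obtain l where l: "l \<in> {0<..<1}" "x = conv p (weak_contraction c x) l" using X unfolding x_def by blast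
  \<comment> \<open>Convexity on the segment from \<open>p\<close> through \<open>x\<close> to the
    image, with value 0 at \<open>x\<close>: both values at the ends turn out to be at most 0, that
    at \<open>p\<close> strictly less.\<close>
  have "0 \<le> (1 - l) * busemann (ray_from x \<omega>) p + l * busemann (ray_from x \<omega>) (weak_contraction c x)"
    using busemann_convex[OF geodesic_ray_ray_from[OF \<omega>, of x], of l p "weak_contraction c x"] l b0 by simp
  moreover have "busemann (ray_from x \<omega>) p < 0"
  proof -
    have "busemann (ray_from x \<omega>) p \<le> dist p (ray_from x \<omega> R) - R"
      by (rule busemann_le[OF geodesic_ray_ray_from[OF \<omega>]]) (use RL in simp)
    also have "\<dots> < R * h - R" using near by simp
    also have "\<dots> \<le> 0" using h(2) RL(2) by simp
    finally show ?thesis .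
  qed
  then have "(1 - l) * busemann (ray_from x \<omega>) p < 0" using l(1) by (simp add: mult_pos_neg)
  moreover have "l * busemann (ray_from x \<omega>) (weak_contraction c x) \<le> 0"
    using x_weak b0 \<open>K \<le> 0\<close> l(1) by (intro mult_nonneg_nonpos) auto
  ultimately show False by linarith
qed

end


section \<open>Polygons from fixed points\<close>

lemma weak_contraction_append:
  "weak_contraction (c @ d) x = weak_contraction d (weak_contraction c x)"
  by (simp add: weak_contraction_def)

text \<open>The vertices are the successive images of the fixed point under the pushes; positive
  weights make neighbours distinct.\<close>

lemma polygon_of_fixed_point:
  assumes c: "weighted_configuration c" and x: "weak_contraction c x = x"
  shows "\<exists>p. polygon p \<and> gauss_map c p"
proof -
  define y where "y i = weak_contraction (take i c) x" for i
  define p where "p = map y [0..<length c]"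
  have len: "length p = length c" by (simp add: p_def)
  have step: "y (Suc i) = ray_from (y i) (fst (c ! i)) (snd (c ! i))" if "i < length c" for i
    using that by (cases "c ! i") (simp add: y_def take_Suc_conv_app_nth weak_contraction_append)
  \<comment> \<open>Only the wrap-around needs the fixed point: the vertex after the last one is the
    full image of \<open>x\<close>, that is \<open>x\<close> itself.\<close>
  have next_vertex: "p ! (Suc i mod length p) = y (Suc i)" if i: "i < length c" for i
  proof (cases "Suc i = length c")
    case True
    have "0 < length c" using i by linarith
    then have "p ! 0 = y 0" by (simp add: p_def)
    moreover have "y 0 = x" "y (Suc i) = x" using True x by (simp_all add: y_def)
    ultimately show ?thesis using True by (simp add: len)
  next
    case False
    then show ?thesis using i by (simp add: p_def)
  qed
  have entry: "fst (c ! i) \<in> ideal_boundary" "snd (c ! i) > 0" if "i < length c" for i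
    using c nth_mem[OF that] by (auto simp: weighted_configuration_def)
  have vertex: "p ! i = y i" if "i < length c" for i using that by (simp add: p_def)
  have d: "dist (p ! i) (p ! (Suc i mod length p)) = snd (c ! i)" if i: "i < length c" for i
    unfolding next_vertex[OF i] vertex[OF i] step[OF i]
    using dist_ray_from_start[OF entry(1)[OF i]] entry(2)[OF i] by simp
  have "polygon p"
    unfolding polygon_def
  proof (intro allI impI)
    fix i assume "i < length p"
    then have "dist (p ! i) (p ! (Suc i mod length p)) > 0" using d[of i] entry(2)[of i] len by simp
    then show "p ! i \<noteq> p ! (Suc i mod length p)" by auto
  qed
  moreover have "gauss_map c p"
    unfolding gauss_map_def
  proof (intro conjI allI impI)
    show "length c = length p" by (simp add: len)
    fix i assume "i < length p"
    then have i: "i < length c" by (simp add: len)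
    show "p ! (Suc i mod length p) \<in> ray_from (p ! i) (fst (c ! i)) ` {0..}"
      unfolding next_vertex[OF i] vertex[OF i] step[OF i] using entry(2)[OF i] by (intro imageI) simp
    show "snd (c ! i) = dist (p ! i) (p ! (Suc i mod length p))" using d[OF i] by simp
  qed
  ultimately show ?thesis by blast
qed

theorem mainTheorem1:
  fixes c :: "'a::hadamard_space config"
    and G :: "(real^'d \<Rightarrow> real^'d) set"
    and \<theta> :: "'a \<Rightarrow> 'a \<Rightarrow> (real^'d) set"
    and \<A> :: "(real^'d \<Rightarrow> 'a) set"
  assumes "weighted_configuration c"
    and "(euclidean_building G \<theta> \<A> \<and> semistable_configuration c) \<or>
         (locally compact (UNIV :: 'a set) \<and> stable_configuration c)"
  shows "(\<exists>x. weak_contraction c x = x) \<and> (\<exists>p. polygon p \<and> gauss_map c p)"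
proof -
  obtain x where "weak_contraction c x = x"
    using assms euclidean_building.fixed_point_semistable fixed_point_locally_compact by blast
  then show ?thesis using polygon_of_fixed_point[OF assms(1)] by blast
qed

end
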